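(* Let $d\in\mathbb{N}$, $m\in\mathbb{N}_0$. Let $\rho,\pi$ be probability measures on $[-1,1]^d$ with $\mu$-densities $f_\rho,f_\pi$ satisfying Assumption (A) for some constants $0<M\le L<\infty$, $\boldsymbol\delta\in(0,\infty)^d$ and with $C_6=C_6(M,L)$, where $C_6(M,L),C_7(M,L)$ are the regularity constants described in the context. For $j\in\{1,\dots,d\}$ set $\varrho_j:=1+C_7\delta_j$; for $k\in\{1,\dots,d\}$ and $\varepsilon>0$ let $$\Lambda_{k,\varepsilon}:=\Big\{\boldsymbol\nu\in\mathbb{N}_0^k:\ \varrho_k^{-\max\{1,\nu_k\}}\prod_{j=1}^{k-1}\varrho_j^{-\nu_j}\ge\varepsilon\Big\},\qquad \beta:=\Big((d-1)!\prod_{j=1}^d\log(\varrho_j)\Big)^{1/d}.$$ Let $T$ be the Knothe--Rosenblatt transport from $\rho$ to $\pi$. Then for every $\tilde\beta<\beta$ there exists $C>0$ (depending on $\boldsymbol\varrho,m,d,\tilde\beta,f_\rho,f_\pi$), and for every $\varepsilon\in(0,1)$ there exist polynomials $p_{k,\varepsilon}\in\mathbb{P}_{\Lambda_{k,\varepsilon}}$, $k\in\{1,\dots,d\}$, such that with $$\tilde T_{k,\varepsilon}(\boldsymbol x):=-1+\frac{2}{c_{k,\varepsilon}(\boldsymbol x_{[k-1]})}\int_{-1}^{x_k}(1+p_{k,\varepsilon}(\boldsymbol x_{[k-1]},t))^2\,dt,\qquad c_{k,\varepsilon}(\boldsymbol x_{[k-1]}):=\int_{-1}^1(1+p_{k,\varepsilon}(\boldsymbol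 x_{[k-1]},t))^2\,dt,$$ the map $\tilde T_\varepsilon:=(\tilde T_{k,\varepsilon})_{k=1}^d:[-1,1]^d\to[-1,1]^d$ is a monotone triangular bijection, and with $N_\varepsilon:=\sum_{k=1}^d|\Lambda_{k,\varepsilon}|$ it holds $$\|T-\tilde T_\varepsilon\|_{W^{m,\infty}([-1,1]^d)}\le C\exp(-\tilde\beta N_\varepsilon^{1/d}).$$
   Context: $\mu$ is the product measure $\bigotimes_j\lambda/2$ on $[-1,1]^k$ ($\lambda$ Lebesgue measure on $[-1,1]$). A probability density on $[-1,1]^d$ is a measurable positive function $f$ with $\int f\,d\mu=1$. $\boldsymbol x_{[k]}=(x_1,\dots,x_k)$. For $\delta>0$, $S\subseteq\mathbb{C}$: $\mathcal{B}_\delta(S)=\{z\in\mathbb{C}:\exists y\in S,|z-y|<\delta\}$; for $\boldsymbol\delta\in(0,\infty)^d$: $\mathcal{B}_{\boldsymbol\delta}(S)=\prod_i\mathcal{B}_{\delta_i}(S)$, $\mathcal{B}_{\boldsymbol\delta}=\prod_i\mathcal{B}_{\delta_i}(0)$. $C^1(O;B)$ for open $O\subseteq\mathbb{C}^n$ means holomorphic functions on $O$ with values in $B$; for a function given on $[-1,1]^n$ it means that a holomorphic extension (denoted by the same symbol) exists. Assumption (A) with constants $M,L,\boldsymbol\delta,C_6$: for $*\in\{\rho,\pi\}$: (a) $f_*:[-1,1]^d\to(0,\infty)$ is a probability density and $f_*\in C^1(\mathcal{B}_{\boldsymbol\delta}([-1,1]);\mathbb{C})$; (b) $M\le|f_*(\boldsymbol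 x)|\le L$ for $\boldsymbol x\in\mathcal{B}_{\boldsymbol\delta}([-1,1])$; (c) $\sup_{\boldsymbol y\in\mathcal{B}_{\boldsymbol\delta}}|f_*(\boldsymbol x+\boldsymbol y)-f_*(\boldsymbol x)|\le C_6$ for $\boldsymbol x\in[-1,1]^d$; (d) $\sup_{\boldsymbol y\in\mathcal{B}_{\boldsymbol\delta_{[k]}}\times\{0\}^{d-k}}|f_*(\boldsymbol x+\boldsymbol y)-f_*(\boldsymbol x)|\le C_6\delta_{k+1}$ for $\boldsymbol x\in[-1,1]^d$, $k\in\{1,\dots,d-1\}$. Knothe--Rosenblatt transport: for a density $f$ put $\hat f_0:=1$, $\hat f_k(\boldsymbol x_{[k]}):=\int_{[-1,1]^{d-k}}f(\boldsymbol x_{[k]},\boldsymbol t)\,d\mu(\boldsymbol t)$, $f_k(\boldsymbol x_{[k]}):=\hat f_k(\boldsymbol x_{[k]})/\hat f_{k-1}(\boldsymbol x_{[k-1]})$; with $f=f_*$ put $F_{*;k}(\boldsymbol x_{[k]}):=\int_{-1}^{x_k}f_{*;k}(\boldsymbol x_{[k-1]},t)\,dt$. Then $T_1:=(F_{\pi;1})^{-1}\circ F_{\rho;1}$ and $T_k(\boldsymbol x_{[k-1]},\cdot):=F_{\pi;k}(T_1(x_1),\dots,T_{k-1}(\boldsymbol x_{[k-1]}),\cdot)^{-1}\circ F_{\rho;k}(\boldsymbol x_{[k-1]},\cdot)$ (inverse in the last variable); $T=(T_k)_{k=1}^d$. Regularity constants: for $0<M\le L<\infty$, $C_6,C_7,C_8>0$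 are constants depending only on $M,L$ such that, for all $d$ and $\boldsymbol\delta$, whenever $f_\rho,f_\pi$ satisfy Assumption (A) with $M,L,\boldsymbol\delta,C_6$, then with $\zeta_j=C_7\delta_j$ and $R_k=\partial_{x_k}T_k$, for all $k\in\{1,\dots,d\}$: $R_k\in C^1(\mathcal{B}_{\boldsymbol\zeta_{[k]}}([-1,1]);\mathcal{B}_{C_8}(1))$, $\Re R_k\ge1/C_8$ on $\mathcal{B}_{\boldsymbol\zeta_{[k]}}([-1,1])$, and if $k\ge2$, $R_k$ maps $\mathcal{B}_{\boldsymbol\zeta_{[k-1]}}([-1,1])\times[-1,1]$ to $\mathcal{B}_{C_8/\max\{1,\delta_k\}}(1)$. (Such constants exist; fix one choice.) $\mathbb{P}_\Lambda:=\operatorname{span}_{\mathbb{R}}\{\boldsymbol x^{\boldsymbol\nu}:\boldsymbol\nu\in\Lambda\}$, with $\mathbb{P}_\emptyset=\{0\}$. A map $(T_j)_{j=1}^d$ on $[-1,1]^d$ is triangular if each $T_j$ depends only on $\boldsymbol x_{[j]}$, and monotone if $x_j\mapsto T_j(\boldsymbol x_{[j-1]},x_j)$ is monotonically increasing for all $\boldsymbol x_{[j-1]}\in[-1,1]^{j-1}$ and all $j$. $\|f\|_{W^{m,\infty}([-1,1]^d)}=\sum_{j=0}^m\operatorname{ess\,sup}_{\boldsymbol x}\|d^jf(\boldsymbol x)\|$ (weak $j$th derivative, Euclidean norm); for vector-valued maps the norm is the sum over components. *)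

theory Defs
  imports "HOL-Probability.Probability"
begin

text \<open>
  Dimensions vary inside the definitions below, so a point of an $n$-dimensional space is an
  extensional function on the index set \<open>{1..n}\<close>, that is, an element of \<open>{1..n} \<rightarrow>\<^sub>E _\<close>.
  The first \<open>k\<close> coordinates of a point are selected by \<open>restrict\<close>, \<open>merge\<close> or by products
  over \<open>{1..k}\<close>; replacing the last coordinate is \<open>x(k := t)\<close>.
\<close>

definition cube :: "nat \<Rightarrow> (nat \<Rightarrow> real) set" where
  "cube n = {1..n} \<rightarrow>\<^sub>E {-1..1}"

definition half_lebesgue :: "real measure" where
  "half_lebesgue = scale_measure (1 / 2) (restrict_space lborel {-1..1})"

abbreviation cube_measure :: "nat set \<Rightarrow> (nat \<Rightarrow> real) measure" where
  "cube_measure I \<equiv> Pi\<^sub>M I (\<lambda>_. half_lebesgue)"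

definition prob_density :: "nat \<Rightarrow> ((nat \<Rightarrow> real) \<Rightarrow> real) \<Rightarrow> bool" where
  "prob_density d f \<longleftrightarrow>
     f \<in> borel_measurable (cube_measure {1..d}) \<and>
     (\<forall>x\<in>cube d. 0 < f x) \<and>
     has_bochner_integral (cube_measure {1..d}) f 1"


section \<open>Holomorphic functions of several variables\<close>

definition nbhd :: "real \<Rightarrow> complex set \<Rightarrow> complex set" where
  "nbhd \<delta> S = {z. \<exists>y\<in>S. cmod (z - y) < \<delta>}"

abbreviation unit_segment :: "complex set" where
  "unit_segment \<equiv> complex_of_real ` {-1..1}"

definition cplx :: "nat \<Rightarrow> (nat \<Rightarrow> real) \<Rightarrow> nat \<Rightarrow> complex" where
  "cplx n x = (\<lambda>i\<in>{1..n}. complex_of_real (x i))"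

text \<open>
  Complex Frechet differentiability at every point of \<open>U\<close>, an open subset of \<open>{1..n} \<rightarrow>\<^sub>E UNIV\<close>;
  \<open>a\<close> is the complex gradient at \<open>z\<close>. (The type \<open>nat \<Rightarrow> complex\<close> carries no norm,
  hence \<open>has_derivative\<close> is not available.)
\<close>

definition holomorphic_vars_on ::
    "nat \<Rightarrow> ((nat \<Rightarrow> complex) \<Rightarrow> complex) \<Rightarrow> (nat \<Rightarrow> complex) set \<Rightarrow> bool" where
  "holomorphic_vars_on n f U \<longleftrightarrow>
     (\<forall>z\<in>U. \<exists>a :: nat \<Rightarrow> complex. \<forall>e>0. \<exists>r>0. \<forall>w\<in>U.
        L2_set (\<lambda>j. cmod (w j - z j)) {1..n} < r \<longrightarrow>
        cmod (f w - f z - (\<Sum>j\<in>{1..n}. a j * (w j - z j)))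
          \<le> e * L2_set (\<lambda>j. cmod (w j - z j)) {1..n})"

text \<open>
  The witness \<open>g\<close> is the holomorphic extension of \<open>f\<close>; it is unique, the domain being connected.
  The last two conjuncts spell out bounds on suprema over polydiscs.
\<close>

definition assumption_A ::
    "nat \<Rightarrow> real \<Rightarrow> real \<Rightarrow> (nat \<Rightarrow> real) \<Rightarrow> real \<Rightarrow> ((nat \<Rightarrow> real) \<Rightarrow> real) \<Rightarrow> bool" where
  "assumption_A d M L \<delta> C6 f \<longleftrightarrow>
     prob_density d f \<and>
     (\<exists>g. holomorphic_vars_on d g (\<Pi>\<^sub>E i\<in>{1..d}. nbhd (\<delta> i) unit_segment) \<and>
        (\<forall>x\<in>cube d. g (cplx d x) = complex_of_real (f x)) \<and>
        (\<forall>z\<in>(\<Pi>\<^sub>E i\<in>{1..d}. nbhd (\<delta> i) unit_segment). M \<le> cmod (g z) \<and> cmod (g z) \<le> L) \<and>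
        (\<forall>x\<in>cube d. \<forall>y\<in>(\<Pi>\<^sub>E i\<in>{1..d}. nbhd (\<delta> i) {0}).
           cmod (g (\<lambda>i\<in>{1..d}. cplx d x i + y i) - g (cplx d x)) \<le> C6) \<and>
        (\<forall>x\<in>cube d. \<forall>k\<in>{1..<d}.
           \<forall>y\<in>(\<Pi>\<^sub>E i\<in>{1..d}. if i \<le> k then nbhd (\<delta> i) {0} else {0}).
             cmod (g (\<lambda>i\<in>{1..d}. cplx d x i + y i) - g (cplx d x)) \<le> C6 * \<delta> (k + 1)))"


section \<open>Knothe--Rosenblatt transport\<close>

text \<open>
  \<open>marginal d f k\<close>, \<open>cond_density d f k\<close> and \<open>cond_cdf d f k\<close> depend on the coordinates
  \<open>1, \<dots>, k\<close> of their argument only.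
\<close>

definition marginal :: "nat \<Rightarrow> ((nat \<Rightarrow> real) \<Rightarrow> real) \<Rightarrow> nat \<Rightarrow> (nat \<Rightarrow> real) \<Rightarrow> real" where
  "marginal d f k x =
     (if k = 0 then 1
      else (\<integral>t. f (merge {1..k} {k+1..d} (x, t)) \<partial>cube_measure {k+1..d}))"

definition cond_density :: "nat \<Rightarrow> ((nat \<Rightarrow> real) \<Rightarrow> real) \<Rightarrow> nat \<Rightarrow> (nat \<Rightarrow> real) \<Rightarrow> real" where
  "cond_density d f k x = marginal d f k x / marginal d f (k - 1) x"

definition cond_cdf :: "nat \<Rightarrow> ((nat \<Rightarrow> real) \<Rightarrow> real) \<Rightarrow> nat \<Rightarrow> (nat \<Rightarrow> real) \<Rightarrow> real" where
  "cond_cdf d f k x = integral {-1..x k} (\<lambda>t. cond_density d f k (x(k := t)))"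

text \<open>
  \<open>KR_transport d f g k\<close> is the \<open>k\<close>-th component of the transport from density \<open>f\<close> to density
  \<open>g\<close>. The inner function lists the images of the first \<open>k - 1\<close> coordinates followed by \<open>t\<close> at
  position \<open>k\<close>; its values at \<open>0\<close> and beyond \<open>k\<close> are ignored by \<open>cond_cdf d g k\<close>.
\<close>

fun KR_transport ::
    "nat \<Rightarrow> ((nat \<Rightarrow> real) \<Rightarrow> real) \<Rightarrow> ((nat \<Rightarrow> real) \<Rightarrow> real) \<Rightarrow> nat \<Rightarrow> (nat \<Rightarrow> real) \<Rightarrow> real"
where
  "KR_transport d f g k x =
     inv_into {-1..1}
       (\<lambda>t. cond_cdf d g k (\<lambda>j. if j < k then KR_transport d f g j x else t))
       (cond_cdf d f k x)"

declare KR_transport.simps [simp del]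

text \<open>
  \<open>R\<close> is the holomorphic extension of the partial derivative of the \<open>k\<close>-th component with respect
  to its last variable, one-sided at the end points.
\<close>

definition regularity_constants :: "real \<Rightarrow> real \<Rightarrow> real \<Rightarrow> real \<Rightarrow> real \<Rightarrow> bool" where
  "regularity_constants M L C6 C7 C8 \<longleftrightarrow>
     0 < C6 \<and> 0 < C7 \<and> 0 < C8 \<and>
     (\<forall>d \<delta> f\<^sub>\<rho> f\<^sub>\<pi>.
        1 \<le> d \<longrightarrow> (\<forall>j\<in>{1..d}. 0 < \<delta> j) \<longrightarrow>
        assumption_A d M L \<delta> C6 f\<^sub>\<rho> \<longrightarrow> assumption_A d M L \<delta> C6 f\<^sub>\<pi> \<longrightarrow>
        (\<forall>k\<in>{1..d}. \<exists>R.
           (\<forall>x\<in>cube k. \<exists>D.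
              ((\<lambda>t. KR_transport d f\<^sub>\<rho> f\<^sub>\<pi> k (x(k := t))) has_real_derivative D)
                (at (x k) within {-1..1}) \<and>
              R (cplx k x) = complex_of_real D) \<and>
           holomorphic_vars_on k R (\<Pi>\<^sub>E i\<in>{1..k}. nbhd (C7 * \<delta> i) unit_segment) \<and>
           (\<forall>z\<in>(\<Pi>\<^sub>E i\<in>{1..k}. nbhd (C7 * \<delta> i) unit_segment).
              R z \<in> nbhd C8 {1} \<and> 1 / C8 \<le> Re (R z)) \<and>
           (2 \<le> k \<longrightarrow>
              (\<forall>z\<in>(\<Pi>\<^sub>E i\<in>{1..k}. if i < k then nbhd (C7 * \<delta> i) unit_segment else unit_segment).
                 R z \<in> nbhd (C8 / max 1 (\<delta> k)) {1}))))"


section \<open>Polynomial spaces and the rational approximation\<close>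

definition multi_index_set :: "(nat \<Rightarrow> real) \<Rightarrow> nat \<Rightarrow> real \<Rightarrow> (nat \<Rightarrow> nat) set" where
  "multi_index_set r k \<epsilon> =
     {\<nu> \<in> {1..k} \<rightarrow>\<^sub>E UNIV.
        \<epsilon> \<le> r k powi (- int (max 1 (\<nu> k))) * (\<Prod>j\<in>{1..<k}. r j powi (- int (\<nu> j)))}"

text \<open>
  Linear span of the monomials with exponents in \<open>\<Lambda>\<close>, written out because \<open>real_vector.span\<close> is
  not available on function types.
\<close>

definition polynomial_space :: "nat \<Rightarrow> (nat \<Rightarrow> nat) set \<Rightarrow> ((nat \<Rightarrow> real) \<Rightarrow> real) set" where
  "polynomial_space k \<Lambda> =
     {p. \<exists>S c. finite S \<and> S \<subseteq> \<Lambda> \<and>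
           p = (\<lambda>x. \<Sum>\<nu>\<in>S. c \<nu> * (\<Prod>j\<in>{1..k}. x j ^ \<nu> j))}"

definition approx_component ::
    "((nat \<Rightarrow> real) \<Rightarrow> real) \<Rightarrow> nat \<Rightarrow> (nat \<Rightarrow> real) \<Rightarrow> real" where
  "approx_component p k x =
     -1 + 2 / integral {-1..1} (\<lambda>t. (1 + p (x(k := t)))\<^sup>2)
          * integral {-1..x k} (\<lambda>t. (1 + p (x(k := t)))\<^sup>2)"

definition approx_map ::
    "nat \<Rightarrow> (nat \<Rightarrow> (nat \<Rightarrow> real) \<Rightarrow> real) \<Rightarrow> (nat \<Rightarrow> real) \<Rightarrow> nat \<Rightarrow> real" where
  "approx_map d p x = (\<lambda>k\<in>{1..d}. approx_component (p k) k x)"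

definition triangular :: "nat \<Rightarrow> ((nat \<Rightarrow> real) \<Rightarrow> nat \<Rightarrow> real) \<Rightarrow> bool" where
  "triangular d S \<longleftrightarrow>
     (\<forall>j\<in>{1..d}. \<forall>x\<in>cube d. \<forall>y\<in>cube d. (\<forall>i\<in>{1..j}. x i = y i) \<longrightarrow> S x j = S y j)"

definition monotone_triangular :: "nat \<Rightarrow> ((nat \<Rightarrow> real) \<Rightarrow> nat \<Rightarrow> real) \<Rightarrow> bool" where
  "monotone_triangular d S \<longleftrightarrow>
     triangular d S \<and> (\<forall>j\<in>{1..d}. \<forall>x\<in>cube d. mono_on {-1..1} (\<lambda>t. S (x(j := t)) j))"


section \<open>Sobolev norms on the cube\<close>

definition partial_deriv :: "nat \<Rightarrow> ((nat \<Rightarrow> real) \<Rightarrow> real) \<Rightarrow> (nat \<Rightarrow> real) \<Rightarrow> real" where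
  "partial_deriv i \<phi> x = deriv (\<lambda>t. \<phi> (x(i := t))) (x i)"

abbreviation partial_derivs :: "nat list \<Rightarrow> ((nat \<Rightarrow> real) \<Rightarrow> real) \<Rightarrow> (nat \<Rightarrow> real) \<Rightarrow> real" where
  "partial_derivs is \<equiv> foldr partial_deriv is"

definition smooth :: "nat \<Rightarrow> ((nat \<Rightarrow> real) \<Rightarrow> real) \<Rightarrow> bool" where
  "smooth d \<phi> \<longleftrightarrow>
     (\<forall>is\<in>lists {1..d}.
        continuous_on ({1..d} \<rightarrow>\<^sub>E UNIV) (partial_derivs is \<phi>) \<and>
        (\<forall>x\<in>{1..d} \<rightarrow>\<^sub>E UNIV. \<forall>i\<in>{1..d}.
           (\<lambda>t. partial_derivs is \<phi> (x(i := t))) differentiable (at (x i))))"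

definition test_function :: "nat \<Rightarrow> ((nat \<Rightarrow> real) \<Rightarrow> real) \<Rightarrow> bool" where
  "test_function d \<phi> \<longleftrightarrow>
     smooth d \<phi> \<and>
     (\<exists>K. compact K \<and> K \<subseteq> ({1..d} \<rightarrow>\<^sub>E {-1<..<1}) \<and>
          (\<forall>x\<in>({1..d} \<rightarrow>\<^sub>E UNIV) - K. \<phi> x = 0))"

definition locally_integrable :: "nat \<Rightarrow> ((nat \<Rightarrow> real) \<Rightarrow> real) \<Rightarrow> bool" where
  "locally_integrable d f \<longleftrightarrow>
     f \<in> borel_measurable (cube_measure {1..d}) \<and>
     (\<forall>K. compact K \<and> K \<subseteq> ({1..d} \<rightarrow>\<^sub>E {-1<..<1}) \<longrightarrow> set_integrable (cube_measure {1..d}) K f)"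

text \<open>
  The normalisation of \<open>cube_measure\<close> affects neither weak derivatives nor essential suprema.
\<close>

definition weak_deriv ::
    "nat \<Rightarrow> nat list \<Rightarrow> ((nat \<Rightarrow> real) \<Rightarrow> real) \<Rightarrow> ((nat \<Rightarrow> real) \<Rightarrow> real) \<Rightarrow> bool" where
  "weak_deriv d is f g \<longleftrightarrow>
     locally_integrable d f \<and> locally_integrable d g \<and>
     (\<forall>\<phi>. test_function d \<phi> \<longrightarrow>
        (\<integral>x. f x * partial_derivs is \<phi> x \<partial>cube_measure {1..d})
          = (-1) ^ length is * (\<integral>x. g x * \<phi> x \<partial>cube_measure {1..d}))"

text \<open>
  The \<open>j\<close>-th derivative is the tensor of all partial derivatives along index lists of length \<open>j\<close>.
  Weak derivatives being unique almost everywhere, the infimum ranges over at most one value;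
  it is infinite if some weak derivative does not exist.
\<close>

definition sobolev_norm :: "nat \<Rightarrow> nat \<Rightarrow> ((nat \<Rightarrow> real) \<Rightarrow> real) \<Rightarrow> ereal" where
  "sobolev_norm d m f =
     (INF D \<in> {D. \<forall>is\<in>lists {1..d}. length is \<le> m \<longrightarrow> weak_deriv d is f (D is)}.
        \<Sum>j\<le>m. esssup (cube_measure {1..d})
          (\<lambda>x. ereal (sqrt (\<Sum>is\<in>{is\<in>lists {1..d}. length is = j}. (D is x)\<^sup>2))))"

definition sobolev_norm_vec ::
    "nat \<Rightarrow> nat \<Rightarrow> ((nat \<Rightarrow> real) \<Rightarrow> nat \<Rightarrow> real) \<Rightarrow> ereal" where
  "sobolev_norm_vec d m S = (\<Sum>k\<in>{1..d}. sobolev_norm d m (\<lambda>x. S x k))"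

end

theory Submission
  imports Defs "HOL-Complex_Analysis.Complex_Analysis"
begin

text \<open>
  Since \<open>T\<^sub>k = -1\<close> at \<open>x\<^sub>k = -1\<close> and \<open>T\<^sub>k = 1\<close> at \<open>x\<^sub>k = 1\<close>, both \<open>T\<^sub>k\<close> and its approximation are normalised
  primitives, of \<open>R\<^sub>k = \<partial>T\<^sub>k / \<partial>x\<^sub>k\<close> and of \<open>(1 + p\<^sub>k)\<^sup>2\<close>. So it suffices that \<open>1 + p\<^sub>k\<close> approximates
  \<open>sqrt R\<^sub>k\<close> up to \<open>O(\<epsilon>)\<close>, uniformly on a complex neighbourhood of the cube: Cauchy's estimates then
  bound all derivatives of \<open>T\<^sub>k\<close> minus its approximation. Such \<open>p\<^sub>k\<close> are obtained by truncating
  Chebyshev expansions one variable at a time. No power of \<open>\<epsilon>\<close> is lost, because \<open>sqrt R\<^sub>k\<close> extends past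
  the Bernstein ellipses with parameters \<open>1 + C\<^sub>7 \<delta>\<^sub>j\<close>. Finally the index sets lie in simplices, and
  comparing their number of lattice points with their volume gives \<open>\<beta> N\<^sub>\<epsilon>\<^sup>1\<^sup>/\<^sup>d \<le> log (1/\<epsilon>) + const\<close>.
\<close>

section \<open>Stadium-shaped neighbourhoods of the unit segment\<close>

text \<open>The ellipse with parameter \<open>\<rho>\<close> has semi-minor axis
  \<open>(\<rho> - 1 / \<rho>) / 2\<close>, strictly below the stadium radius
  \<open>\<rho> - 1\<close>. This gap is spent in two ways: Chebyshev coefficients are computed on
  an ellipse with a parameter \<open>r > \<rho>\<close>, and errors are measured out to an ellipse
  with a parameter \<open>\<sigma> > 1\<close>, where \<open>\<rho> * \<sigma> < r\<close>. The
  ratio \<open>\<rho> * \<sigma> / r < 1\<close> makes summing the errors over all degrees cost a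
  constant instead of a power of \<open>ln (1 / \<epsilon>)\<close>. The error bound holds on a
  neighbourhood whose width does not depend on \<epsilon>, so differentiating \<open>m\<close> times
  costs a constant as well.

  The lower bound on \<open>Re R\<close> is used twice. It keeps \<open>R\<close> off the branch cut
  of the square root, and, since real parts survive averaging, it keeps the normalising integral
  away from 0 at complex points too.

  The count has a leading power of \<open>ln (1 / \<epsilon>)\<close> and lower ones. The lower ones
  are absorbed by a shift of the base, so the \<open>d\<close>-th root sees an additive constant,
  which the exponential turns into a factor.\<close>

abbreviation stadium :: "real \<Rightarrow> complex set" where
  "stadium s \<equiv> nbhd s unit_segment"

lemma stadiumI: "\<bar>y\<bar> \<le> 1 \<Longrightarrow> cmod (z - of_real y) < s \<Longrightarrow> z \<in> stadium s"
  unfolding nbhd_def by (auto intro!: bexI[of _ y])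

lemma stadiumE:
  assumes "z \<in> stadium s"
  obtains y where "\<bar>y\<bar> \<le> 1" "cmod (z - of_real y) < s"
  using assms unfolding nbhd_def by (auto simp: abs_le_iff)

lemma of_real_in_stadium: "0 < s \<Longrightarrow> \<bar>y\<bar> \<le> 1 \<Longrightarrow> of_real y \<in> stadium s"
  by (rule stadiumI[of y]) auto

lemma open_stadium [simp]: "open (stadium s)"
proof -
  have "stadium s = (\<Union>y\<in>{-1..1}. ball (complex_of_real y) s)"
    unfolding nbhd_def by (auto simp: dist_norm norm_minus_commute)
  then show ?thesis by auto
qed

lemma convex_stadium [simp]: "convex (stadium s)"
proof (rule convexI)
  fix z w u v
  assume z: "z \<in> stadium s" and w: "w \<in> stadium s" and uv: "0 \<le> u" "0 \<le> v" "u + v = (1::real)"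
  obtain y where y: "\<bar>y\<bar> \<le> 1" "cmod (z - of_real y) < s" using z by (rule stadiumE)
  obtain x where x: "\<bar>x\<bar> \<le> 1" "cmod (w - of_real x) < s" using w by (rule stadiumE)
  have "\<bar>u * y + v * x\<bar> \<le> u * \<bar>y\<bar> + v * \<bar>x\<bar>"
    using uv by (intro order_trans[OF abs_triangle_ineq]) (simp add: abs_mult)
  also have "\<dots> \<le> u * 1 + v * 1" using uv x y by (intro add_mono mult_left_mono) auto
  finally have 1: "\<bar>u * y + v * x\<bar> \<le> 1" using uv by simp
  have "u *\<^sub>R z + v *\<^sub>R w - of_real (u * y + v * x) = u *\<^sub>R (z - of_real y) + v *\<^sub>R (w - of_real x)"
    by (simp add: scaleR_conv_of_real algebra_simps)
  also have "cmod \<dots> \<le> u * cmod (z - of_real y) + v * cmod (w - of_real x)"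
    using uv by (intro order_trans[OF norm_triangle_ineq]) simp
  also have "\<dots> < s"
    using uv x y convex_bound_lt by blast
  finally show "u *\<^sub>R z + v *\<^sub>R w \<in> stadium s" using 1 by (intro stadiumI)
qed

lemma stadium_mono: "s \<le> t \<Longrightarrow> stadium s \<subseteq> stadium t"
  by (force elim!: stadiumE intro: stadiumI)

lemma stadium_ball: "z \<in> stadium s \<Longrightarrow> cmod (w - z) < r \<Longrightarrow> s + r \<le> t \<Longrightarrow> w \<in> stadium t"
  by (elim stadiumE, erule stadiumI)
     (use norm_triangle_ineq[of "w - z"] in \<open>smt (verit) add_diff_eq diff_add_cancel\<close>)

lemma cnj_in_stadium: "z \<in> stadium s \<Longrightarrow> cnj z \<in> stadium s"
  by (elim stadiumE, erule stadiumI) (metis complex_cnj_complex_of_real complex_cnj_diff complex_mod_cnj)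


section \<open>Difference quotients and parametric integrals of holomorphic functions\<close>

text \<open>Taylor's formula, with Cauchy's estimate on circles of radius \<open>r / 2\<close> for
  the second derivative: \<open>2 * B / (r / 2)^2 = 8 * B / r^2\<close>. Since \<open>f\<close>
  enters only through \<open>B\<close>, the estimate is uniform over families of functions;
  parametric integrals and mixed derivatives rely on this.\<close>

lemma holomorphic_second_order_bound:
  assumes hol: "f holomorphic_on ball w r" and B: "\<And>z. z \<in> ball w r \<Longrightarrow> cmod (f z) \<le> B"
    and h: "cmod h < r / 2"
  shows "cmod (f (w + h) - f w - h * deriv f w) \<le> 8 * B / r\<^sup>2 * (cmod h)\<^sup>2"
proof -
  have r: "0 < r" using h norm_ge_zero[of h] by linarith
  have d2: "cmod ((deriv ^^ 2) f z) \<le> 8 * B / r\<^sup>2" if z: "z \<in> ball w (r/2)" for z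
  proof (rule field_le_epsilon)
    fix e :: real assume e: "e > 0"
    have sub: "cball z (r/2) \<subseteq> ball w r"
    proof
      fix u assume u: "u \<in> cball z (r/2)"
      have "dist w u \<le> dist w z + dist z u" by (rule dist_triangle)
      then show "u \<in> ball w r" using z u by auto
    qed
    have B0: "0 \<le> B" using B[of w] r norm_ge_zero[of "f w"] by (smt (verit) centre_in_ball)
    \<comment> \<open>The Cauchy estimate wants values in an open ball; the margin
      \<open>e * r^2 / 8\<close> is scaled so that it turns into exactly \<open>e\<close>.\<close>
    have "cmod ((deriv ^^ 2) f z) \<le> fact 2 * (B + e * r\<^sup>2 / 8) / (r/2)^2"
    proof (rule Cauchy_higher_deriv_bound)
      show "f holomorphic_on ball z (r/2)"
        using hol sub ball_subset_cball by (meson holomorphic_on_subset order_trans)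
      show "continuous_on (cball z (r/2)) f"
        using hol sub by (meson continuous_on_subset holomorphic_on_imp_continuous_on)
      fix u assume "u \<in> ball z (r/2)"
      then have "u \<in> ball w r" using sub ball_subset_cball by blast
      moreover have "0 < e * r\<^sup>2 / 8" using e r by auto
      ultimately show "f u \<in> ball 0 (B + e * r\<^sup>2 / 8)" using B[of u] by auto
    qed (use r in auto)
    also have "\<dots> = 8 * B / r\<^sup>2 + e"
      using r by (simp add: field_simps power2_eq_square)
    finally show "cmod ((deriv ^^ 2) f z) \<le> 8 * B / r\<^sup>2 + e" .
  qed
  have sub: "ball w (r/2) \<subseteq> ball w r" using r by auto
  have "cmod ((deriv ^^ 0) f (w + h) - (\<Sum>i\<le>1. (deriv ^^ i) f w * (w + h - w) ^ i / fact i))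
     \<le> 8 * B / r\<^sup>2 * cmod (w + h - w) ^ Suc 1 / fact 1"
  proof (rule complex_Taylor[where S = "ball w (r/2)"])
    fix i z assume z: "z \<in> ball w (r/2)" "i \<le> (1::nat)"
    have "(deriv ^^ i) f holomorphic_on ball w r"
      by (intro holomorphic_higher_deriv hol) auto
    then have "((deriv ^^ i) f has_field_derivative deriv ((deriv ^^ i) f) z) (at z)"
      using z sub by (intro holomorphic_derivI[of _ "ball w r"]) auto
    then show "((deriv ^^ i) f has_field_derivative (deriv ^^ Suc i) f z) (at z within ball w (r/2))"
      by (simp add: has_field_derivative_at_within)
  next
    fix z assume "z \<in> ball w (r/2)"
    then show "cmod ((deriv ^^ Suc 1) f z) \<le> 8 * B / r\<^sup>2"
      using d2[of z] by (simp add: numeral_2_eq_2)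
  qed (use h r in \<open>auto simp: dist_norm\<close>)
  then show ?thesis by (simp add: algebra_simps power2_eq_square)
qed

text \<open>Nothing is known about \<open>f\<close> on the boundary circle, so Cauchy's inequality
  is applied for every radius \<open>q < r\<close>, and then \<open>q\<close> tends to
  \<open>r\<close>.\<close>

lemma holomorphic_deriv_bound:
  assumes hol: "f holomorphic_on ball w r" and B: "\<And>z. z \<in> ball w r \<Longrightarrow> cmod (f z) \<le> B" and r: "0 < r"
  shows "cmod (deriv f w) \<le> B / r"
proof -
  have B0: "0 \<le> B" using B[of w] r norm_ge_zero[of "f w"] by (smt (verit) centre_in_ball)
  have *: "cmod (deriv f w) \<le> B / q" if q: "0 < q" "q < r" for q
  proof (rule Cauchy_inequality[where n = 1 and f = f and \<xi> = w and r = q and B = B, simplified])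
    show "f holomorphic_on ball w q" using hol q by (meson holomorphic_on_subset less_imp_le subset_ball)
    have "cball w q \<subseteq> ball w r" using q by auto
    then show "continuous_on (cball w q) f"
      using hol by (meson continuous_on_subset holomorphic_on_imp_continuous_on)
    show "cmod (f x) \<le> B" if "cmod (w - x) = q" for x
      using that q by (intro B) (simp add: dist_norm)
  qed (use q in auto)
  have "((\<lambda>q. B / q) \<longlongrightarrow> B / r) (at_left r)"
    using r by (intro tendsto_intros) auto
  moreover have "eventually (\<lambda>q. cmod (deriv f w) \<le> B / q) (at_left r)"
    using eventually_at_left_real[OF r] by eventually_elim (use * in auto)
  ultimately show ?thesis
    by (intro tendsto_lowerbound[where F = "at_left r"]) auto
qed

text \<open>The parameter set \<open>X\<close> is the interval of integration in one application and
  the range of another complex variable in the other. A sequence of increments is fixed because a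
  uniform limit of continuous, respectively holomorphic, functions is taken along it.\<close>

lemma difference_quotients_uniform_limit:
  assumes r: "0 < r" and hol: "\<And>x. x \<in> X \<Longrightarrow> f x holomorphic_on ball w r"
    and B: "\<And>x u. x \<in> X \<Longrightarrow> u \<in> ball w r \<Longrightarrow> cmod (f x u) \<le> B"
  obtains q where "\<And>N. q N \<noteq> 0" "\<And>N. cmod (q N) < r / 2"
    "uniform_limit X (\<lambda>N x. (f x (w + q N) - f x w) / q N) (\<lambda>x. deriv (f x) w) sequentially"
proof -
  \<comment> \<open>The shift by 3 keeps the increment below \<open>r / 2\<close> already at
    \<open>N = 0\<close>.\<close>
  define q where "q N = complex_of_real (r / (real N + 3))" for N
  have qn: "cmod (q N) = r / (real N + 3)" for N
    using r unfolding q_def by (simp only: norm_of_real) auto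
  have q2: "cmod (q N) < r / 2" for N unfolding qn using r by (intro divide_strict_left_mono) auto
  have "0 < cmod (q N)" for N unfolding qn using r by auto
  then have q0: "q N \<noteq> 0" for N by (metis norm_zero less_irrefl)
  define K where "K = 8 * B / r\<^sup>2"
  have est: "dist ((f x (w + q N) - f x w) / q N) (deriv (f x) w) \<le> K * (r / (real N + 3))" if "x \<in> X" for x N
  proof -
    have "dist ((f x (w + q N) - f x w) / q N) (deriv (f x) w)
        = cmod (f x (w + q N) - f x w - q N * deriv (f x) w) / cmod (q N)"
      using q0[of N] by (simp add: dist_norm diff_divide_distrib flip: norm_divide)
    also have "\<dots> \<le> K * (cmod (q N))\<^sup>2 / cmod (q N)"
      unfolding K_def
      by (rule divide_right_mono[OF holomorphic_second_order_bound[OF hol[OF that] B[OF that] q2]]) auto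
    also have "\<dots> = K * (r / (real N + 3))"
      unfolding qn[symmetric] using q0[of N] by (simp add: power2_eq_square)
    finally show ?thesis .
  qed
  have "((\<lambda>N. K * (r / (real N + 3))) \<longlongrightarrow> K * 0) sequentially"
    by (intro tendsto_intros) real_asymp
  then have lim: "((\<lambda>N. K * (r / (real N + 3))) \<longlongrightarrow> 0) sequentially" by simp
  have "uniform_limit X (\<lambda>N x. (f x (w + q N) - f x w) / q N) (\<lambda>x. deriv (f x) w) sequentially"
  proof (rule uniform_limitI)
    fix e :: real assume "e > 0"
    from order_tendstoD(2)[OF lim this]
    show "\<forall>\<^sub>F N in sequentially. \<forall>x\<in>X. dist ((f x (w + q N) - f x w) / q N) (deriv (f x) w) < e"
      by eventually_elim (use est in \<open>auto intro: le_less_trans\<close>)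
  qed
  with q0 q2 show ?thesis by (rule that)
qed

text \<open>The derivative in \<open>w\<close> is, uniformly in \<open>\<tau>\<close>, a limit of
  difference quotients that are continuous in \<open>\<tau>\<close>. Hence it is integrable, and the
  quadratic remainder bound can be integrated over \<open>\<tau>\<close>.\<close>

lemma holomorphic_on_integral_param:
  fixes h :: "complex \<Rightarrow> real \<Rightarrow> complex"
  assumes U: "open U"
    and hol: "\<And>\<tau>. \<tau> \<in> {0..1} \<Longrightarrow> (\<lambda>w. h w \<tau>) holomorphic_on U"
    and B: "\<And>w \<tau>. w \<in> U \<Longrightarrow> \<tau> \<in> {0..1} \<Longrightarrow> cmod (h w \<tau>) \<le> B"
    and cont: "\<And>w. w \<in> U \<Longrightarrow> continuous_on {0..1} (h w)"
  shows "(\<lambda>w. integral {0..1} (h w)) holomorphic_on U"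
proof -
  have "\<exists>D. ((\<lambda>w. integral {0..1} (h w)) has_field_derivative D) (at w)" if w: "w \<in> U" for w
  proof -
    obtain r where r: "0 < r" "ball w r \<subseteq> U" using U w by (meson open_contains_ball)
    define h' where "h' = (\<lambda>\<tau>. deriv (\<lambda>w. h w \<tau>) w)"
    define K where "K = 8 * B / r\<^sup>2"
    have est: "cmod (h (w + \<eta>) \<tau> - h w \<tau> - \<eta> * h' \<tau>) \<le> K * (cmod \<eta>)\<^sup>2"
      if "cmod \<eta> < r / 2" "\<tau> \<in> {0..1}" for \<eta> \<tau>
      unfolding h'_def K_def
      by (rule holomorphic_second_order_bound)
         (use that r hol B in \<open>auto intro: holomorphic_on_subset\<close>)
    have whU: "w + \<eta> \<in> U" if "cmod \<eta> < r/2" for \<eta>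
      using that r by (intro subsetD[OF r(2)]) (auto simp: dist_norm)
    obtain q where q: "\<And>N. q N \<noteq> 0" "\<And>N. cmod (q N) < r / 2"
      and lim: "uniform_limit {0..1} (\<lambda>N \<tau>. (h (w + q N) \<tau> - h w \<tau>) / q N) h' sequentially"
    proof (rule difference_quotients_uniform_limit[OF r(1), where X = "{0..1}" and f = "\<lambda>\<tau> w. h w \<tau>"])
      show "(\<lambda>w. h w \<tau>) holomorphic_on ball w r" if "\<tau> \<in> {0..1}" for \<tau>
        by (rule holomorphic_on_subset[OF hol[OF that] r(2)])
      show "cmod (h u \<tau>) \<le> B" if "\<tau> \<in> {0..1}" "u \<in> ball w r" for \<tau> u
        using B that r(2) by blast
    qed (rule that[unfolded h'_def])
    have "continuous_on {0..1} h'"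
    proof (rule uniform_limit_theorem[OF _ lim])
      show "\<forall>\<^sub>F N in sequentially. continuous_on {0..1} (\<lambda>\<tau>. (h (w + q N) \<tau> - h w \<tau>) / q N)"
        using q whU w by (intro always_eventually allI continuous_intros cont) auto
    qed simp
    then have inth': "h' integrable_on {0..1}" by (rule integrable_continuous_real)
    have inth: "h u integrable_on {0..1}" if "u \<in> U" for u
      using cont[OF that] by (rule integrable_continuous_real)
    have main: "cmod (integral {0..1} (h (w + \<eta>)) - integral {0..1} (h w) - \<eta> * integral {0..1} h') \<le> K * (cmod \<eta>)\<^sup>2"
      if \<eta>: "cmod \<eta> < r / 2" for \<eta>
    proof -
      have "integral {0..1} (h (w + \<eta>)) - integral {0..1} (h w) - \<eta> * integral {0..1} h'
          = integral {0..1} (\<lambda>\<tau>. h (w + \<eta>) \<tau> - h w \<tau> - \<eta> * h' \<tau>)"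
        using inth[OF whU[OF \<eta>]] inth[OF w] inth'
        by (simp add: integral_diff integrable_diff integrable_on_mult_right)
      also have "cmod \<dots> \<le> integral {0..1} (\<lambda>\<tau>::real. K * (cmod \<eta>)\<^sup>2)"
      proof (rule integral_norm_bound_integral)
        show "(\<lambda>\<tau>. h (w + \<eta>) \<tau> - h w \<tau> - \<eta> * h' \<tau>) integrable_on {0..1}"
          using inth[OF whU[OF \<eta>]] inth[OF w] inth'
          by (intro integrable_diff integrable_on_mult_right)
      qed (use est[OF \<eta>] in auto)
      also have "\<dots> = K * (cmod \<eta>)\<^sup>2" by simp
      finally show ?thesis .
    qed
    have "((\<lambda>\<eta>. (integral {0..1} (h (w + \<eta>)) - integral {0..1} (h w)) / \<eta>) \<longlongrightarrow> integral {0..1} h') (at 0)"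
    proof (rule LIM_zero_cancel, rule Lim_null_comparison)
      show "\<forall>\<^sub>F \<eta> in at 0. cmod ((integral {0..1} (h (w + \<eta>)) - integral {0..1} (h w)) / \<eta> - integral {0..1} h') \<le> K * cmod \<eta>"
        unfolding eventually_at
      proof (intro exI[of _ "r/2"] conjI ballI impI)
        fix \<eta> :: complex assume "\<eta> \<noteq> 0 \<and> dist \<eta> 0 < r / 2"
        then have \<eta>: "\<eta> \<noteq> 0" "cmod \<eta> < r / 2" by auto
        have "cmod ((integral {0..1} (h (w + \<eta>)) - integral {0..1} (h w)) / \<eta> - integral {0..1} h')
            = cmod (integral {0..1} (h (w + \<eta>)) - integral {0..1} (h w) - \<eta> * integral {0..1} h') / cmod \<eta>"
          using \<eta> by (simp add: diff_divide_distrib flip: norm_divide)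
        also have "\<dots> \<le> K * (cmod \<eta>)\<^sup>2 / cmod \<eta>" using main[OF \<eta>(2)] by (intro divide_right_mono) auto
        finally show "cmod ((integral {0..1} (h (w + \<eta>)) - integral {0..1} (h w)) / \<eta> - integral {0..1} h') \<le> K * cmod \<eta>"
          using \<eta> by (simp add: power2_eq_square)
      qed (use r in auto)
      show "((\<lambda>\<eta>. K * cmod \<eta>) \<longlongrightarrow> 0) (at 0)"
        by (auto intro!: tendsto_eq_intros)
    qed
    then show ?thesis by (auto simp: DERIV_def)
  qed
  then show ?thesis using U by (simp add: holomorphic_on_open)
qed

section \<open>Bounded separately holomorphic functions on products of stadiums\<close>

abbreviation embed :: "(nat \<Rightarrow> real) \<Rightarrow> nat \<Rightarrow> complex" where
  "embed x \<equiv> \<lambda>i. complex_of_real (x i)"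

abbreviation unit_box :: "nat \<Rightarrow> (nat \<Rightarrow> real) \<Rightarrow> bool" where
  "unit_box n x \<equiv> \<forall>i\<in>{1..n}. \<bar>x i\<bar> \<le> 1"

definition poly_stadium :: "nat \<Rightarrow> (nat \<Rightarrow> real) \<Rightarrow> (nat \<Rightarrow> complex) set" where
  "poly_stadium n s = {z. \<forall>i\<in>{1..n}. z i \<in> stadium (s i)}"

text \<open>Every tool below is a one-variable theorem applied to one coordinate, made uniform in
  the others by the common bound \<open>B\<close>. Points are arbitrary functions; the first
  conjunct makes their values outside \<open>{1..n}\<close> irrelevant, so updates
  \<open>z(i := t)\<close> carry no extensionality conditions.\<close>

definition sep_hol :: "nat \<Rightarrow> (nat \<Rightarrow> real) \<Rightarrow> real \<Rightarrow> ((nat \<Rightarrow> complex) \<Rightarrow> complex) \<Rightarrow> bool" where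
  "sep_hol n s B F \<longleftrightarrow>
     (\<forall>z w. (\<forall>i\<in>{1..n}. z i = w i) \<longrightarrow> F z = F w) \<and>
     (\<forall>z\<in>poly_stadium n s. cmod (F z) \<le> B \<and>
        (\<forall>i\<in>{1..n}. (\<lambda>t. F (z(i := t))) holomorphic_on stadium (s i)))"

definition cpartial :: "nat \<Rightarrow> ((nat \<Rightarrow> complex) \<Rightarrow> complex) \<Rightarrow> (nat \<Rightarrow> complex) \<Rightarrow> complex" where
  "cpartial i F z = deriv (\<lambda>t. F (z(i := t))) (z i)"

lemma poly_stadium_upd:
  "z \<in> poly_stadium n s \<Longrightarrow> (i \<in> {1..n} \<Longrightarrow> t \<in> stadium (s i)) \<Longrightarrow> z(i := t) \<in> poly_stadium n s"
  unfolding poly_stadium_def by auto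

lemma poly_stadium_mono:
  "(\<And>i. i \<in> {1..n} \<Longrightarrow> t i \<le> s i) \<Longrightarrow> poly_stadium n t \<subseteq> poly_stadium n s"
  unfolding poly_stadium_def using stadium_mono by blast

lemma poly_stadiumD: "z \<in> poly_stadium n s \<Longrightarrow> i \<in> {1..n} \<Longrightarrow> z i \<in> stadium (s i)"
  unfolding poly_stadium_def by auto

lemma sep_hol_bound: "sep_hol n s B F \<Longrightarrow> z \<in> poly_stadium n s \<Longrightarrow> cmod (F z) \<le> B"
  unfolding sep_hol_def by auto

lemma sep_hol_hol:
  "sep_hol n s B F \<Longrightarrow> z \<in> poly_stadium n s \<Longrightarrow> i \<in> {1..n} \<Longrightarrow>
   (\<lambda>t. F (z(i := t))) holomorphic_on stadium (s i)"
  unfolding sep_hol_def by auto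

lemma sep_hol_cong:
  "sep_hol n s B F \<Longrightarrow> (\<And>i. i \<in> {1..n} \<Longrightarrow> z i = w i) \<Longrightarrow> F z = F w"
  unfolding sep_hol_def by blast

lemma sep_holI:
  assumes "\<And>z w. (\<And>i. i \<in> {1..n} \<Longrightarrow> z i = w i) \<Longrightarrow> F z = F w"
    and "\<And>z. z \<in> poly_stadium n s \<Longrightarrow> cmod (F z) \<le> B"
    and "\<And>z i. z \<in> poly_stadium n s \<Longrightarrow> i \<in> {1..n} \<Longrightarrow> (\<lambda>t. F (z(i := t))) holomorphic_on stadium (s i)"
  shows "sep_hol n s B F"
  unfolding sep_hol_def using assms by blast

lemma sep_hol_upd_outside:
  assumes "sep_hol n s B F" "i \<notin> {1..n}"
  shows "F (z(i := t)) = F z"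
  using assms(2) by (intro sep_hol_cong[OF assms(1)]) auto

lemma sep_hol_mono:
  assumes F: "sep_hol n s B F" and "n \<le> n'" "B \<le> B'" and t: "\<And>i. i \<in> {1..n} \<Longrightarrow> t i \<le> s i"
  shows "sep_hol n' t B' F"
proof (rule sep_holI)
  fix z assume z: "z \<in> poly_stadium n' t"
  have z': "z \<in> poly_stadium n s"
    unfolding poly_stadium_def
  proof (intro CollectI ballI)
    fix i assume i: "i \<in> {1..n}"
    then have "z i \<in> stadium (t i)" using poly_stadiumD[OF z] assms(2) by simp
    then show "z i \<in> stadium (s i)" using stadium_mono[OF t[OF i]] by blast
  qed
  show "cmod (F z) \<le> B'" using sep_hol_bound[OF F z'] assms by simp
  fix i assume i: "i \<in> {1..n'}"
  show "(\<lambda>u. F (z(i := u))) holomorphic_on stadium (t i)"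
  proof (cases "i \<in> {1..n}")
    case True
    show ?thesis by (rule holomorphic_on_subset[OF sep_hol_hol[OF F z' True] stadium_mono[OF t[OF True]]])
  next
    case False
    then show ?thesis using sep_hol_upd_outside[OF F False] by simp
  qed
next
  fix z w :: "nat \<Rightarrow> complex" assume "\<And>i. i \<in> {1..n'} \<Longrightarrow> z i = w i"
  then show "F z = F w" using assms(2) by (intro sep_hol_cong[OF F]) simp
qed

section \<open>Closure properties of bounded separately holomorphic functions\<close>

lemma sep_hol_const: "cmod c \<le> B \<Longrightarrow> sep_hol n s B (\<lambda>z. c)"
  by (rule sep_holI) auto

lemma stadium_norm: "z \<in> stadium s \<Longrightarrow> cmod z \<le> 1 + s"
  by (elim stadiumE)
     (use norm_triangle_ineq[of "z - of_real y" "of_real y" for y] in \<open>smt (verit) diff_add_cancel norm_of_real\<close>)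

lemma sep_hol_var: "k \<in> {1..n} \<Longrightarrow> sep_hol n s (1 + s k) (\<lambda>z. z k)"
proof (rule sep_holI)
  fix z i assume "k \<in> {1..n}" "z \<in> poly_stadium n s"
  then show "cmod (z k) \<le> 1 + s k" by (intro stadium_norm poly_stadiumD)
  show "(\<lambda>t. (z(i := t)) k) holomorphic_on stadium (s i)"
    by (cases "i = k") auto
qed auto

lemma sep_hol_add:
  assumes F: "sep_hol n s A F" and G: "sep_hol n s B G"
  shows "sep_hol n s (A + B) (\<lambda>z. F z + G z)"
proof (rule sep_holI)
  fix z w :: "nat \<Rightarrow> complex" assume "\<And>i. i \<in> {1..n} \<Longrightarrow> z i = w i"
  then show "F z + G z = F w + G w" using sep_hol_cong[OF F, of z w] sep_hol_cong[OF G, of z w] by metis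
qed (use sep_hol_bound[OF F] sep_hol_bound[OF G] in
  \<open>auto intro!: holomorphic_intros norm_triangle_mono sep_hol_hol[OF F] sep_hol_hol[OF G]\<close>)

lemma sep_hol_mult:
  assumes F: "sep_hol n s A F" and G: "sep_hol n s B G"
  shows "sep_hol n s (A * B) (\<lambda>z. F z * G z)"
proof (rule sep_holI)
  fix z w :: "nat \<Rightarrow> complex" assume "\<And>i. i \<in> {1..n} \<Longrightarrow> z i = w i"
  then show "F z * G z = F w * G w" using sep_hol_cong[OF F, of z w] sep_hol_cong[OF G, of z w] by metis
next
  fix z assume "z \<in> poly_stadium n s"
  then show "cmod (F z * G z) \<le> A * B"
    unfolding norm_mult using sep_hol_bound[OF F] sep_hol_bound[OF G] by (intro mult_mono') auto
qed (auto intro!: holomorphic_intros sep_hol_hol[OF F] sep_hol_hol[OF G])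

lemma sep_hol_uminus: "sep_hol n s B F \<Longrightarrow> sep_hol n s B (\<lambda>z. - F z)"
  using sep_hol_mult[OF sep_hol_const[of "-1" 1 n s]] by simp

lemma sep_hol_diff:
  assumes "sep_hol n s A F" "sep_hol n s B G"
  shows "sep_hol n s (A + B) (\<lambda>z. F z - G z)"
  using sep_hol_add[OF assms(1) sep_hol_uminus[OF assms(2)]] by simp

lemma sep_hol_compose:
  assumes F: "sep_hol n s A F" and g: "g holomorphic_on V"
    and V: "\<And>z. z \<in> poly_stadium n s \<Longrightarrow> F z \<in> V \<and> cmod (g (F z)) \<le> B"
  shows "sep_hol n s B (\<lambda>z. g (F z))"
proof (rule sep_holI)
  fix z i assume z: "z \<in> poly_stadium n s" and i: "i \<in> {1..n}"
  have "(g \<circ> (\<lambda>t. F (z(i := t)))) holomorphic_on stadium (s i)"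
    by (rule holomorphic_on_compose_gen[OF sep_hol_hol[OF F z i] g])
       (use V z in \<open>auto intro: poly_stadium_upd\<close>)
  then show "(\<lambda>t. g (F (z(i := t)))) holomorphic_on stadium (s i)" by (simp add: o_def)
qed (use V in \<open>auto intro!: arg_cong[of _ _ g] sep_hol_cong[OF F]\<close>)

lemma sep_hol_fix:
  assumes F: "sep_hol n s B F" and a: "a \<in> stadium (s k)"
  shows "sep_hol n s B (\<lambda>z. F (z(k := a)))"
proof (rule sep_holI)
  fix z i assume z: "z \<in> poly_stadium n s" and i: "i \<in> {1..n}"
  have z': "z(k := a) \<in> poly_stadium n s" using z a by (intro poly_stadium_upd)
  show "(\<lambda>t. F ((z(i := t))(k := a))) holomorphic_on stadium (s i)"
  proof (cases "i = k")
    case False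
    then show ?thesis using sep_hol_hol[OF F z' i] by (simp add: fun_upd_twist)
  qed simp
qed (use a in \<open>auto intro!: sep_hol_cong[OF F] sep_hol_bound[OF F] poly_stadium_upd\<close>)

text \<open>Schwarz reflection in all variables at once, possible because stadiums around a real
  segment are symmetric. Averaging with the reflection is what later permits real polynomial
  coefficients.\<close>

lemma sep_hol_cnj:
  assumes F: "sep_hol n s B F"
  shows "sep_hol n s B (\<lambda>z. cnj (F (\<lambda>i. cnj (z i))))"
proof (rule sep_holI)
  fix z assume z: "z \<in> poly_stadium n s"
  have z': "(\<lambda>i. cnj (z i)) \<in> poly_stadium n s"
    using z cnj_in_stadium unfolding poly_stadium_def by auto
  then show "cmod (cnj (F (\<lambda>i. cnj (z i)))) \<le> B" using sep_hol_bound[OF F] by simp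
  fix i assume i: "i \<in> {1..n}"
  have "cnj ` stadium (s i) = stadium (s i)"
    using cnj_in_stadium by (metis complex_cnj_cnj image_eqI image_subsetI subsetI subset_antisym)
  then have "cnj \<circ> (\<lambda>t. F ((\<lambda>i. cnj (z i))(i := t))) \<circ> cnj holomorphic_on stadium (s i)"
    using sep_hol_hol[OF F z' i] by (intro holomorphic_on_compose_cnj_cnj) auto
  moreover have "(\<lambda>j. cnj ((z(i := t)) j)) = (\<lambda>i. cnj (z i))(i := cnj t)" for t by auto
  ultimately show "(\<lambda>t. cnj (F (\<lambda>j. cnj ((z(i := t)) j)))) holomorphic_on stadium (s i)"
    by (simp add: o_def)
qed (auto intro!: sep_hol_cong[OF F])

lemma sep_hol_integral:
  assumes H: "\<And>\<tau>. \<tau> \<in> {0..1} \<Longrightarrow> sep_hol n s B (\<lambda>z. H z \<tau>)"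
    and cont: "\<And>z. z \<in> poly_stadium n s \<Longrightarrow> continuous_on {0..1::real} (H z)"
  shows "sep_hol n s B (\<lambda>z. integral {0..1} (H z))"
proof (rule sep_holI)
  fix z assume z: "z \<in> poly_stadium n s"
  have "cmod (integral {0..1} (H z)) \<le> integral {0..1::real} (\<lambda>_. B)"
    using integrable_continuous_real[OF cont[OF z]] sep_hol_bound[OF H z]
    by (intro integral_norm_bound_integral) auto
  then show "cmod (integral {0..1} (H z)) \<le> B" by simp
  fix i assume i: "i \<in> {1..n}"
  show "(\<lambda>t. integral {0..1} (H (z(i := t)))) holomorphic_on stadium (s i)"
    by (rule holomorphic_on_integral_param[where B = B])
       (use z i in \<open>auto intro!: cont sep_hol_hol[OF H] sep_hol_bound[OF H] poly_stadium_upd\<close>)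
next
  fix z w :: "nat \<Rightarrow> complex" assume "\<And>i. i \<in> {1..n} \<Longrightarrow> z i = w i"
  then have "H z \<tau> = H w \<tau>" if "\<tau> \<in> {0..1}" for \<tau> using sep_hol_cong[OF H[OF that]] by blast
  then show "integral {0..1} (H z) = integral {0..1} (H w)" by (intro integral_cong) auto
qed

section \<open>Continuity along paths, partial derivatives and Lipschitz bounds\<close>

lemma sep_hol_continuous_path:
  assumes F: "sep_hol n s B F" and z: "z \<in> poly_stadium n s" and i: "i \<in> {1..n}"
    and g: "continuous_on T g" "\<And>t. t \<in> T \<Longrightarrow> g t \<in> stadium (s i)"
  shows "continuous_on T (\<lambda>t. F (z(i := g t)))"
  using continuous_on_compose2[OF holomorphic_on_imp_continuous_on[OF sep_hol_hol[OF F z i]] g(1)] g(2)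
  by auto

text \<open>In the variable \<open>k\<close> this is Cauchy's inequality, at the price of radius
  \<open>r\<close> in that direction only. Holomorphy in another variable needs Weierstrass's
  theorem: the derivative is a uniform limit of difference quotients in \<open>z k\<close>, and each
  of these is holomorphic in the other variable.\<close>

lemma sep_hol_cpartial:
  assumes F: "sep_hol n s B F" and k: "k \<in> {1..n}" and r: "0 < r"
    and t: "\<And>i. i \<in> {1..n} \<Longrightarrow> t i \<le> s i" "t k + r \<le> s k"
  shows "sep_hol n t (B / r) (cpartial k F)"
proof (rule sep_holI)
  fix z w :: "nat \<Rightarrow> complex" assume zw: "\<And>i. i \<in> {1..n} \<Longrightarrow> z i = w i"
  have "F (z(k := u)) = F (w(k := u))" for u using zw by (intro sep_hol_cong[OF F]) auto
  then show "cpartial k F z = cpartial k F w" unfolding cpartial_def using zw k by simp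
next
  fix z assume z: "z \<in> poly_stadium n t"
  have z': "z \<in> poly_stadium n s" using z poly_stadium_mono[of n t s] t by blast
  have zb: "u \<in> stadium (s k)" if "u \<in> ball (z k) r" for u
    using stadium_ball[OF poly_stadiumD[OF z k]] that t by (auto simp: dist_norm norm_minus_commute)
  show "cmod (cpartial k F z) \<le> B / r"
    unfolding cpartial_def
  proof (rule holomorphic_deriv_bound)
    show "(\<lambda>u. F (z(k := u))) holomorphic_on ball (z k) r"
      using zb by (intro holomorphic_on_subset[OF sep_hol_hol[OF F z' k]]) auto
  qed (use zb z' r in \<open>auto intro!: sep_hol_bound[OF F] poly_stadium_upd\<close>)
  fix i assume i: "i \<in> {1..n}"
  show "(\<lambda>v. cpartial k F (z(i := v))) holomorphic_on stadium (t i)"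
  proof (cases "i = k")
    case True
    have "deriv (\<lambda>u. F (z(k := u))) holomorphic_on stadium (s k)"
      by (intro holomorphic_deriv sep_hol_hol[OF F z' k]) auto
    then show ?thesis unfolding True cpartial_def
      using holomorphic_on_subset[OF _ stadium_mono[OF t(1)[OF k]]] by simp
  next
    case False
    have zv: "z(i := v) \<in> poly_stadium n s" if "v \<in> stadium (t i)" for v
      using z' that t(1)[OF i] stadium_mono by (intro poly_stadium_upd) auto
    obtain q where q0: "\<And>N. q N \<noteq> 0" and q2: "\<And>N. cmod (q N) < r / 2"
      and lim: "uniform_limit (stadium (t i)) (\<lambda>N v. (F (z(i := v, k := z k + q N)) - F (z(i := v, k := z k))) / q N)
        (\<lambda>v. deriv (\<lambda>u. F (z(i := v, k := u))) (z k)) sequentially"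
    proof (rule difference_quotients_uniform_limit[OF r, where X = "stadium (t i)" and w = "z k"
          and f = "\<lambda>v u. F (z(i := v, k := u))"])
      show "(\<lambda>u. F (z(i := v, k := u))) holomorphic_on ball (z k) r" if "v \<in> stadium (t i)" for v
        using zb by (intro holomorphic_on_subset[OF sep_hol_hol[OF F zv[OF that] k]]) auto
      show "cmod (F (z(i := v, k := u))) \<le> B" if "v \<in> stadium (t i)" "u \<in> ball (z k) r" for v u
        using that zb by (intro sep_hol_bound[OF F] poly_stadium_upd zv) auto
    qed (rule that)
    have zk: "z(i := v, k := z k) = z(i := v)" for v using False by auto
    have dk: "deriv (\<lambda>u. F (z(i := v, k := u))) (z k) = cpartial k F (z(i := v))" for v
      unfolding cpartial_def using False by simp
    note lim = lim[unfolded zk dk]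
    have zq: "z k + q N \<in> stadium (s k)" for N
      using zb q2[of N] r by (auto simp: dist_norm)
    show ?thesis
    proof (rule holomorphic_uniform_sequence[where f = "\<lambda>N v. (F (z(i := v, k := z k + q N)) - F (z(i := v))) / q N"])
      fix N
      have "(\<lambda>v. F ((z(k := z k + q N))(i := v))) holomorphic_on stadium (s i)"
        by (intro sep_hol_hol[OF F] poly_stadium_upd z' zq i)
      moreover have "(z(k := z k + q N))(i := v) = z(i := v, k := z k + q N)" for v
        using False by (auto simp: fun_upd_twist)
      ultimately have "(\<lambda>v. F (z(i := v, k := z k + q N))) holomorphic_on stadium (t i)"
        using holomorphic_on_subset[OF _ stadium_mono[OF t(1)[OF i]]] by simp
      moreover have "(\<lambda>v. F (z(i := v))) holomorphic_on stadium (t i)"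
        using holomorphic_on_subset[OF _ stadium_mono[OF t(1)[OF i]]] sep_hol_hol[OF F z' i] by simp
      ultimately show "(\<lambda>v. (F (z(i := v, k := z k + q N)) - F (z(i := v))) / q N) holomorphic_on stadium (t i)"
        using q0 by (intro holomorphic_intros) auto
    next
      fix v assume v: "v \<in> stadium (t i)"
      obtain d where d: "0 < d" "cball v d \<subseteq> stadium (t i)"
        using open_contains_cball_eq[of "stadium (t i)"] v by auto
      show "\<exists>d>0. cball v d \<subseteq> stadium (t i) \<and>
          uniform_limit (cball v d) (\<lambda>N v. (F (z(i := v, k := z k + q N)) - F (z(i := v))) / q N)
              (\<lambda>v. cpartial k F (z(i := v))) sequentially"
        using d uniform_limit_on_subset[OF lim d(2)] by blast
    qed simp
  qed
qed

lemma sep_hol_fold_cpartial: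
  assumes F: "sep_hol n (\<lambda>_. t + real (length is) * r) B F" and r: "0 < r" and "is": "set is \<subseteq> {1..n}"
  shows "sep_hol n (\<lambda>_. t) (B / r ^ length is) (fold cpartial is F)"
  using F "is"
proof (induction "is" arbitrary: F B)
  case (Cons i "is")
  have "sep_hol n (\<lambda>_. t + real (length is) * r) (B / r) (cpartial i F)"
    by (rule sep_hol_cpartial[OF Cons.prems(1)]) (use Cons.prems r in \<open>auto simp: algebra_simps\<close>)
  from Cons.IH[OF this] Cons.prems show ?case by (simp add: field_simps)
qed simp

lemma cpartial_has_real_derivative:
  assumes F: "sep_hol n (\<lambda>_. s) B F" and k: "k \<in> {1..n}" and s: "0 < s"
    and x: "\<And>i. i \<in> {1..n} \<Longrightarrow> \<bar>x i\<bar> \<le> 1"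
  shows "((\<lambda>t. Re (F (\<lambda>i. of_real ((x(k := t)) i)))) has_real_derivative
           Re (cpartial k F (\<lambda>i. of_real (x i)))) (at (x k) within A)"
proof -
  let ?z = "\<lambda>i. complex_of_real (x i)"
  have z: "?z \<in> poly_stadium n (\<lambda>_. s)"
    using x s of_real_in_stadium unfolding poly_stadium_def by auto
  have "((\<lambda>t. F (?z(k := t))) has_field_derivative cpartial k F ?z) (at (?z k))"
    unfolding cpartial_def
    by (rule holomorphic_derivI[OF sep_hol_hol[OF F z k]]) (use poly_stadiumD[OF z k] in auto)
  then have "((\<lambda>t. Re (F (?z(k := of_real t)))) has_real_derivative Re (cpartial k F ?z)) (at (x k) within A)"
    by (intro has_field_derivative_Re has_vector_derivative_real_field)
  moreover have "(\<lambda>i. complex_of_real ((x(k := t)) i)) = ?z(k := of_real t)" for t by auto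
  ultimately show ?thesis by (simp only:)
qed

text \<open>This is how joint continuity comes out of separate holomorphy. Cauchy's inequality
  bounds each partial derivative by \<open>B / r\<close>, stadiums are convex, and
  \<open>mix\<close> joins the two points by exchanging one coordinate at a time.\<close>

lemma sep_hol_lipschitz:
  assumes F: "sep_hol n s B F" and r: "0 < r" "\<And>i. i \<in> {1..n} \<Longrightarrow> t i + r \<le> s i"
    and z: "z \<in> poly_stadium n t" and w: "w \<in> poly_stadium n t"
  shows "cmod (F z - F w) \<le> B / r * (\<Sum>i\<in>{1..n}. cmod (z i - w i))"
proof -
  have st: "poly_stadium n t \<subseteq> poly_stadium n s"
  proof (rule poly_stadium_mono)
    show "t i \<le> s i" if "i \<in> {1..n}" for i using r(1) r(2)[OF that] by simp
  qed
  have step: "cmod (F (v(k := a)) - F (v(k := b))) \<le> B / r * cmod (a - b)"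
    if v: "v \<in> poly_stadium n t" and k: "k \<in> {1..n}" and ab: "a \<in> stadium (t k)" "b \<in> stadium (t k)" for v k a b
  proof (rule field_differentiable_bound[where S = "stadium (t k)"])
    fix u assume u: "u \<in> stadium (t k)"
    have v': "v \<in> poly_stadium n s" using v st by blast
    have us: "u \<in> stadium (s k)" using u r(2)[OF k] r(1) stadium_mono[of "t k" "s k"] by auto
    show "((\<lambda>u. F (v(k := u))) has_field_derivative deriv (\<lambda>u. F (v(k := u))) u) (at u within stadium (t k))"
      by (rule has_field_derivative_at_within[OF holomorphic_derivI[OF sep_hol_hol[OF F v' k] open_stadium us]])
    have sub: "ball u r \<subseteq> stadium (s k)"
      using stadium_ball[OF u, of _ r "s k"] r(2)[OF k] by (auto simp: dist_norm norm_minus_commute)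
    show "cmod (deriv (\<lambda>u. F (v(k := u))) u) \<le> B / r"
      using sub v' by (intro holomorphic_deriv_bound holomorphic_on_subset[OF sep_hol_hol[OF F v' k]] r)
        (auto intro!: sep_hol_bound[OF F] poly_stadium_upd)
  qed (use ab in auto)
  define mix where "mix m = (\<lambda>i. if i \<in> {1..m} then w i else z i)" for m :: nat
  have mixS: "mix m \<in> poly_stadium n t" for m
    using z w unfolding mix_def poly_stadium_def by auto
  have "cmod (F z - F (mix m)) \<le> B / r * (\<Sum>i\<in>{1..m}. cmod (z i - w i))" if "m \<le> n" for m
    using that
  proof (induction m)
    case 0
    have "mix 0 = z" unfolding mix_def by auto
    then show ?case by simp
  next
    case (Suc m)
    have 1: "mix m = (mix m)(Suc m := z (Suc m))" unfolding mix_def by auto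
    have 2: "mix (Suc m) = (mix m)(Suc m := w (Suc m))" unfolding mix_def by auto
    have "cmod (F (mix m) - F (mix (Suc m))) \<le> B / r * cmod (z (Suc m) - w (Suc m))"
      by (subst 1, subst 2, rule step) (use mixS z w Suc.prems in \<open>auto intro: poly_stadiumD\<close>)
    then show ?case using Suc norm_triangle_ineq[of "F z - F (mix m)" "F (mix m) - F (mix (Suc m))"]
      by (simp add: algebra_simps)
  qed
  from this[of n] have "cmod (F z - F (mix n)) \<le> B / r * (\<Sum>i\<in>{1..n}. cmod (z i - w i))" by simp
  moreover have "F (mix n) = F w" by (rule sep_hol_cong[OF F]) (auto simp: mix_def)
  ultimately show ?thesis by simp
qed

section \<open>Integration along the segment from -1\<close>

text \<open>The primitive in variable \<open>k\<close> along the segment from -1. Rescaling the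
  segment to \<open>{0..1}\<close> moves the end point into the integrand and the prefactor, so that
  holomorphy in \<open>z k\<close> is a case of a parametric integral over a fixed interval.\<close>

definition cprim :: "nat \<Rightarrow> ((nat \<Rightarrow> complex) \<Rightarrow> complex) \<Rightarrow> (nat \<Rightarrow> complex) \<Rightarrow> complex" where
  "cprim k F z = (z k + 1) * integral {0..1} (\<lambda>\<tau>. F (z(k := -1 + of_real \<tau> * (z k + 1))))"

lemma segment_in_stadium:
  assumes "z \<in> stadium s" "0 < s" "\<tau> \<in> {0..1}"
  shows "-1 + of_real \<tau> * (z + 1) \<in> stadium s"
proof -
  have "(1 - \<tau>) *\<^sub>R (-1) + \<tau> *\<^sub>R z \<in> stadium s"
    using assms of_real_in_stadium[of s "-1"] by (intro convexD[OF convex_stadium]) auto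
  then show ?thesis by (simp add: scaleR_conv_of_real algebra_simps)
qed

lemma sep_hol_cprim:
  assumes F: "sep_hol n s B F" and k: "k \<in> {1..n}" and s: "0 < s k"
  shows "sep_hol n s ((2 + s k) * B) (cprim k F)"
  unfolding cprim_def
proof (intro sep_hol_mult sep_hol_integral)
  have "sep_hol n s (1 + s k + 1) (\<lambda>z. z k + 1)"
    by (intro sep_hol_add sep_hol_var k sep_hol_const) auto
  then show "sep_hol n s (2 + s k) (\<lambda>z. z k + 1)" by (simp add: algebra_simps)
next
  fix z assume z: "z \<in> poly_stadium n s"
  show "continuous_on {0..1} (\<lambda>\<tau>. F (z(k := -1 + of_real \<tau> * (z k + 1))))"
    by (rule sep_hol_continuous_path[OF F z k])
       (intro continuous_intros, intro segment_in_stadium poly_stadiumD[OF z k] s)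
next
  fix \<tau> :: real assume \<tau>: "\<tau> \<in> {0..1}"
  have zk: "z(k := -1 + of_real \<tau> * (z k + 1)) \<in> poly_stadium n s" if "z \<in> poly_stadium n s" for z
    using that \<tau> s k poly_stadiumD[OF that] by (intro poly_stadium_upd segment_in_stadium) auto
  show "sep_hol n s B (\<lambda>z. F (z(k := -1 + of_real \<tau> * (z k + 1))))"
  proof (rule sep_holI)
    fix z i assume z: "z \<in> poly_stadium n s" and i: "i \<in> {1..n}"
    show "(\<lambda>t. F ((z(i := t))(k := -1 + of_real \<tau> * ((z(i := t)) k + 1)))) holomorphic_on stadium (s i)"
    proof (cases "i = k")
      case False
      then show ?thesis using sep_hol_hol[OF F zk[OF z] i] by (simp add: fun_upd_twist)
    next
      case True
      have "((\<lambda>t. F (z(k := t))) \<circ> (\<lambda>t. -1 + of_real \<tau> * (t + 1))) holomorphic_on stadium (s k)"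
        by (rule holomorphic_on_compose_gen[OF _ sep_hol_hol[OF F z k]])
           (use segment_in_stadium \<tau> s in \<open>auto intro!: holomorphic_intros simp del: add_uminus_conv_diff\<close>)
      then show ?thesis unfolding True by (simp add: o_def)
    qed
  qed (use zk k in \<open>auto intro!: sep_hol_cong[OF F] sep_hol_bound[OF F]\<close>)
qed

section \<open>Chebyshev expansions\<close>

fun cheb :: "nat \<Rightarrow> complex \<Rightarrow> complex" where
  "cheb 0 z = 1"
| "cheb (Suc 0) z = z"
| "cheb (Suc (Suc n)) z = 2 * z * cheb (Suc n) z - cheb n z"

text \<open>For \<open>w = exp (\<i> * t)\<close> this is the identity defining the Chebyshev
  polynomials, which sends \<open>cos t\<close> to \<open>cos (n * t)\<close>. The proof checks that
  the right-hand side satisfies the same three-term recursion.\<close>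

lemma cheb_joukowski:
  assumes "w \<noteq> 0"
  shows "cheb n ((w + 1 / w) / 2) = (w ^ n + (1 / w) ^ n) / 2"
proof (induction n rule: cheb.induct[of "\<lambda>n _. cheb n ((w + 1 / w) / 2) = (w ^ n + (1 / w) ^ n) / 2" _ "w"])
  case (3 n _)
  define v where "v = 1 / w"
  have vw: "w * v = 1" using assms unfolding v_def by simp
  have a: "w * v ^ Suc n = v ^ n" "v * w ^ Suc n = w ^ n"
    using vw by (simp_all add: mult.assoc[symmetric] mult.commute[of v w])
  have "(w + v) * (w ^ Suc n + v ^ Suc n) = w * w ^ Suc n + w * v ^ Suc n + (v * w ^ Suc n + v * v ^ Suc n)"
    by (subst distrib_right, subst distrib_left, subst distrib_left) (rule refl)
  also have "\<dots> = w ^ Suc (Suc n) + v ^ Suc (Suc n) + (w ^ n + v ^ n)" unfolding a by simp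
  finally have p: "(w + v) * (w ^ Suc n + v ^ Suc n) = w ^ Suc (Suc n) + v ^ Suc (Suc n) + (w ^ n + v ^ n)" .
  have "2 * ((w + v) / 2) * ((w ^ Suc n + v ^ Suc n) / 2) - (w ^ n + v ^ n) / 2
      = ((w + v) * (w ^ Suc n + v ^ Suc n) - (w ^ n + v ^ n)) / 2"
    by (simp add: diff_divide_distrib del: power_Suc)
  then show ?case using 3 unfolding p by (simp only: cheb.simps v_def add_diff_cancel_right')
qed auto

lemma cheb_polynomial: "\<exists>c. \<forall>z. cheb m z = (\<Sum>i\<le>m. c i * z ^ i)"
proof (induction m rule: cheb.induct[of "\<lambda>m _. \<exists>c. \<forall>z. cheb m z = (\<Sum>i\<le>m. c i * z ^ i)" _ 0])
  case (1 z) show ?case by (rule exI[of _ "\<lambda>_. 1"]) simp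
next
  case (2 z) show ?case by (rule exI[of _ "\<lambda>i. if i = 1 then 1 else 0"]) simp
next
  case (3 n z)
  then obtain a b where a: "\<And>z. cheb (Suc n) z = (\<Sum>i\<le>Suc n. a i * z ^ i)"
    and b: "\<And>z. cheb n z = (\<Sum>i\<le>n. b i * z ^ i)" by blast
  \<comment> \<open>The \<open>case\<close> expression shifts the coefficients of
    \<open>cheb (Suc n)\<close> by one place, which is multiplication by
    \<open>2 * z\<close>.\<close>
  define c where "c i = (case i of 0 \<Rightarrow> 0 | Suc j \<Rightarrow> 2 * a j) - (if i \<le> n then b i else 0)" for i
  have "cheb (Suc (Suc n)) z = (\<Sum>i\<le>Suc (Suc n). c i * z ^ i)" for z
  proof -
    have "(\<Sum>i\<le>Suc (Suc n). c i * z ^ i)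
       = (\<Sum>i\<le>Suc (Suc n). (case i of 0 \<Rightarrow> 0 | Suc j \<Rightarrow> 2 * a j) * z ^ i) -
         (\<Sum>i\<le>Suc (Suc n). (if i \<le> n then b i else 0) * z ^ i)"
      unfolding c_def by (simp only: left_diff_distrib sum_subtractf)
    also have "(\<Sum>i\<le>Suc (Suc n). (case i of 0 \<Rightarrow> 0 | Suc j \<Rightarrow> 2 * a j) * z ^ i)
        = 2 * z * (\<Sum>i\<le>Suc n. a i * z ^ i)"
      by (subst sum.atMost_Suc_shift) (simp add: sum_distrib_left algebra_simps)
    also have "(\<Sum>i\<le>Suc (Suc n). (if i \<le> n then b i else 0) * z ^ i) = (\<Sum>i\<le>n. b i * z ^ i)"
      by simp
    finally show ?thesis by (simp only: a b cheb.simps)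
  qed
  then show ?case by blast
qed

lemma add_inverse_le_imp_le:
  fixes t \<sigma> :: real
  assumes "1 \<le> t" "1 \<le> \<sigma>" "t + 1 / t \<le> \<sigma> + 1 / \<sigma>"
  shows "t \<le> \<sigma>"
proof (rule ccontr)
  assume "\<not> t \<le> \<sigma>"
  then have ts: "\<sigma> < t" by simp
  have "1 * 1 < t * \<sigma>" using assms ts by (intro mult_less_le_imp_less) auto
  then have "(t - \<sigma>) * 1 < (t - \<sigma>) * (t * \<sigma>)" using ts by (intro mult_strict_left_mono) auto
  then show False using assms ts by (simp add: field_simps)
qed

text \<open>In the Joukowski variable, \<open>|w| + 1 / |w|\<close> is the sum of the distances to the foci.\<close>

lemma stadium_joukowski:
  assumes z: "z \<in> stadium s" and \<sigma>: "1 \<le> \<sigma>" "2 + 2 * s \<le> \<sigma> + 1 / \<sigma>"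
  obtains w where "w \<noteq> 0" "z = (w + 1 / w) / 2" "1 \<le> cmod w" "cmod w \<le> \<sigma>"
proof -
  have ex: "\<exists>w. w \<noteq> 0 \<and> z = (w + 1 / w) / 2"
  proof -
    define q where "q = csqrt (z\<^sup>2 - 1)"
    have "q\<^sup>2 = z\<^sup>2 - 1" unfolding q_def by simp
    then have p: "(z + q) * (z - q) = 1" by (simp add: algebra_simps power2_eq_square)
    then have "z + q \<noteq> 0" by auto
    moreover from p this have "1 / (z + q) = z - q" by (simp add: field_simps)
    ultimately show ?thesis by (intro exI[of _ "z + q"]) simp
  qed
  then obtain w where w: "w \<noteq> 0" "z = (w + 1 / w) / 2" "1 \<le> cmod w"
  proof -
    obtain v where v: "v \<noteq> 0" "z = (v + 1 / v) / 2" using ex by blast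
    show ?thesis
    proof (cases "1 \<le> cmod v")
      case False
      then have "1 \<le> cmod (1 / v)" using v by (simp add: norm_divide field_simps)
      then show ?thesis using v by (intro that[of "1 / v"]) (auto simp: add.commute)
    qed (use v that in blast)
  qed
  have par: "(cmod (w - 1))\<^sup>2 + (cmod (w + 1))\<^sup>2 = 2 * (cmod w)\<^sup>2 + 2"
    by (simp add: cmod_power2 algebra_simps) (simp add: power2_eq_square algebra_simps)
  have 1: "z - 1 = (w - 1)\<^sup>2 / (2 * w)" "z + 1 = (w + 1)\<^sup>2 / (2 * w)"
    using w by (simp_all add: field_simps power2_eq_square)
  have "cmod (z - 1) + cmod (z + 1) = ((cmod (w - 1))\<^sup>2 + (cmod (w + 1))\<^sup>2) / (2 * cmod w)"
    unfolding 1 by (simp add: norm_divide norm_mult norm_power add_divide_distrib)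
  also have "\<dots> = cmod w + 1 / cmod w"
    unfolding par using w by (simp add: field_simps power2_eq_square)
  finally have foci: "cmod w + 1 / cmod w = cmod (z - 1) + cmod (z + 1)" by simp
  obtain y where y: "\<bar>y\<bar> \<le> 1" "cmod (z - of_real y) < s" using z by (rule stadiumE)
  have "cmod (z - 1) \<le> cmod (z - of_real y) + cmod (of_real (y - 1))"
    using norm_triangle_ineq[of "z - of_real y" "of_real y - 1"] by simp
  moreover have "cmod (z + 1) \<le> cmod (z - of_real y) + cmod (of_real (y + 1))"
    using norm_triangle_ineq[of "z - of_real y" "of_real y + 1"] by simp
  moreover have "cmod (of_real (y - 1)) = 1 - y" "cmod (of_real (y + 1)) = 1 + y"
    using y(1) unfolding norm_of_real by auto
  ultimately have "cmod (z - 1) + cmod (z + 1) \<le> 2 + 2 * s" using y by linarith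
  then have "cmod w + 1 / cmod w \<le> \<sigma> + 1 / \<sigma>" using foci \<sigma>(2) by simp
  then have "cmod w \<le> \<sigma>" using \<sigma>(1) w(3) by (simp add: add_inverse_le_imp_le)
  with w show ?thesis by (rule that)
qed

text \<open>The condition on \<open>s\<close> puts the stadium inside the ellipse with parameter
  \<open>\<sigma>\<close>: on the stadium the distances to the foci add up to at most
  \<open>2 + 2 * s\<close>. There both Joukowski powers have modulus at most
  \<open>\<sigma> ^ m\<close>.\<close>

lemma cheb_bound:
  assumes "z \<in> stadium s" "1 \<le> \<sigma>" "2 + 2 * s \<le> \<sigma> + 1 / \<sigma>"
  shows "cmod (cheb m z) \<le> \<sigma> ^ m"
proof -
  obtain w where w: "w \<noteq> 0" "z = (w + 1 / w) / 2" "1 \<le> cmod w" "cmod w \<le> \<sigma>"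
    using assms by (rule stadium_joukowski)
  have "cmod (cheb m z) \<le> (cmod (w ^ m) + cmod ((1 / w) ^ m)) / 2"
    unfolding w(2) cheb_joukowski[OF w(1)] using norm_triangle_ineq[of "w ^ m" "(1 / w) ^ m"] by simp
  also have "\<dots> \<le> (\<sigma> ^ m + \<sigma> ^ m) / 2"
  proof -
    have "cmod (w ^ m) \<le> \<sigma> ^ m" using w(4) by (simp add: norm_power power_mono)
    moreover have "cmod (1 / w) \<le> 1" unfolding norm_divide norm_one divide_le_eq_1 using w(3) by linarith
    then have "cmod (1 / w) \<le> \<sigma>" using assms(2) by linarith
    then have "cmod ((1 / w) ^ m) \<le> \<sigma> ^ m" unfolding norm_power by (intro power_mono) auto
    ultimately show ?thesis by simp
  qed
  finally show ?thesis by simp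
qed

section \<open>Bernstein ellipses and coefficient integrals\<close>

definition circ :: "real \<Rightarrow> real \<Rightarrow> complex" where
  "circ r t = of_real r * exp (2 * of_real pi * \<i> * of_real t)"

definition ellipse :: "real \<Rightarrow> real \<Rightarrow> complex" where
  "ellipse r t = (circ r t + 1 / circ r t) / 2"

text \<open>The Laurent coefficients of \<open>f ((w + 1 / w) / 2)\<close>, computed on the circle
  of radius \<open>r\<close>. They are doubled for \<open>m > 0\<close> because
  \<open>cheb m\<close> is half of \<open>w ^ m + (1 / w) ^ m\<close>.\<close>

definition cheb_coeff :: "real \<Rightarrow> (complex \<Rightarrow> complex) \<Rightarrow> nat \<Rightarrow> complex" where
  "cheb_coeff r f m = (if m = 0 then 1 else 2) * integral {0..1} (\<lambda>t. f (ellipse r t) * (1 / circ r t) ^ m)"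

lemma norm_circ: "0 < r \<Longrightarrow> cmod (circ r t) = r"
  unfolding circ_def by (simp add: norm_mult)

lemma circ_nonzero: "0 < r \<Longrightarrow> circ r t \<noteq> 0"
  using norm_circ[of r t] by auto

lemma circ_has_vector_derivative [derivative_intros]:
  "(circ r has_vector_derivative 2 * of_real pi * \<i> * circ r t) (at t within A)"
  unfolding circ_def by (rule has_vector_derivative_real_field) (auto intro!: derivative_eq_intros)

lemma continuous_on_circ [continuous_intros]: "continuous_on A (circ r)"
  unfolding circ_def by (intro continuous_intros)

lemma ellipse_has_vector_derivative:
  assumes r: "0 < r"
  shows "(ellipse r has_vector_derivative of_real pi * \<i> * (circ r t - 1 / circ r t)) (at t within A)"
proof -
  have 1: "((\<lambda>z. (z + 1 / z) / 2) has_field_derivative (1 - 1 / (circ r t)\<^sup>2) / 2) (at (circ r t))"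
    using circ_nonzero[OF r, of t] by (auto intro!: derivative_eq_intros simp: power2_eq_square field_simps)
  have "((\<lambda>z. (z + 1 / z) / 2) \<circ> circ r has_vector_derivative
      2 * of_real pi * \<i> * circ r t * ((1 - 1 / (circ r t)\<^sup>2) / 2)) (at t within A)"
    by (rule field_vector_diff_chain_within[OF circ_has_vector_derivative])
       (use 1 in \<open>auto intro: has_field_derivative_at_within\<close>)
  moreover have "2 * of_real pi * \<i> * circ r t * ((1 - 1 / (circ r t)\<^sup>2) / 2) = of_real pi * \<i> * (circ r t - 1 / circ r t)"
    using circ_nonzero[OF r, of t] by (simp add: field_simps power2_eq_square)
  moreover have "(\<lambda>z. (z + 1 / z) / 2) \<circ> circ r = ellipse r" by (auto simp: ellipse_def)
  ultimately show ?thesis by (simp only:)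
qed

lemma continuous_on_ellipse: "0 < r \<Longrightarrow> continuous_on A (ellipse r)"
  unfolding ellipse_def using circ_nonzero by (auto intro!: continuous_intros)

text \<open>With \<open>e\<close> the point of the unit circle at the same angle, the foot point is
  \<open>Re e = (e + 1 / e) / 2\<close>. The distance to it is at most
  \<open>((r - 1) + (1 - 1 / r)) / 2\<close>, which is the semi-minor axis.\<close>

lemma ellipse_in_stadium:
  assumes r: "1 < r" "(r - 1 / r) / 2 < \<zeta>"
  shows "ellipse r t \<in> stadium \<zeta>"
proof (rule stadiumI)
  define e where "e = exp (2 * of_real pi * \<i> * of_real t)"
  have e: "cmod e = 1" "e \<noteq> 0" unfolding e_def by auto
  have ie: "1 / e = cnj e"
    using e complex_norm_square[of e] by (simp add: field_simps)
  have y: "complex_of_real (Re e) = (e + 1 / e) / 2"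
    unfolding ie by (simp add: complex_add_cnj)
  show "\<bar>Re e\<bar> \<le> 1" using abs_Re_le_cmod[of e] e by simp
  have "ellipse r t - of_real (Re e) = (of_real (r - 1) * e - of_real (1 - 1 / r) * (1 / e)) / 2"
    unfolding y ellipse_def circ_def e_def[symmetric] using e r by (simp add: field_simps)
  also have "cmod \<dots> \<le> (cmod (of_real (r - 1) * e) + cmod (of_real (1 - 1 / r) * (1 / e))) / 2"
    using norm_triangle_ineq4[of "of_real (r - 1) * e" "of_real (1 - 1 / r) * (1 / e)"] by simp
  also have "\<dots> = (r - 1 / r) / 2"
    using e r by (simp only: norm_mult norm_of_real norm_divide norm_one) (simp add: field_simps)
  also have "\<dots> < \<zeta>" by fact
  finally show "cmod (ellipse r t - of_real (Re e)) < \<zeta>" .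
qed

text \<open>Expansion of the Cauchy kernel on the ellipse, whose points are \<open>(a + 1 / a) / 2\<close>.\<close>

lemma cheb_generating:
  assumes w: "w \<noteq> 0" "1 \<le> cmod w" and a: "cmod w < cmod a" and z: "z = (w + 1 / w) / 2"
  shows "(\<lambda>m. (if m = 0 then 1 else 2) * (1 / a) ^ m * cheb m z) sums
           ((a - 1 / a) / 2 / ((a + 1 / a) / 2 - z))"
    and "(a + 1 / a) / 2 \<noteq> z"
proof -
  have a0: "a \<noteq> 0" and aw: "a \<noteq> w" using w a by auto
  have "1 < cmod (w * a)" unfolding norm_mult using w a mult_less_le_imp_less[of 1 "cmod a" 1 "cmod w"]
    by (simp add: mult.commute)
  then have aw1: "w * a \<noteq> 1" and n2: "cmod (1 / (w * a)) < 1"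
    unfolding norm_divide norm_one divide_less_eq_1 by auto
  have n1: "cmod (w / a) < 1" using a a0 by (simp add: norm_divide)
  have fac: "(a + 1 / a) / 2 - z = (a - w) * (w * a - 1) / (2 * (w * a))"
    unfolding z using a0 w by (simp add: field_simps)
  show "(a + 1 / a) / 2 \<noteq> z"
  proof
    assume "(a + 1 / a) / 2 = z"
    then have "(a - w) * (w * a - 1) / (2 * (w * a)) = 0" using fac by simp
    then show False using a0 w aw aw1 by simp
  qed
  \<comment> \<open>Two geometric series; their terms at \<open>m = 0\<close> are both 1, and one of
    them is removed to match the coefficient 1 instead of 2.\<close>
  have "(\<lambda>m. (w / a) ^ m + (1 / (w * a)) ^ m - (if m = 0 then 1 else 0)) sums
          (1 / (1 - w / a) + 1 / (1 - 1 / (w * a)) - 1)"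
    using sums_single[of 0 "\<lambda>_. 1::complex"]
    by (intro sums_diff sums_add geometric_sums n1 n2) (simp add: eq_commute)
  moreover have "(w / a) ^ m + (1 / (w * a)) ^ m - (if m = 0 then 1 else 0) =
      (if m = 0 then 1 else 2) * (1 / a) ^ m * cheb m z" for m
    unfolding z cheb_joukowski[OF w(1)] using a0 w(1) by (simp add: power_divide power_mult_distrib field_simps)
  moreover have "1 / (1 - w / a) + 1 / (1 - 1 / (w * a)) - 1 = (a - 1 / a) / 2 / ((a + 1 / a) / 2 - z)"
  proof -
    have 1: "1 / (1 - w / a) = a / (a - w)" "1 / (1 - 1 / (w * a)) = w * a / (w * a - 1)"
      using a0 w aw aw1 by (simp_all add: field_simps)
    have "a / (a - w) + w * a / (w * a - 1) - 1 = (w * a * a - w) / ((a - w) * (w * a - 1))"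
    proof -
      define X Y where "X = a - w" and "Y = w * a - 1"
      have "X \<noteq> 0" "Y \<noteq> 0" using aw aw1 unfolding X_def Y_def by auto
      then have "a / X + w * a / Y - 1 = (a * Y + w * a * X - X * Y) / (X * Y)" by (simp add: field_simps)
      also have "a * Y + w * a * X - X * Y = w * a * a - w" unfolding X_def Y_def by (simp add: algebra_simps)
      finally show ?thesis unfolding X_def Y_def .
    qed
    also have "\<dots> = (a - 1 / a) / 2 / ((a - w) * (w * a - 1) / (2 * (w * a)))"
    proof -
      have "(a - 1 / a) * (w * a) = w * a * a - w" using a0 by (simp add: field_simps)
      moreover have "(a - 1 / a) / 2 / (P / (2 * (w * a))) = ((a - 1 / a) * (w * a)) / P" for P by simp
      ultimately show ?thesis by (simp only:)
    qed
    finally show ?thesis unfolding 1 fac .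
  qed
  ultimately show "(\<lambda>m. (if m = 0 then 1 else 2) * (1 / a) ^ m * cheb m z) sums
           ((a - 1 / a) / 2 / ((a + 1 / a) / 2 - z))" by simp
qed

text \<open>For \<open>m > 0\<close> an exponential is integrated over full periods. The result
  serves to determine the winding number of the ellipse without geometry.\<close>

lemma cheb_coeff_one:
  assumes r: "0 < r"
  shows "cheb_coeff r (\<lambda>_. 1) m = (if m = 0 then 1 else 0)"
proof (cases "m = 0")
  case False
  define c where "c = - (2 * of_real pi * \<i> * of_nat m)"
  have c: "c \<noteq> 0" using False unfolding c_def by simp
  have eq: "(1 / circ r t) ^ m = of_real ((1 / r) ^ m) * exp (c * of_real t)" for t
  proof -
    have "(1 / circ r t) ^ m = of_real ((1 / r) ^ m) * exp (- (2 * of_real pi * \<i> * of_real t)) ^ m"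
      unfolding circ_def by (simp add: exp_minus power_divide power_mult_distrib field_simps)
    also have "exp (- (2 * of_real pi * \<i> * of_real t)) ^ m = exp (c * of_real t)"
      unfolding c_def by (simp add: algebra_simps flip: exp_of_nat_mult)
    finally show ?thesis .
  qed
  have "((\<lambda>t. exp (c * of_real t)) has_integral exp (c * of_real 1) / c - exp (c * of_real 0) / c) {0..1}"
    by (rule fundamental_theorem_of_calculus)
       (use c in \<open>auto intro!: has_vector_derivative_real_field derivative_eq_intros\<close>)
  moreover have "exp c = 1" unfolding c_def exp_minus
    using exp_integer_2pi[of "of_nat m"] by (simp add: algebra_simps)
  ultimately have "((\<lambda>t. exp (c * of_real t)) has_integral 0) {0..1}" by simp
  then have "((\<lambda>t. of_real ((1 / r) ^ m) * exp (c * of_real t)) has_integral of_real ((1 / r) ^ m) * 0) {0..1}"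
    by (rule has_integral_mult_right)
  then have "integral {0..1} (\<lambda>t. (1 / circ r t) ^ m) = 0"
    unfolding eq by (simp only: integral_unique mult_zero_right)
  then show ?thesis unfolding cheb_coeff_def using False by simp
qed (simp add: cheb_coeff_def)

text \<open>Cauchy's integral formula on the ellipse, with the kernel expanded into Chebyshev
  polynomials. Termwise integration is justified by the M-test with ratio
  \<open>\<sigma> / r\<close>: the polynomials grow at most like \<open>\<sigma> ^ m\<close> at
  \<open>z\<close>, while the kernel coefficients decay like \<open>r ^ m\<close>. The winding
  number is carried along as an unknown factor.\<close>

lemma cheb_expansion_winding:
  assumes r: "1 < r" "(r - 1 / r) / 2 < \<zeta>"
    and \<sigma>: "1 \<le> \<sigma>" "\<sigma> < r" "2 + 2 * s \<le> \<sigma> + 1 / \<sigma>"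
    and f: "f holomorphic_on stadium \<zeta>" and z: "z \<in> stadium s" "z \<in> stadium \<zeta>"
  shows "(\<lambda>m. cheb_coeff r f m * cheb m z) sums (winding_number (ellipse r) z * f z)"
proof -
  obtain w where w: "w \<noteq> 0" "z = (w + 1 / w) / 2" "1 \<le> cmod w" "cmod w \<le> \<sigma>"
    using stadium_joukowski[OF z(1) \<sigma>(1,3)] by blast
  have r0: "0 < r" using r by simp
  define D where "D t = of_real pi * \<i> * (circ r t - 1 / circ r t)" for t
  have der: "(ellipse r has_vector_derivative D t) (at t within A)" for t A
    unfolding D_def by (rule ellipse_has_vector_derivative[OF r0])
  have contD: "continuous_on A D" for A
    unfolding D_def using circ_nonzero[OF r0] by (auto intro!: continuous_intros)
  have wa: "cmod w < cmod (circ r t)" for t using w \<sigma> norm_circ[OF r0] by simp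
  note gen = cheb_generating[OF w(1,3) wa w(2)]
  have contf: "continuous_on {0..1} (\<lambda>t. f (ellipse r t))"
    by (rule continuous_on_compose2[OF holomorphic_on_imp_continuous_on[OF f] continuous_on_ellipse[OF r0]])
       (use ellipse_in_stadium[OF r] in auto)
  have vp: "valid_path (ellipse r)"
    unfolding valid_path_def
    by (rule C1_differentiable_imp_piecewise) (use der contD in \<open>auto simp: C1_differentiable_on_def\<close>)
  have e01: "circ r 0 = circ r 1" unfolding circ_def by simp
  have "((\<lambda>u. f u / (u - z)) has_contour_integral (2*pi * \<i> * winding_number (ellipse r) z * f z)) (ellipse r)"
  proof (rule Cauchy_integral_formula_convex_simple[OF convex_stadium f])
    show "z \<in> interior (stadium \<zeta>)" using z by (simp add: interior_open)
    show "path_image (ellipse r) \<subseteq> stadium \<zeta> - {z}"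
      unfolding path_image_def using ellipse_in_stadium[OF r] gen(2)[folded ellipse_def] by blast
    show "pathfinish (ellipse r) = pathstart (ellipse r)"
      unfolding pathfinish_def pathstart_def ellipse_def e01 ..
  qed (rule vp)
  then have "((\<lambda>t. f (ellipse r t) / (ellipse r t - z) * vector_derivative (ellipse r) (at t within {0..1}))
      has_integral (2*pi * \<i> * winding_number (ellipse r) z * f z)) {0..1}"
    unfolding has_contour_integral_def .
  then have "((\<lambda>t. f (ellipse r t) / (ellipse r t - z) * D t)
      has_integral (2*pi * \<i> * winding_number (ellipse r) z * f z)) {0..1}"
    by (rule has_integral_eq[rotated])
       (use vector_derivative_within_cbox[of 0 1] der in \<open>auto intro!: vector_derivative_within_cbox[of 0 1, simplified]\<close>)
  then have "((\<lambda>t. 1 / (2*pi * \<i>) * (f (ellipse r t) / (ellipse r t - z) * D t))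
      has_integral 1 / (2*pi * \<i>) * (2*pi * \<i> * winding_number (ellipse r) z * f z)) {0..1}"
    by (rule has_integral_mult_right)
  moreover have "1 / (2*pi * \<i>) * (f (ellipse r t) / (ellipse r t - z) * D t) =
      f (ellipse r t) * ((circ r t - 1 / circ r t) / 2 / ((circ r t + 1 / circ r t) / 2 - z))" for t
  proof -
    have "1 / (2*pi * \<i>) * (X * (of_real pi * \<i> * c)) = X * (c / 2)" for X c :: complex
      by (simp add: field_simps)
    then show ?thesis unfolding D_def ellipse_def[of r t, symmetric] by simp
  qed
  ultimately have cauchy: "((\<lambda>t. f (ellipse r t) * ((circ r t - 1 / circ r t) / 2 / ((circ r t + 1 / circ r t) / 2 - z)))
      has_integral winding_number (ellipse r) z * f z) {0..1}" by simp
  define g where "g m t = f (ellipse r t) * ((if m = 0 then 1 else 2) * (1 / circ r t) ^ m * cheb m z)" for m t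
  have contg: "continuous_on {0..1} (g m)" for m
    unfolding g_def using circ_nonzero[OF r0] by (intro continuous_intros contf) auto
  have "bounded ((\<lambda>t. f (ellipse r t)) ` {0..1})"
    using contf by (intro compact_imp_bounded compact_continuous_image) auto
  then obtain B where "\<forall>u\<in>(\<lambda>t. f (ellipse r t)) ` {0..1}. cmod u \<le> B"
    unfolding bounded_iff by blast
  then have B: "cmod (f (ellipse r t)) \<le> B" if "t \<in> {0..1}" for t using that by blast
  have B0: "0 \<le> B" using order_trans[OF norm_ge_zero B[of 0]] by simp
  have "uniform_limit {0..1} (\<lambda>N t. \<Sum>m<N. g m t) (\<lambda>t. \<Sum>m. g m t) sequentially"
  proof (rule Weierstrass_m_test)
    fix m t assume t: "t \<in> {0..1::real}"
    have "cmod (g m t) \<le> B * (2 * (1 / r) ^ m * \<sigma> ^ m)"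
      unfolding g_def norm_mult using B[OF t] B0 r0 cheb_bound[OF z(1) \<sigma>(1,3), of m] \<sigma>(1)
      by (intro mult_mono) (auto simp: norm_power norm_divide norm_circ)
    then show "cmod (g m t) \<le> 2 * B * (\<sigma> / r) ^ m" by (simp add: power_divide field_simps)
  next
    show "summable (\<lambda>m. 2 * B * (\<sigma> / r) ^ m)"
      using \<sigma> r0 by (intro summable_mult summable_geometric) simp
  qed
  then obtain I J where I: "\<And>N. ((\<lambda>t. \<Sum>m<N. g m t) has_integral I N) {0..1}"
    and J: "((\<lambda>t. \<Sum>m. g m t) has_integral J) {0..1}" and IJ: "I \<longlonglongrightarrow> J"
    by (rule uniform_limit_integral) (auto intro!: continuous_intros contg)
  have "(\<Sum>m. g m t) = f (ellipse r t) * ((circ r t - 1 / circ r t) / 2 / ((circ r t + 1 / circ r t) / 2 - z))" for t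
    unfolding g_def using sums_mult[OF gen(1)] by (intro sums_unique[symmetric])
  then have "J = winding_number (ellipse r) z * f z"
    using J cauchy by (simp add: has_integral_unique)
  moreover have "I N = (\<Sum>m<N. cheb_coeff r f m * cheb m z)" for N
  proof -
    have "(g m has_integral cheb_coeff r f m * cheb m z) {0..1}" for m
    proof -
      have "(\<lambda>t. f (ellipse r t) * (1 / circ r t) ^ m) integrable_on {0..1}"
        using circ_nonzero[OF r0] by (intro integrable_continuous_real continuous_intros contf) auto
      then have "((\<lambda>t. (if m = 0 then 1 else 2) * (f (ellipse r t) * (1 / circ r t) ^ m) * cheb m z)
         has_integral cheb_coeff r f m * cheb m z) {0..1}"
        unfolding cheb_coeff_def by (intro has_integral_mult_left has_integral_mult_right integrable_integral)
      then show ?thesis unfolding g_def by (simp add: mult_ac)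
    qed
    then have "((\<lambda>t. \<Sum>m<N. g m t) has_integral (\<Sum>m<N. cheb_coeff r f m * cheb m z)) {0..1}"
      by (intro has_integral_sum) auto
    then show ?thesis using I has_integral_unique by blast
  qed
  then have "I = (\<lambda>N. \<Sum>m<N. cheb_coeff r f m * cheb m z)" by blast
  ultimately show ?thesis using IJ unfolding sums_def by simp
qed

text \<open>Applied to the constant function 1, the expansion shows that the winding number is 1.\<close>

lemma cheb_expansion:
  assumes r: "1 < r" "(r - 1 / r) / 2 < \<zeta>"
    and \<sigma>: "1 \<le> \<sigma>" "\<sigma> < r" "2 + 2 * s \<le> \<sigma> + 1 / \<sigma>"
    and f: "f holomorphic_on stadium \<zeta>" and z: "z \<in> stadium s" "z \<in> stadium \<zeta>"
  shows "(\<lambda>m. cheb_coeff r f m * cheb m z) sums f z"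
proof -
  have "(\<lambda>m. cheb_coeff r (\<lambda>_. 1) m * cheb m z) sums (winding_number (ellipse r) z * 1)"
    by (rule cheb_expansion_winding[OF r \<sigma> _ z]) auto
  moreover have "(\<lambda>m. cheb_coeff r (\<lambda>_. 1) m * cheb m z) sums 1"
  proof -
    have "(\<lambda>m. cheb_coeff r (\<lambda>_. 1) m * cheb m z) = (\<lambda>m. if m = 0 then 1 else 0)"
      using r by (auto simp: cheb_coeff_one)
    then show ?thesis using sums_single[of 0 "\<lambda>_. 1::complex"] by (simp add: eq_commute)
  qed
  ultimately have "winding_number (ellipse r) z = 1" using sums_unique2 by fastforce
  then show ?thesis using cheb_expansion_winding[OF r \<sigma> f z] by simp
qed

section \<open>Approximation by polynomials with hyperbolic-cross-like index sets\<close>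

definition cpoly :: "nat \<Rightarrow> (nat \<Rightarrow> nat) set \<Rightarrow> ((nat \<Rightarrow> complex) \<Rightarrow> complex) set" where
  "cpoly n \<Lambda> = {P. \<exists>S c. finite S \<and> S \<subseteq> \<Lambda> \<and> P = (\<lambda>z. \<Sum>\<nu>\<in>S. c \<nu> * (\<Prod>j\<in>{1..n}. z j ^ \<nu> j))}"

text \<open>In logarithms these are the lattice points of a simplex. The product form suits
  induction on \<open>n\<close>: the exponents with last entry \<open>m\<close> form the set in one
  variable less for the threshold \<open>e * \<rho> ^ m\<close>, with \<open>\<rho>\<close> taken at
  the last variable.\<close>

definition index_simplex :: "nat \<Rightarrow> (nat \<Rightarrow> real) \<Rightarrow> real \<Rightarrow> (nat \<Rightarrow> nat) set" where
  "index_simplex n \<rho> e = {\<nu> \<in> {1..n} \<rightarrow>\<^sub>E UNIV. e * (\<Prod>j\<in>{1..n}. \<rho> j ^ \<nu> j) \<le> 1}"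

lemma cpolyI:
  "finite S \<Longrightarrow> S \<subseteq> \<Lambda> \<Longrightarrow> (\<And>z. P z = (\<Sum>\<nu>\<in>S. c \<nu> * (\<Prod>j\<in>{1..n}. z j ^ \<nu> j))) \<Longrightarrow> P \<in> cpoly n \<Lambda>"
  unfolding cpoly_def by blast

lemma cpoly_zero: "(\<lambda>z. 0) \<in> cpoly n \<Lambda>"
  by (rule cpolyI[of "{}"]) auto

lemma cpoly_cmult:
  assumes "P \<in> cpoly n \<Lambda>"
  shows "(\<lambda>z. a * P z) \<in> cpoly n \<Lambda>"
proof -
  obtain S c where S: "finite S" "S \<subseteq> \<Lambda>" "P = (\<lambda>z. \<Sum>\<nu>\<in>S. c \<nu> * (\<Prod>j\<in>{1..n}. z j ^ \<nu> j))"
    using assms unfolding cpoly_def by blast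
  show ?thesis
    by (rule cpolyI[of S, where c = "\<lambda>\<nu>. a * c \<nu>"]) (use S in \<open>auto simp: sum_distrib_left mult.assoc\<close>)
qed

lemma cpoly_add:
  assumes "P \<in> cpoly n \<Lambda>" "Q \<in> cpoly n \<Lambda>"
  shows "(\<lambda>z. P z + Q z) \<in> cpoly n \<Lambda>"
proof -
  obtain S c where S: "finite S" "S \<subseteq> \<Lambda>" "P = (\<lambda>z. \<Sum>\<nu>\<in>S. c \<nu> * (\<Prod>j\<in>{1..n}. z j ^ \<nu> j))"
    using assms unfolding cpoly_def by blast
  obtain S' c' where S': "finite S'" "S' \<subseteq> \<Lambda>" "Q = (\<lambda>z. \<Sum>\<nu>\<in>S'. c' \<nu> * (\<Prod>j\<in>{1..n}. z j ^ \<nu> j))"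
    using assms unfolding cpoly_def by blast
  show ?thesis
  proof (rule cpolyI[of "S \<union> S'", where c = "\<lambda>\<nu>. (if \<nu> \<in> S then c \<nu> else 0) + (if \<nu> \<in> S' then c' \<nu> else 0)"])
    fix z :: "nat \<Rightarrow> complex"
    let ?m = "\<lambda>\<nu>. \<Prod>j\<in>{1..n}. z j ^ \<nu> j"
    have "P z = (\<Sum>\<nu>\<in>S \<union> S'. (if \<nu> \<in> S then c \<nu> else 0) * ?m \<nu>)"
      unfolding S(3) using S(1) S'(1) by (intro sum.mono_neutral_cong_left) auto
    moreover have "Q z = (\<Sum>\<nu>\<in>S \<union> S'. (if \<nu> \<in> S' then c' \<nu> else 0) * ?m \<nu>)"
      unfolding S'(3) using S(1) S'(1) by (intro sum.mono_neutral_cong_left) auto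
    ultimately show "P z + Q z = (\<Sum>\<nu>\<in>S \<union> S'. ((if \<nu> \<in> S then c \<nu> else 0) + (if \<nu> \<in> S' then c' \<nu> else 0)) * ?m \<nu>)"
      by (simp only: distrib_right sum.distrib)
  qed (use S S' in auto)
qed

lemma cpoly_sum:
  "finite A \<Longrightarrow> (\<And>a. a \<in> A \<Longrightarrow> P a \<in> cpoly n \<Lambda>) \<Longrightarrow> (\<lambda>z. \<Sum>a\<in>A. P a z) \<in> cpoly n \<Lambda>"
  by (induction A rule: finite_induct) (auto intro!: cpoly_zero cpoly_add)

lemma cpoly_mult_power_Suc:
  assumes "P \<in> cpoly n \<Lambda>" and \<Lambda>: "\<And>\<nu>. \<nu> \<in> \<Lambda> \<Longrightarrow> \<nu> \<in> {1..n} \<rightarrow>\<^sub>E UNIV \<and> \<nu>(Suc n := i) \<in> \<Lambda>'"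
  shows "(\<lambda>z. P z * z (Suc n) ^ i) \<in> cpoly (Suc n) \<Lambda>'"
proof -
  obtain S c where S: "finite S" "S \<subseteq> \<Lambda>" "P = (\<lambda>z. \<Sum>\<nu>\<in>S. c \<nu> * (\<Prod>j\<in>{1..n}. z j ^ \<nu> j))"
    using assms unfolding cpoly_def by blast
  define u where "u \<nu> = \<nu>(Suc n := i)" for \<nu> :: "nat \<Rightarrow> nat"
  \<comment> \<open>Old exponents are extensional on \<open>{1..n}\<close>, so resetting the new
    coordinate to \<open>undefined\<close> inverts \<open>u\<close>. This gives injectivity and
    reads off the coefficients of the reindexed sum.\<close>
  have restore: "(u \<nu>)(Suc n := undefined) = \<nu>" if "\<nu> \<in> S" for \<nu>
  proof -
    have "\<nu> \<in> {1..n} \<rightarrow>\<^sub>E UNIV" using that S(2) \<Lambda> by blast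
    then have "\<nu> (Suc n) = undefined" by (intro PiE_arb[of \<nu> "{1..n}"]) auto
    then show ?thesis unfolding u_def by auto
  qed
  then have inj: "inj_on u S" by (metis (lifting) inj_onI)
  show ?thesis
  proof (rule cpolyI[of "u ` S", where c = "\<lambda>\<nu>. c (\<nu>(Suc n := undefined))"])
    fix z :: "nat \<Rightarrow> complex"
    have "(\<Sum>\<nu>\<in>u ` S. c (\<nu>(Suc n := undefined)) * (\<Prod>j\<in>{1..Suc n}. z j ^ \<nu> j))
        = (\<Sum>\<nu>\<in>S. c ((u \<nu>)(Suc n := undefined)) * (\<Prod>j\<in>{1..Suc n}. z j ^ (u \<nu>) j))"
      by (subst sum.reindex[OF inj]) (simp add: o_def)
    also have "\<dots> = (\<Sum>\<nu>\<in>S. c \<nu> * ((\<Prod>j\<in>{1..n}. z j ^ \<nu> j) * z (Suc n) ^ i))"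
    proof (rule sum.cong[OF refl])
      fix \<nu> assume "\<nu> \<in> S"
      have "(\<Prod>j\<in>{1..Suc n}. z j ^ (u \<nu>) j) = (\<Prod>j\<in>{1..n}. z j ^ (u \<nu>) j) * z (Suc n) ^ i"
        by (simp add: u_def)
      also have "(\<Prod>j\<in>{1..n}. z j ^ (u \<nu>) j) = (\<Prod>j\<in>{1..n}. z j ^ \<nu> j)"
        by (rule prod.cong) (auto simp: u_def)
      finally show "c ((u \<nu>)(Suc n := undefined)) * (\<Prod>j\<in>{1..Suc n}. z j ^ (u \<nu>) j)
         = c \<nu> * ((\<Prod>j\<in>{1..n}. z j ^ \<nu> j) * z (Suc n) ^ i)"
        by (simp only: restore[OF \<open>\<nu> \<in> S\<close>])
    qed
    also have "\<dots> = P z * z (Suc n) ^ i"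
      unfolding S(3) by (simp add: sum_distrib_right mult.assoc)
    finally show "P z * z (Suc n) ^ i = (\<Sum>\<nu>\<in>u ` S. c (\<nu>(Suc n := undefined)) * (\<Prod>j\<in>{1..Suc n}. z j ^ \<nu> j))"
      by simp
  qed (use S \<Lambda> in \<open>auto simp: u_def\<close>)
qed

lemma sep_hol_drop_last:
  assumes F: "sep_hol (Suc n) s B F" and indep: "\<And>z t. F (z(Suc n := t)) = F z" and s: "0 < s (Suc n)"
  shows "sep_hol n s B F"
proof (rule sep_holI)
  fix z w :: "nat \<Rightarrow> complex" assume zw: "\<And>i. i \<in> {1..n} \<Longrightarrow> z i = w i"
  have "F (z(Suc n := 0)) = F (w(Suc n := 0))"
    using zw by (intro sep_hol_cong[OF F]) auto
  then show "F z = F w" by (simp only: indep)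
next
  fix z assume z: "z \<in> poly_stadium n s"
  have "0 \<in> stadium (s (Suc n))" using of_real_in_stadium[OF s, of 0] by simp
  then have z': "z(Suc n := 0) \<in> poly_stadium (Suc n) s"
    using z unfolding poly_stadium_def by auto
  show "cmod (F z) \<le> B" using sep_hol_bound[OF F z'] by (simp only: indep)
  fix i assume i: "i \<in> {1..n}"
  then have "(\<lambda>t. F ((z(i := t))(Suc n := 0))) holomorphic_on stadium (s i)"
    using sep_hol_hol[OF F z', of i] by (simp add: fun_upd_twist)
  then show "(\<lambda>t. F (z(i := t))) holomorphic_on stadium (s i)" by (simp only: indep)
qed

text \<open>The coefficient is a parametric integral over the ellipse in the last variable, hence
  holomorphic in the remaining ones; the decay is read off from \<open>cmod (circ r t) = r\<close>.
  Keeping the ellipse as large as the stadium allows makes this decay faster than the threshold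
  grows.\<close>

lemma sep_hol_cheb_coeff:
  assumes F: "sep_hol (Suc n) \<zeta> B F" and r: "1 < r" "(r - 1 / r) / 2 < \<zeta> (Suc n)"
  shows "sep_hol n \<zeta> (2 * B / r ^ m) (\<lambda>z. cheb_coeff r (\<lambda>t. F (z(Suc n := t))) m)"
proof (rule sep_hol_drop_last)
  have r0: "0 < r" using r by simp
  have "sep_hol (Suc n) \<zeta> (2 * (B * (1 / r ^ m)))
     (\<lambda>z. (if m = 0 then 1 else 2) * integral {0..1} (\<lambda>t. F (z(Suc n := ellipse r t)) * (1 / circ r t) ^ m))"
  proof (rule sep_hol_mult[OF sep_hol_const sep_hol_integral])
    show "sep_hol (Suc n) \<zeta> (B * (1 / r ^ m)) (\<lambda>z. F (z(Suc n := ellipse r t)) * (1 / circ r t) ^ m)" for t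
      by (intro sep_hol_mult sep_hol_fix[OF F] ellipse_in_stadium r sep_hol_const)
         (simp add: norm_power norm_divide norm_circ[OF r0] power_one_over)
    show "continuous_on {0..1} (\<lambda>t. F (z(Suc n := ellipse r t)) * (1 / circ r t) ^ m)"
      if "z \<in> poly_stadium (Suc n) \<zeta>" for z
      using circ_nonzero[OF r0] ellipse_in_stadium[OF r]
      by (intro continuous_intros sep_hol_continuous_path[OF F that] continuous_on_ellipse r0) auto
  qed auto
  then show "sep_hol (Suc n) \<zeta> (2 * B / r ^ m) (\<lambda>z. cheb_coeff r (\<lambda>t. F (z(Suc n := t))) m)"
    unfolding cheb_coeff_def by simp
  have "0 < (r - 1 / r) / 2" using r by (simp add: field_simps) (smt (verit) mult_less_cancel_left2)
  then show "0 < \<zeta> (Suc n)" using r(2) by linarith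
qed simp

text \<open>
  Induction on the number of variables: the Chebyshev coefficient of order \<open>m\<close> in the last
  variable is approximated with the threshold \<open>e * \<rho>\<^sup>m\<close>, or by 0 once this exceeds 1.
\<close>

lemma sep_hol_polynomial_approx:
  assumes par: "\<And>i. i \<in> {1..n} \<Longrightarrow> 1 < \<rho> i \<and> 1 \<le> \<sigma> i \<and> \<rho> i * \<sigma> i < r i \<and>
      (r i - 1 / r i) / 2 < \<zeta> i \<and> 2 + 2 * s \<le> \<sigma> i + 1 / \<sigma> i \<and> s \<le> \<zeta> i"
  shows "\<exists>C\<ge>0. \<forall>F B e. sep_hol n \<zeta> B F \<longrightarrow> 0 \<le> B \<longrightarrow> 0 < e \<longrightarrow>
    (\<exists>P\<in>cpoly n (index_simplex n \<rho> e). \<forall>z\<in>poly_stadium n (\<lambda>_. s). cmod (F z - P z) \<le> C * B * e)"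
  using par
proof (induction n)
  case 0
  show ?case
  proof (intro exI[of _ 1] conjI allI impI)
    fix F B and e :: real assume F: "sep_hol 0 \<zeta> B F" and B: "0 \<le> B" and e: "0 < e"
    have all: "z \<in> poly_stadium 0 t" for z t unfolding poly_stadium_def by simp
    have cst: "F z = F w" for z w by (rule sep_hol_cong[OF F]) auto
    show "\<exists>P\<in>cpoly 0 (index_simplex 0 \<rho> e). \<forall>z\<in>poly_stadium 0 (\<lambda>_. s). cmod (F z - P z) \<le> 1 * B * e"
    proof (cases "e \<le> 1")
      case True
      have "F \<in> cpoly 0 (index_simplex 0 \<rho> e)"
        by (rule cpolyI[of "{\<lambda>_. undefined}", where c = "\<lambda>_. F (\<lambda>_. 0)"])
           (use True cst in \<open>auto simp: index_simplex_def\<close>)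
      then show ?thesis using B e by (intro bexI[of _ F]) auto
    next
      case False
      have "cmod (F z) \<le> B * e" for z
        using sep_hol_bound[OF F all[of z]] False B mult_left_mono[of 1 e B] by simp
      then show ?thesis using cpoly_zero by (intro bexI[of _ "\<lambda>_. 0"]) auto
    qed
  qed auto
next
  case (Suc n)
  define k where "k = Suc n"
  have k: "1 < \<rho> k" "1 \<le> \<sigma> k" "\<rho> k * \<sigma> k < r k" "(r k - 1 / r k) / 2 < \<zeta> k"
    "2 + 2 * s \<le> \<sigma> k + 1 / \<sigma> k" "s \<le> \<zeta> k"
    using Suc.prems[of k] unfolding k_def by auto
  have \<sigma>r: "\<sigma> k < r k"
  proof -
    have "1 * \<sigma> k \<le> \<rho> k * \<sigma> k" using k by (intro mult_right_mono) auto
    then show ?thesis using k(3) by linarith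
  qed
  have r1: "1 < r k" and r0: "0 < r k" using \<sigma>r k by auto
  obtain C where C: "0 \<le> C" and IH: "\<And>F B e. sep_hol n \<zeta> B F \<Longrightarrow> 0 \<le> B \<Longrightarrow> 0 < e \<Longrightarrow>
    (\<exists>P\<in>cpoly n (index_simplex n \<rho> e). \<forall>z\<in>poly_stadium n (\<lambda>_. s). cmod (F z - P z) \<le> C * B * e)"
    using Suc.IH[OF Suc.prems] by auto
  \<comment> \<open>For a degree outside \<open>M\<close> the zero polynomial is used, whose error
    is the bound on the coefficient itself; this requires a constant of at least 1.\<close>
  define C' where "C' = max C 1"
  \<comment> \<open>At degree \<open>m\<close> the coefficient decays like \<open>1 / r ^ m\<close>,
    the raised threshold contributes \<open>\<rho> ^ m\<close> and the Chebyshev polynomial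
    \<open>\<sigma> ^ m\<close>. Their product is the geometric sequence that is summed.\<close>
  define q where "q = \<rho> k * \<sigma> k / r k"
  have q: "0 \<le> q" "q < 1" unfolding q_def using k r0 by auto
  show ?case
  proof (intro exI[of _ "2 * C' / (1 - q)"] conjI allI impI)
    show "0 \<le> 2 * C' / (1 - q)" unfolding C'_def using q by auto
    fix F B and e :: real assume F: "sep_hol (Suc n) \<zeta> B F" and B: "0 \<le> B" and e: "0 < e"
    define a where "a m z = cheb_coeff (r k) (\<lambda>t. F (z(k := t))) m" for m z
    have ahol: "sep_hol n \<zeta> (2 * B / r k ^ m) (a m)" for m
      unfolding a_def k_def using sep_hol_cheb_coeff[OF F, of "r k" m] r1 k(4) unfolding k_def by simp
    define M where "M = {m. e * \<rho> k ^ m \<le> 1}"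
    have finM: "finite M"
    proof -
      obtain N where N: "1 / e < \<rho> k ^ N" using k(1) real_arch_pow by blast
      have "m \<le> N" if "m \<in> M" for m
      proof (rule ccontr)
        assume "\<not> m \<le> N"
        then have "\<rho> k ^ N \<le> \<rho> k ^ m" using k(1) by (intro power_increasing) auto
        then have "1 / e < \<rho> k ^ m" using N by simp
        then show False using that e unfolding M_def by (simp add: field_simps)
      qed
      then show ?thesis by (meson atMost_iff finite_atMost finite_subset subsetI)
    qed
    have bm: "0 \<le> 2 * B / r k ^ m" for m using B r0 by simp
    have "\<exists>P. (m \<in> M \<longrightarrow> P \<in> cpoly n (index_simplex n \<rho> (e * \<rho> k ^ m))) \<and> (m \<notin> M \<longrightarrow> P = (\<lambda>_. 0)) \<and>
        (\<forall>z\<in>poly_stadium n (\<lambda>_. s). cmod (a m z - P z) \<le> C' * (2 * B / r k ^ m) * (e * \<rho> k ^ m))" for m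
    proof (cases "m \<in> M")
      case True
      have em: "0 < e * \<rho> k ^ m" using e k by simp
      obtain P where P: "P \<in> cpoly n (index_simplex n \<rho> (e * \<rho> k ^ m))"
        "\<And>z. z \<in> poly_stadium n (\<lambda>_. s) \<Longrightarrow> cmod (a m z - P z) \<le> C * (2 * B / r k ^ m) * (e * \<rho> k ^ m)"
        using IH[OF ahol bm em] by blast
      have "C * (2 * B / r k ^ m) * (e * \<rho> k ^ m) \<le> C' * (2 * B / r k ^ m) * (e * \<rho> k ^ m)"
        unfolding C'_def using bm[of m] em by (intro mult_right_mono) auto
      then show ?thesis using True P by (intro exI[of _ P]) (auto intro: order_trans)
    next
      case False
      have "cmod (a m z - 0) \<le> C' * (2 * B / r k ^ m) * (e * \<rho> k ^ m)" if z: "z \<in> poly_stadium n (\<lambda>_. s)" for z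
      proof -
        have "z \<in> poly_stadium n \<zeta>"
          using z poly_stadium_mono[of n "\<lambda>_. s" \<zeta>] Suc.prems by auto
        then have "cmod (a m z - 0) \<le> 1 * (2 * B / r k ^ m) * 1" using sep_hol_bound[OF ahol] by simp
        also have "\<dots> \<le> C' * (2 * B / r k ^ m) * (e * \<rho> k ^ m)"
        proof (intro mult_mono)
          show "0 \<le> C' * (2 * B / r k ^ m)" by (intro mult_nonneg_nonneg bm) (simp add: C'_def)
        qed (use bm[of m] False in \<open>auto simp: C'_def M_def\<close>)
        finally show ?thesis .
      qed
      then show ?thesis using False by (intro exI[of _ "\<lambda>_. 0"]) auto
    qed
    then obtain P where PM: "\<And>m. m \<in> M \<Longrightarrow> P m \<in> cpoly n (index_simplex n \<rho> (e * \<rho> k ^ m))"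
      and P0: "\<And>m. m \<notin> M \<Longrightarrow> P m = (\<lambda>_. 0)"
      and Pb: "\<And>m z. z \<in> poly_stadium n (\<lambda>_. s) \<Longrightarrow> cmod (a m z - P m z) \<le> C' * (2 * B / r k ^ m) * (e * \<rho> k ^ m)"
      by metis
    show "\<exists>P\<in>cpoly (Suc n) (index_simplex (Suc n) \<rho> e). \<forall>z\<in>poly_stadium (Suc n) (\<lambda>_. s).
        cmod (F z - P z) \<le> 2 * C' / (1 - q) * B * e"
    proof (rule bexI[of _ "\<lambda>z. \<Sum>m\<in>M. P m z * cheb m (z k)"], rule ballI)
      fix z assume z: "z \<in> poly_stadium (Suc n) (\<lambda>_. s)"
      have zn: "z \<in> poly_stadium n (\<lambda>_. s)" using z unfolding poly_stadium_def by auto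
      have zk: "z k \<in> stadium s" using z unfolding k_def by (intro poly_stadiumD) auto
      then have zk': "z k \<in> stadium (\<zeta> k)" using stadium_mono[OF k(6)] by blast
      have z\<zeta>: "z \<in> poly_stadium (Suc n) \<zeta>"
        using z poly_stadium_mono[of "Suc n" "\<lambda>_. s" \<zeta>] Suc.prems by auto
      have "(\<lambda>m. a m z * cheb m (z k)) sums F (z(k := z k))"
        unfolding a_def
        by (rule cheb_expansion[OF r1 k(4,2) \<sigma>r k(5) _ zk zk'])
           (use sep_hol_hol[OF F z\<zeta>, of k] in \<open>simp add: k_def\<close>)
      moreover have "(\<lambda>m. P m z * cheb m (z k)) sums (\<Sum>m\<in>M. P m z * cheb m (z k))"
        using P0 by (intro sums_finite finM) auto
      ultimately have d: "(\<lambda>m. a m z * cheb m (z k) - P m z * cheb m (z k)) sums (F z - (\<Sum>m\<in>M. P m z * cheb m (z k)))"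
        by (intro sums_diff) simp_all
      have summand: "cmod (a m z * cheb m (z k) - P m z * cheb m (z k)) \<le> 2 * C' * B * e * q ^ m" for m
      proof -
        have "cmod (a m z * cheb m (z k) - P m z * cheb m (z k)) = cmod (a m z - P m z) * cmod (cheb m (z k))"
          by (simp add: norm_mult flip: left_diff_distrib)
        also have "\<dots> \<le> C' * (2 * B / r k ^ m) * (e * \<rho> k ^ m) * \<sigma> k ^ m"
          using Pb[OF zn, of m] cheb_bound[OF zk k(2,5), of m] k(2)
          by (intro mult_mono) (auto intro: order_trans[OF norm_ge_zero])
        also have "\<dots> = 2 * C' * B * e * q ^ m"
          unfolding q_def by (simp add: power_divide power_mult_distrib)
        finally show ?thesis .
      qed
      have "cmod (F z - (\<Sum>m\<in>M. P m z * cheb m (z k))) \<le> (\<Sum>m. 2 * C' * B * e * q ^ m)"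
        unfolding sums_unique[OF d] using q summand
        by (intro norm_suminf_le summable_mult summable_geometric) auto
      also have "\<dots> = 2 * C' * B * e * (1 / (1 - q))"
        using q by (subst suminf_mult) (auto simp: suminf_geometric intro!: summable_geometric)
      finally show "cmod (F z - (\<Sum>m\<in>M. P m z * cheb m (z k))) \<le> 2 * C' / (1 - q) * B * e"
        by (simp add: algebra_simps)
    next
      show "(\<lambda>z. \<Sum>m\<in>M. P m z * cheb m (z k)) \<in> cpoly (Suc n) (index_simplex (Suc n) \<rho> e)"
      proof (intro cpoly_sum finM)
        fix m assume m: "m \<in> M"
        obtain c where c: "\<And>z. cheb m z = (\<Sum>i\<le>m. c i * z ^ i)" using cheb_polynomial by blast
        have "(\<lambda>z. \<Sum>i\<in>{..m}. c i * (P m z * z (Suc n) ^ i)) \<in> cpoly (Suc n) (index_simplex (Suc n) \<rho> e)"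
        proof (intro cpoly_sum cpoly_cmult cpoly_mult_power_Suc[OF PM[OF m]])
          \<comment> \<open>Expanding \<open>cheb m\<close> brings in every power
            \<open>i \<le> m\<close> of the last variable. The index set contains them all, because
            lowering an exponent lowers the product when \<open>\<rho> k > 1\<close>.\<close>
          fix i \<nu> assume i: "i \<in> {..m}" and \<nu>: "\<nu> \<in> index_simplex n \<rho> (e * \<rho> k ^ m)"
          have ext: "\<nu> \<in> {1..n} \<rightarrow>\<^sub>E UNIV" using \<nu> unfolding index_simplex_def by auto
          have p0: "0 \<le> (\<Prod>j\<in>{1..n}. \<rho> j ^ \<nu> j)"
            using Suc.prems by (intro prod_nonneg) (force intro!: zero_le_power)
          have "(\<Prod>j\<in>{1..Suc n}. \<rho> j ^ (\<nu>(Suc n := i)) j) = (\<Prod>j\<in>{1..n}. \<rho> j ^ (\<nu>(Suc n := i)) j) * \<rho> k ^ i"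
            unfolding k_def by simp
          also have "(\<Prod>j\<in>{1..n}. \<rho> j ^ (\<nu>(Suc n := i)) j) = (\<Prod>j\<in>{1..n}. \<rho> j ^ \<nu> j)"
            by (rule prod.cong) auto
          finally have "e * (\<Prod>j\<in>{1..Suc n}. \<rho> j ^ (\<nu>(Suc n := i)) j) = e * ((\<Prod>j\<in>{1..n}. \<rho> j ^ \<nu> j) * \<rho> k ^ i)"
            by simp
          also have "\<dots> \<le> e * ((\<Prod>j\<in>{1..n}. \<rho> j ^ \<nu> j) * \<rho> k ^ m)"
            using p0 e k(1) i by (intro mult_left_mono power_increasing) auto
          also have "\<dots> \<le> 1" using \<nu> unfolding index_simplex_def by (simp add: algebra_simps)
          finally show "\<nu> \<in> {1..n} \<rightarrow>\<^sub>E UNIV \<and> \<nu>(Suc n := i) \<in> index_simplex (Suc n) \<rho> e"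
            using ext unfolding index_simplex_def by (auto simp: PiE_def extensional_def)
        qed auto
        moreover have "(\<lambda>z. \<Sum>i\<in>{..m}. c i * (P m z * z (Suc n) ^ i)) = (\<lambda>z. P m z * cheb m (z k))"
          unfolding c k_def by (simp add: sum_distrib_left mult_ac)
        ultimately show "(\<lambda>z. P m z * cheb m (z k)) \<in> cpoly (Suc n) (index_simplex (Suc n) \<rho> e)" by simp
      qed
    qed
  qed
qed

text \<open>Averaging \<open>P\<close> with its reflection replaces every coefficient by its real
  part. The error does not grow, because \<open>F\<close> agrees with its own reflection and the
  domain is symmetric.\<close>

lemma real_polynomial_approx:
  assumes P: "P \<in> cpoly n \<Lambda>"
    and sym: "\<And>z. z \<in> poly_stadium n s \<Longrightarrow> cnj (F (\<lambda>i. cnj (z i))) = F z"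
    and bd: "\<And>z. z \<in> poly_stadium n s \<Longrightarrow> cmod (F z - P z) \<le> \<eta>"
  obtains S c where "finite S" "S \<subseteq> \<Lambda>"
    "\<And>z. z \<in> poly_stadium n s \<Longrightarrow> cmod (F z - (\<Sum>\<nu>\<in>S. of_real (c \<nu>) * (\<Prod>j\<in>{1..n}. z j ^ \<nu> j))) \<le> \<eta>"
proof -
  obtain S c where S: "finite S" "S \<subseteq> \<Lambda>" "P = (\<lambda>z. \<Sum>\<nu>\<in>S. c \<nu> * (\<Prod>j\<in>{1..n}. z j ^ \<nu> j))"
    using P unfolding cpoly_def by blast
  show ?thesis
  proof (rule that[OF S(1,2), of "\<lambda>\<nu>. Re (c \<nu>)"])
    fix z assume z: "z \<in> poly_stadium n s"
    define z' where "z' = (\<lambda>i. cnj (z i))"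
    have z': "z' \<in> poly_stadium n s" using z cnj_in_stadium unfolding z'_def poly_stadium_def by auto
    have "(\<Sum>\<nu>\<in>S. of_real (Re (c \<nu>)) * (\<Prod>j\<in>{1..n}. z j ^ \<nu> j)) =
        (\<Sum>\<nu>\<in>S. (c \<nu> * (\<Prod>j\<in>{1..n}. z j ^ \<nu> j) + cnj (c \<nu>) * (\<Prod>j\<in>{1..n}. z j ^ \<nu> j)) / 2)"
    proof (rule sum.cong[OF refl])
      fix \<nu>
      have "complex_of_real (Re (c \<nu>)) = (c \<nu> + cnj (c \<nu>)) / 2" by (simp add: complex_add_cnj)
      then show "of_real (Re (c \<nu>)) * (\<Prod>j\<in>{1..n}. z j ^ \<nu> j)
        = (c \<nu> * (\<Prod>j\<in>{1..n}. z j ^ \<nu> j) + cnj (c \<nu>) * (\<Prod>j\<in>{1..n}. z j ^ \<nu> j)) / 2"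
        by (simp only: distrib_right times_divide_eq_left)
    qed
    also have "\<dots> = (P z + cnj (P z')) / 2"
      unfolding S(3) z'_def by (simp add: sum.distrib add_divide_distrib sum_divide_distrib)
    finally have "F z - (\<Sum>\<nu>\<in>S. of_real (Re (c \<nu>)) * (\<Prod>j\<in>{1..n}. z j ^ \<nu> j)) = ((F z - P z) + cnj (F z' - P z')) / 2"
      using sym[OF z] unfolding z'_def by (simp add: field_simps)
    also have "cmod \<dots> \<le> (cmod (F z - P z) + cmod (F z' - P z')) / 2"
      using norm_triangle_ineq[of "F z - P z" "cnj (F z' - P z')"] by (simp only: norm_divide complex_mod_cnj) simp
    also have "\<dots> \<le> \<eta>" using bd[OF z] bd[OF z'] by simp
    finally show "cmod (F z - (\<Sum>\<nu>\<in>S. of_real (Re (c \<nu>)) * (\<Prod>j\<in>{1..n}. z j ^ \<nu> j))) \<le> \<eta>" .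
  qed
qed

section \<open>Counting lattice points in a simplex\<close>

lemma power_diff_lower_bound:
  fixes x a :: real
  assumes "0 \<le> x" "0 \<le> a"
  shows "real (Suc k) * a * x ^ k \<le> (x + a) ^ Suc k - x ^ Suc k"
proof (induction k)
  case (Suc k)
  have "x ^ Suc k + real (Suc k) * a * x ^ k \<le> (x + a) ^ Suc k" using Suc by simp
  then have "(x + a) * (x ^ Suc k + real (Suc k) * a * x ^ k) \<le> (x + a) * (x + a) ^ Suc k"
    using assms by (intro mult_left_mono) auto
  moreover have "(x + a) * (x ^ Suc k + real (Suc k) * a * x ^ k) =
      x ^ Suc (Suc k) + real (Suc (Suc k)) * a * x ^ Suc k + real (Suc k) * a\<^sup>2 * x ^ k"
    by (simp add: algebra_simps power2_eq_square)
  moreover have "0 \<le> real (Suc k) * a\<^sup>2 * x ^ k" using assms by simp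
  ultimately show ?case by simp
qed (use assms in auto)

text \<open>A lower Riemann sum for the integral of \<open>(k + 1) * x ^ k\<close> from
  \<open>y - a * N\<close> to \<open>y + a\<close>, evaluated by telescoping.\<close>

lemma sum_power_arith_le:
  fixes a y :: real
  assumes "0 < a" "0 \<le> y - a * real N"
  shows "real (Suc k) * a * (\<Sum>n\<le>N. (y - a * real n) ^ k) + (y - a * real N) ^ Suc k \<le> (y + a) ^ Suc k"
  using assms(2)
proof (induction N)
  case 0
  then show ?case using power_diff_lower_bound[of y a k] assms(1) by simp
next
  case (Suc N)
  have a: "0 \<le> a" using assms(1) by simp
  have s: "y - a * real (Suc N) + a = y - a * real N" by (simp add: algebra_simps)
  have "real (Suc k) * a * (y - a * real (Suc N)) ^ k \<le> (y - a * real N) ^ Suc k - (y - a * real (Suc N)) ^ Suc k"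
    using power_diff_lower_bound[OF Suc.prems a, of k] unfolding s .
  moreover have "0 \<le> y - a * real N" using Suc.prems a s by linarith
  note Suc.IH[OF this]
  ultimately show ?case unfolding sum.atMost_Suc distrib_left by linarith
qed

text \<open>Geometrically, the unit cells sitting at the lattice points fit into the simplex
  enlarged by the sum of the \<open>a j\<close>, and the right-hand side is the volume of that
  simplex. The proof slices by the last coordinate instead of measuring; finiteness is carried
  through the induction since cardinalities are compared.\<close>

lemma card_lattice_simplex:
  fixes a :: "nat \<Rightarrow> real"
  assumes "\<And>j. j \<in> {1..k} \<Longrightarrow> 0 < a j" "0 \<le> l"
  shows "finite {\<nu> \<in> {1..k} \<rightarrow>\<^sub>E (UNIV :: nat set). (\<Sum>j\<in>{1..k}. a j * real (\<nu> j)) \<le> l} \<and>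
    real (card {\<nu> \<in> {1..k} \<rightarrow>\<^sub>E (UNIV :: nat set). (\<Sum>j\<in>{1..k}. a j * real (\<nu> j)) \<le> l})
      \<le> (l + (\<Sum>j\<in>{1..k}. a j)) ^ k / (fact k * (\<Prod>j\<in>{1..k}. a j))"
  using assms
proof (induction k arbitrary: l)
  case 0
  have "{\<nu> \<in> {1..0} \<rightarrow>\<^sub>E (UNIV :: nat set). (\<Sum>j\<in>{1..0::nat}. a j * real (\<nu> j)) \<le> l} = {\<lambda>_. undefined}"
    using 0 by auto
  then show ?case by simp
next
  case (Suc k)
  define T where "T l = {\<nu> \<in> {1..k} \<rightarrow>\<^sub>E (UNIV :: nat set). (\<Sum>j\<in>{1..k}. a j * real (\<nu> j)) \<le> l}" for l
  define T' where "T' = {\<nu> \<in> {1..Suc k} \<rightarrow>\<^sub>E (UNIV :: nat set). (\<Sum>j\<in>{1..Suc k}. a j * real (\<nu> j)) \<le> l}"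
  define b where "b = a (Suc k)"
  define A where "A = (\<Sum>j\<in>{1..k}. a j)"
  define p where "p = fact k * (\<Prod>j\<in>{1..k}. a j)"
  define N where "N = nat \<lfloor>l / b\<rfloor>"
  have b: "0 < b" using Suc.prems(1) unfolding b_def by simp
  have A: "0 \<le> A" unfolding A_def using Suc.prems(1) by (intro sum_nonneg) (simp add: less_imp_le)
  have p: "0 < p" unfolding p_def using Suc.prems(1) by (intro mult_pos_pos prod_pos) auto
  have IH: "finite (T l')" "real (card (T l')) \<le> (l' + A) ^ k / p" if "0 \<le> l'" for l'
    using Suc.IH[OF _ that] Suc.prems(1) unfolding T_def A_def p_def by auto
  have "real N \<le> l / b" unfolding N_def using Suc.prems(2) b by simp
  then have Nb: "b * real N \<le> l" using b by (simp add: field_simps)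
  have ln: "0 \<le> l - b * real n" if "n \<le> N" for n
  proof -
    have "b * real n \<le> b * real N" using b that by (intro mult_left_mono) auto
    then show ?thesis using Nb by linarith
  qed
  have sub: "T' \<subseteq> (\<Union>n\<in>{..N}. (\<lambda>\<nu>. \<nu>(Suc k := n)) ` T (l - b * real n))"
  proof
    fix \<nu> assume \<nu>: "\<nu> \<in> T'"
    have s0: "0 \<le> (\<Sum>j\<in>{1..k}. a j * real (\<nu> j))"
      using Suc.prems(1) by (intro sum_nonneg mult_nonneg_nonneg) (auto simp: less_imp_le)
    have s: "(\<Sum>j\<in>{1..k}. a j * real (\<nu> j)) + b * real (\<nu> (Suc k)) \<le> l"
      using \<nu> unfolding T'_def b_def by simp
    then have "b * real (\<nu> (Suc k)) \<le> l" using s0 by linarith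
    then have "real (\<nu> (Suc k)) \<le> l / b" using b by (simp add: field_simps)
    then have nN: "\<nu> (Suc k) \<le> N" unfolding N_def by (simp add: le_nat_floor)
    have "(\<Sum>j\<in>{1..k}. a j * real ((\<nu>(Suc k := undefined)) j)) = (\<Sum>j\<in>{1..k}. a j * real (\<nu> j))"
      by (rule sum.cong) auto
    then have "\<nu>(Suc k := undefined) \<in> T (l - b * real (\<nu> (Suc k)))"
      using \<nu> s unfolding T_def T'_def by (auto simp: PiE_def extensional_def)
    moreover have "\<nu> = (\<nu>(Suc k := undefined))(Suc k := \<nu> (Suc k))" by auto
    ultimately show "\<nu> \<in> (\<Union>n\<in>{..N}. (\<lambda>\<nu>. \<nu>(Suc k := n)) ` T (l - b * real n))" using nN by blast
  qed
  have fin: "finite (\<Union>n\<in>{..N}. (\<lambda>\<nu>. \<nu>(Suc k := n)) ` T (l - b * real n))"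
    using IH(1)[OF ln] by auto
  have "real (card T') \<le> real (\<Sum>n\<le>N. card ((\<lambda>\<nu>. \<nu>(Suc k := n)) ` T (l - b * real n)))"
    by (intro of_nat_mono order_trans[OF card_mono[OF fin sub] card_UN_le]) simp
  also have "\<dots> \<le> (\<Sum>n\<le>N. (l + A - b * real n) ^ k / p)"
    unfolding of_nat_sum
  proof (rule sum_mono)
    fix n assume "n \<in> {..N}"
    then have n: "0 \<le> l - b * real n" using ln by simp
    have "card ((\<lambda>\<nu>. \<nu>(Suc k := n)) ` T (l - b * real n)) \<le> card (T (l - b * real n))"
      by (rule card_image_le[OF IH(1)[OF n]])
    then show "real (card ((\<lambda>\<nu>. \<nu>(Suc k := n)) ` T (l - b * real n))) \<le> (l + A - b * real n) ^ k / p"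
      using IH(2)[OF n] by (simp add: algebra_simps)
  qed
  also have "\<dots> = (\<Sum>n\<le>N. (l + A - b * real n) ^ k) / p" by (simp add: sum_divide_distrib)
  also have "\<dots> \<le> ((l + A + b) ^ Suc k / (real (Suc k) * b)) / p"
  proof (rule divide_right_mono)
    have y: "0 \<le> l + A - b * real N" using Nb A by simp
    have "real (Suc k) * b * (\<Sum>n\<le>N. (l + A - b * real n) ^ k) \<le> (l + A + b) ^ Suc k"
      using sum_power_arith_le[OF b y, of k] zero_le_power[OF y, of "Suc k"] by linarith
    moreover have "0 < real (Suc k) * b" using b by simp
    ultimately show "(\<Sum>n\<le>N. (l + A - b * real n) ^ k) \<le> (l + A + b) ^ Suc k / (real (Suc k) * b)"
      by (simp only: pos_le_divide_eq mult.commute[of "\<Sum>n\<le>N. (l + A - b * real n) ^ k"])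
  qed (use p in simp)
  also have "\<dots> = (l + (\<Sum>j\<in>{1..Suc k}. a j)) ^ Suc k / (fact (Suc k) * (\<Prod>j\<in>{1..Suc k}. a j))"
    unfolding p_def A_def b_def by (simp add: add_ac mult_ac)
  finally show ?case using finite_subset[OF sub fin] unfolding T'_def by blast
qed

text \<open>Replacing \<open>max 1 (\<nu> k)\<close> by \<open>\<nu> k\<close> can only enlarge the
  set, which is harmless for an upper bound on its size, and taking logarithms then yields a
  simplex.\<close>

lemma multi_index_set_subset:
  assumes r: "\<And>j. j \<in> {1..k} \<Longrightarrow> 1 < r j" and k: "1 \<le> k" and \<epsilon>: "0 < \<epsilon>"
  shows "multi_index_set r k \<epsilon> \<subseteq>
    {\<nu> \<in> {1..k} \<rightarrow>\<^sub>E (UNIV :: nat set). (\<Sum>j\<in>{1..k}. ln (r j) * real (\<nu> j)) \<le> ln (1 / \<epsilon>)}"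
proof
  fix \<nu> assume \<nu>: "\<nu> \<in> multi_index_set r k \<epsilon>"
  have rp: "0 < r j" if "j \<in> {1..k}" for j using r[OF that] by simp
  have K: "{1..k} = insert k {1..<k}" using k by auto
  have "\<epsilon> \<le> r k powi (- int (max 1 (\<nu> k))) * (\<Prod>j\<in>{1..<k}. r j powi (- int (\<nu> j)))"
    using \<nu> unfolding multi_index_set_def by simp
  also have "\<dots> \<le> r k powi (- int (\<nu> k)) * (\<Prod>j\<in>{1..<k}. r j powi (- int (\<nu> j)))"
    using r k by (intro mult_right_mono power_int_increasing prod_nonneg zero_le_power_int)
      (auto intro!: less_imp_le[OF rp] less_imp_le[OF r])
  also have "\<dots> = (\<Prod>j\<in>{1..k}. r j powi (- int (\<nu> j)))" unfolding K by simp
  finally have le: "\<epsilon> \<le> (\<Prod>j\<in>{1..k}. r j powi (- int (\<nu> j)))" .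
  have "ln \<epsilon> \<le> ln (\<Prod>j\<in>{1..k}. r j powi (- int (\<nu> j)))" using le \<epsilon> by simp
  also have "\<dots> = (\<Sum>j\<in>{1..k}. ln (r j powi (- int (\<nu> j))))"
    by (rule ln_prod) (use rp in \<open>auto simp: less_imp_neq[THEN not_sym] dest!: rp\<close>)
  also have "\<dots> = (\<Sum>j\<in>{1..k}. - (ln (r j) * real (\<nu> j)))"
    using rp by (intro sum.cong refl) (simp add: power_int_minus ln_inverse ln_realpow mult.commute)
  finally have "(\<Sum>j\<in>{1..k}. ln (r j) * real (\<nu> j)) \<le> ln (1 / \<epsilon>)"
    using \<epsilon> by (simp add: sum_negf ln_div)
  then show "\<nu> \<in> {\<nu> \<in> {1..k} \<rightarrow>\<^sub>E UNIV. (\<Sum>j\<in>{1..k}. ln (r j) * real (\<nu> j)) \<le> ln (1 / \<epsilon>)}"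
    using \<nu> unfolding multi_index_set_def by simp
qed

text \<open>Lets a term of order \<open>d - 1\<close> disappear into a shift of the base, so that
  the \<open>d\<close>-th root costs only the additive constant \<open>K\<close>.\<close>

lemma power_binomial_lower:
  fixes Y K :: real
  assumes "0 \<le> Y" "0 \<le> K" "1 \<le> d"
  shows "Y ^ d + K * Y ^ (d - 1) \<le> (Y + K) ^ d"
proof -
  obtain e where d: "d = Suc e" using assms(3) by (cases d) auto
  have "Y ^ d + K * Y ^ (d - 1) = (Y + K) * Y ^ e" unfolding d by (simp add: algebra_simps)
  also have "\<dots> \<le> (Y + K) * (Y + K) ^ e" using assms by (intro mult_left_mono power_mono) auto
  finally show ?thesis unfolding d by simp
qed

text \<open>In \<open>G * N\<close>, with \<open>G\<close> the \<open>d\<close>-th power of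
  \<open>\<beta>\<close>, only the set with \<open>k = d\<close> contributes the order
  \<open>Y ^ d\<close>. The sets with \<open>k < d\<close> are of lower order and go into the
  shift.\<close>

lemma multi_index_count:
  assumes d: "1 \<le> d" and r: "\<And>j. j \<in> {1..d} \<Longrightarrow> 1 < r j"
    and \<beta>: "\<beta> = (fact (d - 1) * (\<Prod>j\<in>{1..d}. ln (r j))) powr (1 / real d)"
  obtains K where "0 \<le> K" "\<And>\<epsilon>. \<epsilon> \<in> {0<..<1} \<Longrightarrow>
    \<beta> * real (\<Sum>k\<in>{1..d}. card (multi_index_set r k \<epsilon>)) powr (1 / real d) \<le> ln (1 / \<epsilon>) + K"
proof -
  define a where "a j = ln (r j)" for j
  have a: "0 < a j" if "j \<in> {1..d}" for j unfolding a_def using r[OF that] by simp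
  define A where "A = (\<Sum>j\<in>{1..d}. a j)"
  have A: "0 < A" unfolding A_def using a d by (intro sum_pos) auto
  define G where "G = fact (d - 1) * (\<Prod>j\<in>{1..d}. a j)"
  have G: "0 < G" unfolding G_def using a by (intro mult_pos_pos prod_pos) auto
  define b where "b k = 1 / (fact k * (\<Prod>j\<in>{1..k}. a j))" for k
  have b: "0 \<le> b k" if "k \<le> d" for k
    unfolding b_def using a that by (intro divide_nonneg_nonneg mult_nonneg_nonneg prod_nonneg) (auto simp: less_imp_le)
  \<comment> \<open>As \<open>Y \<ge> A\<close>, a power \<open>Y ^ k\<close> with
    \<open>k < d\<close> is at most \<open>Y ^ (d - 1) / A ^ (d - 1 - k)\<close>; \<open>K\<close>
    collects the resulting coefficients.\<close>
  define K where "K = (\<Sum>k\<in>{1..<d}. G * b k / A ^ (d - 1 - k))"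
  have K: "0 \<le> K" unfolding K_def using G b A by (intro sum_nonneg) auto
  show ?thesis
  proof (rule that[of "A + K"])
    fix \<epsilon> :: real assume \<epsilon>: "\<epsilon> \<in> {0<..<1}"
    define Y where "Y = ln (1 / \<epsilon>) + A"
    have l: "0 \<le> ln (1 / \<epsilon>)" using \<epsilon> by (intro ln_ge_zero) auto
    have Y: "A \<le> Y" unfolding Y_def using l by simp
    have Y0: "0 \<le> Y" using Y A by simp
    define n where "n k = real (card (multi_index_set r k \<epsilon>))" for k
    have nk: "n k \<le> b k * Y ^ k" if k: "k \<in> {1..d}" for k
    proof -
      let ?S = "{\<nu> \<in> {1..k} \<rightarrow>\<^sub>E (UNIV :: nat set). (\<Sum>j\<in>{1..k}. a j * real (\<nu> j)) \<le> ln (1 / \<epsilon>)}"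
      have S: "finite ?S" "real (card ?S) \<le> (ln (1 / \<epsilon>) + (\<Sum>j\<in>{1..k}. a j)) ^ k / (fact k * (\<Prod>j\<in>{1..k}. a j))"
        using card_lattice_simplex[of k a, OF _ l] a k by auto
      have "multi_index_set r k \<epsilon> \<subseteq> ?S"
        unfolding a_def using r k \<epsilon> by (intro multi_index_set_subset) auto
      then have "n k \<le> real (card ?S)" unfolding n_def using card_mono[OF S(1)] by simp
      also have "\<dots> \<le> (ln (1 / \<epsilon>) + (\<Sum>j\<in>{1..k}. a j)) ^ k / (fact k * (\<Prod>j\<in>{1..k}. a j))" by (rule S(2))
      also have "\<dots> = b k * (ln (1 / \<epsilon>) + (\<Sum>j\<in>{1..k}. a j)) ^ k" unfolding b_def by simp
      also have "\<dots> \<le> b k * Y ^ k"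
      proof (intro mult_left_mono power_mono b)
        have "(\<Sum>j\<in>{1..k}. a j) \<le> A" unfolding A_def using a k by (intro sum_mono2) (auto simp: less_imp_le)
        then show "ln (1 / \<epsilon>) + (\<Sum>j\<in>{1..k}. a j) \<le> Y" unfolding Y_def by simp
        have "0 \<le> (\<Sum>j\<in>{1..k}. a j)" using a k by (intro sum_nonneg) (auto simp: less_imp_le)
        then show "0 \<le> ln (1 / \<epsilon>) + (\<Sum>j\<in>{1..k}. a j)" using l by simp
      qed (use k in auto)
      finally show ?thesis .
    qed
    define N where "N = (\<Sum>k\<in>{1..d}. n k)"
    have N: "0 \<le> N" unfolding N_def n_def by (simp add: sum_nonneg)
    have Ns: "real (\<Sum>k\<in>{1..d}. card (multi_index_set r k \<epsilon>)) = N" unfolding N_def n_def by simp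
    have low: "G * (b k * Y ^ k) \<le> G * b k / A ^ (d - 1 - k) * Y ^ (d - 1)" if k: "k \<in> {1..<d}" for k
    proof -
      have "A ^ (d - 1 - k) * Y ^ k \<le> Y ^ (d - 1 - k) * Y ^ k"
        using A Y Y0 by (intro mult_right_mono power_mono) auto
      also have "\<dots> = Y ^ (d - 1)" using k by (simp flip: power_add)
      finally have "Y ^ k \<le> Y ^ (d - 1) / A ^ (d - 1 - k)" using A by (simp add: field_simps)
      then have "G * b k * Y ^ k \<le> G * b k * (Y ^ (d - 1) / A ^ (d - 1 - k))"
        using G b[of k] k by (intro mult_left_mono) auto
      then show ?thesis by (simp add: mult_ac)
    qed
    have "G * N \<le> G * (\<Sum>k\<in>{1..d}. b k * Y ^ k)"
      unfolding N_def using nk G by (intro mult_left_mono sum_mono) auto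
    also have "\<dots> = (\<Sum>k\<in>{1..<d}. G * (b k * Y ^ k)) + G * (b d * Y ^ d)"
    proof -
      have "{1..d} = insert d {1..<d}" using d by auto
      then show ?thesis by (simp add: sum_distrib_left distrib_left)
    qed
    also have "\<dots> \<le> (\<Sum>k\<in>{1..<d}. G * b k / A ^ (d - 1 - k) * Y ^ (d - 1)) + Y ^ d"
    proof (intro add_mono sum_mono low)
      \<comment> \<open>The quotient of \<open>(d - 1)!\<close> by \<open>d!\<close>; this leading
        coefficient is then simply rounded up to 1.\<close>
      have "G * b d = 1 / real d"
      proof -
        have "(\<Prod>j\<in>{1..d}. a j) \<noteq> 0" using a by (force simp: prod_zero_iff)
        moreover have "fact d = real d * fact (d - 1)" using d by (cases d) auto
        ultimately show ?thesis unfolding G_def b_def using d by simp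
      qed
      then have "G * (b d * Y ^ d) = Y ^ d / real d" by (simp add: mult.assoc[symmetric])
      also have "\<dots> \<le> Y ^ d / 1" using d Y0 by (intro divide_left_mono) auto
      finally show "G * (b d * Y ^ d) \<le> Y ^ d" by simp
    qed
    also have "\<dots> = Y ^ d + K * Y ^ (d - 1)" unfolding K_def by (simp add: sum_distrib_right)
    also have "\<dots> \<le> (Y + K) ^ d" by (rule power_binomial_lower[OF Y0 K d])
    finally have GN: "G * N \<le> (Y + K) ^ d" .
    have "\<beta> * N powr (1 / real d) = (G * N) powr (1 / real d)"
      unfolding \<beta> using G N unfolding G_def a_def by (simp add: powr_mult)
    also have "\<dots> \<le> ((Y + K) ^ d) powr (1 / real d)"
      using GN G N by (intro powr_mono2) auto
    also have "\<dots> = Y + K"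
    proof -
      have YK: "0 < Y + K" using A Y K by simp
      then have "((Y + K) ^ d) powr (1 / real d) = (Y + K) powr (real d * (1 / real d))"
        by (simp add: powr_realpow[symmetric] powr_powr)
      then show ?thesis using YK d by simp
    qed
    finally show "\<beta> * real (\<Sum>k\<in>{1..d}. card (multi_index_set r k \<epsilon>)) powr (1 / real d) \<le> ln (1 / \<epsilon>) + (A + K)"
      unfolding Ns Y_def by simp
  qed (use A K in simp)
qed

section \<open>The Knothe--Rosenblatt transport on the boundary of the cube\<close>

lemma space_half_lebesgue [simp]: "space half_lebesgue = {-1..1}"
  unfolding half_lebesgue_def by (simp add: space_scale_measure space_restrict_space)

lemma sets_half_lebesgue [measurable_cong]: "sets half_lebesgue = sets (restrict_space borel {-1..1})"
  unfolding half_lebesgue_def by (simp cong: sets_restrict_space_cong)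

lemma measurable_half_lebesgue_id: "(\<lambda>x. x) \<in> half_lebesgue \<rightarrow>\<^sub>M borel"
  by (subst measurable_cong_sets[OF sets_half_lebesgue refl]) (rule measurable_restrict_space1, simp)

lemma ennreal_half: "1 / 2 = ennreal (1 / 2)"
  using divide_ennreal[of 1 2] by simp

lemma prob_space_half_lebesgue: "prob_space half_lebesgue"
proof
  have "emeasure half_lebesgue {-1..1} = ennreal (1/2) * emeasure lborel {-1..1::real}"
    unfolding half_lebesgue_def by (simp add: emeasure_restrict_space ennreal_half)
  also have "\<dots> = ennreal (1/2 * 2)" by (subst ennreal_mult) auto
  also have "\<dots> = 1" by simp
  finally show "emeasure half_lebesgue (space half_lebesgue) = 1" by simp
qed

lemma half_lebesgue_density: "half_lebesgue = density (restrict_space lborel {-1..1}) (\<lambda>_. ennreal (1 / 2))"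
proof (rule measure_eqI)
  fix A assume "A \<in> sets half_lebesgue"
  then have A: "A \<in> sets (restrict_space lborel {-1..1})" unfolding half_lebesgue_def by simp
  show "emeasure half_lebesgue A = emeasure (density (restrict_space lborel {-1..1}) (\<lambda>_. ennreal (1 / 2))) A"
    using A unfolding half_lebesgue_def by (simp add: emeasure_density_const ennreal_half)
qed (simp add: half_lebesgue_def)

text \<open>Bridges the two integrals in the construction: marginals are taken with respect to the
  normalised product measure, conditional distribution functions with respect to unnormalised
  Lebesgue measure.\<close>

lemma integral_half_lebesgue:
  fixes f :: "real \<Rightarrow> real"
  assumes f: "f \<in> borel_measurable half_lebesgue" and B: "\<And>x. x \<in> {-1..1} \<Longrightarrow> \<bar>f x\<bar> \<le> B"
  shows "f integrable_on {-1..1}" "integral {-1..1} f = 2 * (\<integral>x. f x \<partial>half_lebesgue)"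
proof -
  have meas: "f \<in> borel_measurable (restrict_space lborel {-1..1})"
    using f by (simp add: half_lebesgue_density)
  then have m': "(\<lambda>x. indicator {-1..1} x *\<^sub>R f x) \<in> borel_measurable lborel"
    by (simp add: borel_measurable_restrict_space_iff)
  have "integrable lborel (\<lambda>x. indicator {-1..1} x *\<^sub>R f x)"
  proof (rule Bochner_Integration.integrable_bound)
    have "integrable lborel (indicator {-1..1} :: real \<Rightarrow> real)" by (rule integrable_real_indicator) auto
    then show "integrable lborel (\<lambda>x::real. indicator {-1..1} x *\<^sub>R B)" by simp
    show "AE x in lborel. norm (indicator {-1..1} x *\<^sub>R f x) \<le> norm (indicator {-1..1} x *\<^sub>R B)"
      using B by (intro AE_I2) (auto simp: indicator_def intro: order_trans[OF _ abs_ge_self])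
  qed (rule m')
  then have si: "set_integrable lborel {-1..1} f" unfolding set_integrable_def .
  show "f integrable_on {-1..1}" using set_borel_integral_eq_integral(1)[OF si] .
  have "(\<integral>x. f x \<partial>half_lebesgue) = (\<integral>x. (1/2) *\<^sub>R f x \<partial>restrict_space lborel {-1..1})"
    unfolding half_lebesgue_density by (subst integral_density) (use meas in auto)
  also have "\<dots> = 1/2 * (\<integral>x. f x \<partial>restrict_space lborel {-1..1})" by simp
  also have "(\<integral>x. f x \<partial>restrict_space lborel {-1..1}) = integral {-1..1} f"
    using set_borel_integral_eq_integral(2)[OF si] by (simp add: integral_restrict_space set_lebesgue_integral_def)
  finally show "integral {-1..1} f = 2 * (\<integral>x. f x \<partial>half_lebesgue)" by simp
qed

interpretation half: product_prob_space "\<lambda>_. half_lebesgue" UNIV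
  by (simp add: product_prob_space_def product_prob_space_axioms_def product_sigma_finite_def
      prob_space_half_lebesgue prob_space_imp_sigma_finite)

lemma prob_space_cube_measure: "prob_space (cube_measure I)"
  by (rule prob_space_PiM) (rule prob_space_half_lebesgue)

lemma space_cube_measure:
  "space (cube_measure {1..d}) = cube d" "space (cube_measure {Suc 0..d}) = cube d"
  unfolding cube_def space_PiM by simp_all

lemma cubeD: "x \<in> cube n \<Longrightarrow> i \<in> {1..n} \<Longrightarrow> \<bar>x i\<bar> \<le> 1"
  unfolding cube_def PiE_def Pi_def by (auto simp: abs_le_iff)

section \<open>Marginals and conditional distribution functions of one density\<close>

locale bounded_density =
  fixes d :: nat and f :: "(nat \<Rightarrow> real) \<Rightarrow> real" and M L :: real
  assumes density: "prob_density d f"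
    and bounds: "\<And>x. x \<in> cube d \<Longrightarrow> M \<le> f x \<and> f x \<le> L" and M: "0 < M"
begin

lemma measurable_density: "f \<in> borel_measurable (cube_measure {1..d})"
  using density unfolding prob_density_def by simp

text \<open>The integral formula for the marginals, used also at \<open>k = 0\<close>, where
  \<open>marginal\<close> prescribes the value 1. The two agree since the density has total mass 1,
  and Fubini's theorem can then pass from \<open>k\<close> to \<open>k - 1\<close> without a special
  case.\<close>

definition section_integral :: "nat \<Rightarrow> (nat \<Rightarrow> real) \<Rightarrow> real" where
  "section_integral k x = (\<integral>t. f (merge {1..k} {k+1..d} (x, t)) \<partial>cube_measure {k+1..d})"

lemma section_integral_cong:
  assumes "\<And>i. i \<in> {1..k} \<Longrightarrow> x i = y i"
  shows "section_integral k x = section_integral k y"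
proof -
  have "merge {1..k} {k+1..d} (x, t) = merge {1..k} {k+1..d} (y, t)" for t
    using assms by (auto simp: merge_def)
  then show ?thesis unfolding section_integral_def by simp
qed

lemma measurable_merge_upd:
  assumes x: "\<forall>i\<in>{1..<k}. \<bar>x i\<bar> \<le> 1" and k: "k \<le> d"
  shows "(\<lambda>(u, t). merge {1..k} {k+1..d} (x(k := u), t)) \<in>
    half_lebesgue \<Otimes>\<^sub>M cube_measure {k+1..d} \<rightarrow>\<^sub>M cube_measure {1..d}"
proof (rule measurable_PiM_single')
  fix i assume i: "i \<in> {1..d}"
  consider "i \<in> {1..<k}" | "i = k" | "i \<in> {k+1..d}" using i by fastforce
  then show "(\<lambda>\<omega>. (case \<omega> of (u, t) \<Rightarrow> merge {1..k} {k+1..d} (x(k := u), t)) i)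
      \<in> half_lebesgue \<Otimes>\<^sub>M cube_measure {k+1..d} \<rightarrow>\<^sub>M half_lebesgue"
  proof cases
    case 1
    then have "x i \<in> space half_lebesgue" using x 1 by (auto simp: abs_le_iff)
    then have "(\<lambda>\<omega>. x i) \<in> half_lebesgue \<Otimes>\<^sub>M cube_measure {k+1..d} \<rightarrow>\<^sub>M half_lebesgue" by simp
    then show ?thesis using 1 by (simp add: split_beta' merge_def)
  next
    case 2
    then show ?thesis using i by (simp add: split_beta' merge_def)
  next
    case 3
    then have "(\<lambda>\<omega>. snd \<omega> i) \<in> half_lebesgue \<Otimes>\<^sub>M cube_measure {k+1..d} \<rightarrow>\<^sub>M half_lebesgue"
      by (intro measurable_compose[OF measurable_snd] measurable_component_singleton)
    then show ?thesis using 3 by (simp add: split_beta' merge_def)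
  qed
next
  show "(\<lambda>(u, t). merge {1..k} {k+1..d} (x(k := u), t)) \<in>
    space (half_lebesgue \<Otimes>\<^sub>M cube_measure {k+1..d}) \<rightarrow> ({1..d} \<rightarrow>\<^sub>E space half_lebesgue)"
    using x k by (fastforce simp: space_pair_measure space_PiM merge_def PiE_def Pi_def extensional_def abs_le_iff)
qed

lemma merge_in_cube:
  assumes x: "unit_box k x" and k: "k \<le> d" and t: "t \<in> space (cube_measure {k+1..d})"
  shows "merge {1..k} {k+1..d} (x, t) \<in> cube d"
  using assms by (fastforce simp: cube_def space_PiM merge_def PiE_def Pi_def extensional_def abs_le_iff)

lemma measurable_section:
  assumes x: "unit_box k x" and k: "k \<le> d"
  shows "(\<lambda>t. f (merge {1..k} {k+1..d} (x, t))) \<in> borel_measurable (cube_measure {k+1..d})"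
proof (rule measurable_compose[OF _ measurable_density], rule measurable_PiM_single')
  fix i assume i: "i \<in> {1..d}"
  show "(\<lambda>t. merge {1..k} {k+1..d} (x, t) i) \<in> cube_measure {k+1..d} \<rightarrow>\<^sub>M half_lebesgue"
  proof (cases "i \<le> k")
    case True
    then show ?thesis using i x by (simp add: merge_def abs_le_iff)
  next
    case False
    then show ?thesis using i by (simp add: merge_def)
  qed
next
  show "(\<lambda>t. merge {1..k} {k+1..d} (x, t)) \<in> space (cube_measure {k+1..d}) \<rightarrow> ({1..d} \<rightarrow>\<^sub>E space half_lebesgue)"
    using merge_in_cube[OF x k] unfolding cube_def by auto
qed

lemma section_integral_bounds:
  assumes x: "unit_box k x" and k: "k \<le> d"
  shows "M \<le> section_integral k x" "section_integral k x \<le> L"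
proof -
  interpret P: prob_space "cube_measure {k+1..d}" by (rule prob_space_cube_measure)
  have bd: "M \<le> f (merge {1..k} {k+1..d} (x, t)) \<and> f (merge {1..k} {k+1..d} (x, t)) \<le> L"
    if "t \<in> space (cube_measure {k+1..d})" for t
    using bounds merge_in_cube[OF x k that] by blast
  have int: "integrable (cube_measure {k+1..d}) (\<lambda>t. f (merge {1..k} {k+1..d} (x, t)))"
    by (rule P.integrable_const_bound[where B = L])
       (use bd M measurable_section[OF x k] in \<open>force intro!: AE_I2\<close>)+
  show "M \<le> section_integral k x" unfolding section_integral_def
    using bd by (intro P.integral_ge_const int AE_I2) auto
  show "section_integral k x \<le> L" unfolding section_integral_def
    using bd by (intro P.integral_le_const int AE_I2) auto
qed

lemma marginal_eq: "marginal d f k x = section_integral k x"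
proof (cases "k = 0")
  case True
  have "section_integral 0 x = (\<integral>t. f t \<partial>cube_measure {1..d})"
    unfolding section_integral_def
  proof (simp, rule Bochner_Integration.integral_cong[OF refl])
    fix t assume "t \<in> space (cube_measure {Suc 0..d})"
    then have "merge {} {Suc 0..d} (x, t) = t"
      by (auto simp: merge_def space_PiM PiE_def extensional_def)
    then show "f (merge {} {Suc 0..d} (x, t)) = f t" by simp
  qed
  also have "\<dots> = 1" using density unfolding prob_density_def by (simp add: has_bochner_integral_integral_eq)
  finally show ?thesis using True by (simp add: marginal_def)
qed (simp add: marginal_def section_integral_def)

lemma measurable_section_integral:
  assumes x: "\<forall>i\<in>{1..<k}. \<bar>x i\<bar> \<le> 1" and k: "k \<le> d"
  shows "(\<lambda>u. section_integral k (x(k := u))) \<in> borel_measurable half_lebesgue"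
proof -
  interpret P: prob_space "cube_measure {k+1..d}" by (rule prob_space_cube_measure)
  have "(\<lambda>(u, t). f (merge {1..k} {k+1..d} (x(k := u), t))) \<in> borel_measurable (half_lebesgue \<Otimes>\<^sub>M cube_measure {k+1..d})"
    using measurable_compose[OF measurable_merge_upd[OF x k] measurable_density] by (simp add: split_beta')
  then show ?thesis unfolding section_integral_def by (rule P.borel_measurable_lebesgue_integral)
qed

text \<open>Fubini's theorem after splitting coordinate \<open>k\<close> off the block
  \<open>{k..d}\<close>. Division by the right-hand side shows that a conditional density has mass 1
  under \<open>half_lebesgue\<close>.\<close>

lemma integral_section_integral:
  assumes x: "\<forall>i\<in>{1..<k}. \<bar>x i\<bar> \<le> 1" and k: "1 \<le> k" "k \<le> d"
  shows "(\<integral>u. section_integral k (x(k := u)) \<partial>half_lebesgue) = section_integral (k - 1) x"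
proof -
  define h where "h = (\<lambda>t. f (merge {1..k-1} {k-1+1..d} (x, t)))"
  interpret P: prob_space "cube_measure {k-1+1..d}" by (rule prob_space_cube_measure)
  have x': "\<forall>i\<in>{1..k-1}. \<bar>x i\<bar> \<le> 1" using x k by auto
  have bd: "M \<le> h t \<and> h t \<le> L" if "t \<in> space (cube_measure {k-1+1..d})" for t
    unfolding h_def using bounds merge_in_cube[OF x' _ that] k by auto
  have int: "integrable (cube_measure {k-1+1..d}) h"
    by (rule P.integrable_const_bound[where B = L])
       (use bd M measurable_section[OF x'] k in \<open>force intro!: AE_I2 simp: h_def\<close>)+
  have I: "{k-1+1..d} = {k} \<union> {k+1..d}" using k by auto
  have merge_eq: "merge {1..k-1} {k-1+1..d} (x, merge {k} {k+1..d} (w, y)) = merge {1..k} {k+1..d} (x(k := w k), y)"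
    for w y using k by (auto simp: merge_def fun_eq_iff)
  have "section_integral (k - 1) x = integral\<^sup>L (cube_measure ({k} \<union> {k+1..d})) h"
    unfolding section_integral_def h_def I[symmetric] ..
  also have "\<dots> = (\<integral>w. (\<integral>y. h (merge {k} {k+1..d} (w, y)) \<partial>cube_measure {k+1..d}) \<partial>cube_measure {k})"
    using int unfolding I by (intro half.product_integral_fold) auto
  also have "\<dots> = (\<integral>w. section_integral k (x(k := w k)) \<partial>cube_measure {k})"
    unfolding h_def merge_eq section_integral_def ..
  also have "\<dots> = (\<integral>u. section_integral k (x(k := u)) \<partial>half_lebesgue)"
    by (rule half.product_integral_singleton) (rule measurable_section_integral[OF x k(2)])
  finally show ?thesis by simp
qed

lemma cond_density_upd:
  assumes "1 \<le> k"
  shows "cond_density d f k (x(k := u)) = section_integral k (x(k := u)) / section_integral (k - 1) x"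
  unfolding cond_density_def marginal_eq
  using assms by (subst section_integral_cong[of "k - 1" "x(k := u)" x]) auto

lemma cond_density_facts:
  assumes x: "\<forall>i\<in>{1..<k}. \<bar>x i\<bar> \<le> 1" and k: "1 \<le> k" "k \<le> d"
  shows "\<And>u. \<bar>u\<bar> \<le> 1 \<Longrightarrow> M / L \<le> cond_density d f k (x(k := u))"
    and "(\<lambda>u. cond_density d f k (x(k := u))) integrable_on {-1..1}"
    and "integral {-1..1} (\<lambda>u. cond_density d f k (x(k := u))) = 2"
proof -
  have xu: "\<forall>i\<in>{1..k}. \<bar>(x(k := u)) i\<bar> \<le> 1" if "\<bar>u\<bar> \<le> 1" for u using x that by auto
  have x': "\<forall>i\<in>{1..k-1}. \<bar>x i\<bar> \<le> 1" using x k by auto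
  have prev: "M \<le> section_integral (k - 1) x" "section_integral (k - 1) x \<le> L"
    using section_integral_bounds[OF x'] k by auto
  have cur: "M \<le> section_integral k (x(k := u))" "section_integral k (x(k := u)) \<le> L" if "\<bar>u\<bar> \<le> 1" for u
    by (rule section_integral_bounds[OF xu[OF that] k(2)])+
  show "M / L \<le> cond_density d f k (x(k := u))" if "\<bar>u\<bar> \<le> 1" for u
    unfolding cond_density_upd[OF k(1)] using cur[OF that] prev M by (intro frac_le) auto
  have meas: "(\<lambda>u. cond_density d f k (x(k := u))) \<in> borel_measurable half_lebesgue"
    unfolding cond_density_upd[OF k(1)]
    by (intro borel_measurable_divide measurable_section_integral[OF x k(2)]) auto
  have bd: "\<bar>cond_density d f k (x(k := u))\<bar> \<le> L / M" if "u \<in> {-1..1}" for u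
  proof -
    have u: "\<bar>u\<bar> \<le> 1" using that by (auto simp: abs_le_iff)
    show ?thesis
      unfolding cond_density_upd[OF k(1)] abs_divide using cur[OF u] prev M by (intro frac_le) auto
  qed
  show "(\<lambda>u. cond_density d f k (x(k := u))) integrable_on {-1..1}"
    by (rule integral_half_lebesgue(1)[OF meas bd])
  have "integral {-1..1} (\<lambda>u. cond_density d f k (x(k := u)))
      = 2 * (\<integral>u. cond_density d f k (x(k := u)) \<partial>half_lebesgue)"
    by (rule integral_half_lebesgue(2)[OF meas bd])
  also have "(\<integral>u. cond_density d f k (x(k := u)) \<partial>half_lebesgue)
      = (\<integral>u. section_integral k (x(k := u)) / section_integral (k - 1) x \<partial>half_lebesgue)"
    unfolding cond_density_upd[OF k(1)] ..
  also have "(\<integral>u. section_integral k (x(k := u)) / section_integral (k - 1) x \<partial>half_lebesgue)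
     = section_integral (k - 1) x / section_integral (k - 1) x"
    using integral_section_integral[OF x k] by simp
  also have "\<dots> = 1" using prev M by simp
  finally show "integral {-1..1} (\<lambda>u. cond_density d f k (x(k := u))) = 2" by (simp only: mult_1_right)
qed

lemma cond_cdf_cong:
  assumes "\<And>i. i \<in> {1..k} \<Longrightarrow> x i = y i" "1 \<le> k"
  shows "cond_cdf d f k x = cond_cdf d f k y"
proof -
  have "cond_density d f k (x(k := t)) = cond_density d f k (y(k := t))" for t
    unfolding cond_density_def marginal_eq
    using assms by (intro arg_cong2[where f = "(/)"] section_integral_cong) auto
  then show ?thesis unfolding cond_cdf_def using assms by auto
qed

text \<open>The total is 2 rather than 1 because Lebesgue measure is applied to a density normalised
  for \<open>half_lebesgue\<close>. Both densities of a transport carry the same factor, so it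
  cancels in the composition with the inverse. Strict growth comes from the lower bound
  \<open>M / L\<close> on the conditional density.\<close>

lemma cond_cdf_facts:
  assumes x: "\<forall>i\<in>{1..<k}. \<bar>x i\<bar> \<le> 1" and k: "1 \<le> k" "k \<le> d"
  shows "cond_cdf d f k (x(k := -1)) = 0"
    and "cond_cdf d f k (x(k := 1)) = 2"
    and "strict_mono_on {-1..1} (\<lambda>t. cond_cdf d f k (x(k := t)))"
    and "continuous_on {-1..1} (\<lambda>t. cond_cdf d f k (x(k := t)))"
proof -
  note F = cond_density_facts[OF x k]
  let ?c = "\<lambda>u. cond_density d f k (x(k := u))"
  have eq: "cond_cdf d f k (x(k := t)) = integral {-1..t} ?c" for t
    unfolding cond_cdf_def by simp
  show "cond_cdf d f k (x(k := -1)) = 0" unfolding eq by simp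
  show "cond_cdf d f k (x(k := 1)) = 2" unfolding eq by (rule F(3))
  show "continuous_on {-1..1} (\<lambda>t. cond_cdf d f k (x(k := t)))"
    unfolding eq by (rule indefinite_integral_continuous_1[OF F(2)])
  show "strict_mono_on {-1..1} (\<lambda>t. cond_cdf d f k (x(k := t)))"
  proof (rule strict_mono_onI)
    fix s t :: real assume s: "s \<in> {-1..1}" and t: "t \<in> {-1..1}" and st: "s < t"
    have I: "?c integrable_on {a..b}" if "-1 \<le> a" "b \<le> 1" for a b
      using that by (intro integrable_subinterval_real[OF F(2)]) auto
    have L0: "0 < L"
      using section_integral_bounds[of "k - 1" x] x k M by fastforce
    have "integral {-1..s} ?c + integral {s..t} ?c = integral {-1..t} ?c"
      using s t st by (intro Henstock_Kurzweil_Integration.integral_combine I) auto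
    moreover have "integral {s..t} (\<lambda>_. M / L) \<le> integral {s..t} ?c"
      using s t by (intro integral_le I F(1)) (auto simp: abs_le_iff)
    moreover have "0 < integral {s..t} (\<lambda>_. M / L)" using st M L0 by simp
    ultimately show "cond_cdf d f k (x(k := s)) < cond_cdf d f k (x(k := t))"
      unfolding eq by linarith
  qed
qed

lemma cond_cdf_bij:
  assumes x: "\<forall>i\<in>{1..<k}. \<bar>x i\<bar> \<le> 1" and k: "1 \<le> k" "k \<le> d"
  shows "bij_betw (\<lambda>t. cond_cdf d f k (x(k := t))) {-1..1} {0..2}"
proof -
  note F = cond_cdf_facts[OF x k]
  let ?G = "\<lambda>t. cond_cdf d f k (x(k := t))"
  have "?G ` {-1..1} = {0..2}"
  proof
    have mono: "?G s \<le> ?G t" if "s \<in> {-1..1}" "t \<in> {-1..1}" "s \<le> t" for s t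
      using strict_mono_onD[OF F(3) that(1,2)] that(3) by (cases "s = t") auto
    show "?G ` {-1..1} \<subseteq> {0..2}"
      using mono[of "-1"] mono[of _ 1] F(1,2) by fastforce
    show "{0..2} \<subseteq> ?G ` {-1..1}"
    proof
      fix y :: real assume "y \<in> {0..2}"
      then have "\<exists>t\<ge>-1. t \<le> 1 \<and> ?G t = y" using F by (intro IVT') auto
      then show "y \<in> ?G ` {-1..1}" by auto
    qed
  qed
  then show ?thesis using strict_mono_on_imp_inj_on[OF F(3)] unfolding bij_betw_def by blast
qed

end

section \<open>The transport between two densities\<close>

locale density_pair = F: bounded_density d f M L + G: bounded_density d g M L
  for d f g M L
begin

text \<open>In the recursive equation the argument of the target distribution function repeats
  \<open>t\<close> at all positions from \<open>k\<close> on. Only position \<open>k\<close>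
  matters, so it can be rewritten as an update, the form in which the facts on distribution
  functions are stated.\<close>

lemma KR_transport_eq:
  assumes "1 \<le> k"
  shows "KR_transport d f g k x =
    inv_into {-1..1} (\<lambda>t. cond_cdf d g k ((\<lambda>j. KR_transport d f g j x)(k := t))) (cond_cdf d f k x)"
proof -
  have "cond_cdf d g k (\<lambda>j. if j < k then KR_transport d f g j x else t)
      = cond_cdf d g k ((\<lambda>j. KR_transport d f g j x)(k := t))" for t
    using assms by (intro G.cond_cdf_cong) auto
  then show ?thesis by (subst KR_transport.simps) simp
qed

lemma KR_transport_range:
  assumes "unit_box k x" "1 \<le> k" "k \<le> d"
  shows "\<bar>KR_transport d f g k x\<bar> \<le> 1"
  using assms
proof (induction k rule: less_induct)
  case (less k)
  have T: "\<forall>j\<in>{1..<k}. \<bar>KR_transport d f g j x\<bar> \<le> 1"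
    using less.prems by (auto intro!: less.IH)
  have "cond_cdf d f k (x(k := x k)) \<in> {0..2}"
    using bij_betw_imp_surj_on[OF F.cond_cdf_bij[of k x]] less.prems
    by (force simp: abs_le_iff)
  then have "cond_cdf d f k x \<in> (\<lambda>t. cond_cdf d g k ((\<lambda>j. KR_transport d f g j x)(k := t))) ` {-1..1}"
    using bij_betw_imp_surj_on[OF G.cond_cdf_bij[OF T]] less.prems by simp
  then have "KR_transport d f g k x \<in> {-1..1}"
    unfolding KR_transport_eq[OF less.prems(2)] by (rule inv_into_into)
  then show ?case by (auto simp: abs_le_iff)
qed

lemma KR_transport_cong:
  assumes "\<And>i. i \<in> {1..k} \<Longrightarrow> x i = y i" "1 \<le> k"
  shows "KR_transport d f g k x = KR_transport d f g k y"
  using assms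
proof (induction k rule: less_induct)
  case (less k)
  have "KR_transport d f g j x = KR_transport d f g j y" if "j \<in> {1..<k}" for j
    using that less.prems by (intro less.IH) auto
  then have "cond_cdf d g k ((\<lambda>j. KR_transport d f g j x)(k := t)) = cond_cdf d g k ((\<lambda>j. KR_transport d f g j y)(k := t))" for t
    using less.prems by (intro G.cond_cdf_cong) auto
  moreover have "cond_cdf d f k x = cond_cdf d f k y" using less.prems by (intro F.cond_cdf_cong) auto
  ultimately show ?case unfolding KR_transport_eq[OF less.prems(2)] by simp
qed

text \<open>On every section both distribution functions start at 0 and end at 2, so end points are
  matched whatever the earlier components do. This fixes the constant of integration and the total
  integral of the derivative.\<close>

lemma KR_transport_endpoints:
  assumes x: "\<forall>i\<in>{1..<k}. \<bar>x i\<bar> \<le> 1" and k: "1 \<le> k" "k \<le> d"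
  shows "KR_transport d f g k (x(k := -1)) = -1" "KR_transport d f g k (x(k := 1)) = 1"
proof -
  have T: "\<forall>j\<in>{1..<k}. \<bar>KR_transport d f g j (x(k := c))\<bar> \<le> 1" for c
    using x k by (auto intro!: KR_transport_range)
  have "KR_transport d f g k (x(k := c)) = c" if c: "c \<in> {-1..1}"
    and e: "cond_cdf d f k (x(k := c)) = cond_cdf d g k ((\<lambda>j. KR_transport d f g j (x(k := c)))(k := c))" for c
    unfolding KR_transport_eq[OF k(1)] e
    using G.cond_cdf_bij[OF T k, of c] c
    by (intro inv_into_f_f) (auto simp: bij_betw_def)
  then show "KR_transport d f g k (x(k := -1)) = -1" "KR_transport d f g k (x(k := 1)) = 1"
    using F.cond_cdf_facts(1,2)[OF x k] G.cond_cdf_facts(1,2)[OF T k]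
    by simp_all
qed

end

text \<open>The extension is bounded in modulus only; positivity of the density on the cube turns
  this into two-sided bounds on its real values.\<close>

lemma assumption_A_bounded_density:
  assumes A: "assumption_A d M L \<delta> C6 f" and \<delta>: "\<forall>j\<in>{1..d}. 0 < \<delta> j" and M: "0 < M"
  shows "bounded_density d f M L"
proof
  show "prob_density d f" using A unfolding assumption_A_def by blast
  then have pos: "0 < f x" if "x \<in> cube d" for x using that unfolding prob_density_def by blast
  obtain g where g: "\<And>x. x \<in> cube d \<Longrightarrow> g (cplx d x) = complex_of_real (f x)"
    "\<And>z. z \<in> (\<Pi>\<^sub>E i\<in>{1..d}. nbhd (\<delta> i) unit_segment) \<Longrightarrow> M \<le> cmod (g z) \<and> cmod (g z) \<le> L"
    using A unfolding assumption_A_def by blast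
  show "M \<le> f x \<and> f x \<le> L" if x: "x \<in> cube d" for x
  proof -
    have "cplx d x \<in> (\<Pi>\<^sub>E i\<in>{1..d}. nbhd (\<delta> i) unit_segment)"
      unfolding cplx_def using \<delta> cubeD[OF x] by (auto intro!: of_real_in_stadium)
    then show ?thesis using g(2) g(1)[OF x] pos[OF x] by fastforce
  qed
qed (rule M)

section \<open>Weak derivatives of traces of holomorphic functions\<close>

text \<open>Tychonoff's theorem in the space of all functions on \<open>nat\<close>: extensionality
  pins each coordinate outside \<open>{1..d}\<close> to the one-point set of
  \<open>undefined\<close>, so the cube is a full product of compact sets.\<close>

lemma compact_cube: "compact (cube d)"
proof -
  have "cube d = Pi\<^sub>E UNIV (\<lambda>i. if i \<in> {1..d} then {-1..1} else {undefined})"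
    unfolding cube_def by (auto simp: PiE_def Pi_def extensional_def split: if_splits)
  moreover have "compactin (product_topology (\<lambda>_. euclidean) UNIV)
      (Pi\<^sub>E UNIV (\<lambda>i::nat. if i \<in> {1..d} then {-1..1::real} else {undefined}))"
    unfolding compactin_PiE by auto
  ultimately show ?thesis unfolding euclidean_product_topology by simp
qed

text \<open>Connects the product sigma-algebra with the Borel sets of the function space, in which
  continuity and compact supports are expressed.\<close>

lemma measurable_cube_borel: "(\<lambda>x. x) \<in> borel_measurable (cube_measure {1..d})"
proof (rule measurable_coordinatewise_then_product)
  fix i
  show "(\<lambda>x. x i) \<in> borel_measurable (cube_measure {1..d})"
  proof (cases "i \<in> {1..d}")
    case True
    show ?thesis
      by (rule measurable_compose[OF measurable_component_singleton[OF True] measurable_half_lebesgue_id])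
  next
    case False
    have "x i = undefined" if "x \<in> space (cube_measure {1..d})" for x
      using that False by (auto simp: space_PiM PiE_def extensional_def)
    then show ?thesis by (subst measurable_cong[where g = "\<lambda>_. undefined"]) auto
  qed
qed

lemma continuous_on_cube_measurable:
  fixes f :: "(nat \<Rightarrow> real) \<Rightarrow> real"
  assumes "continuous_on (cube d) f"
  shows "f \<in> borel_measurable (cube_measure {1..d})"
proof -
  have "cube d \<in> sets borel" using compact_imp_closed[OF compact_cube] by auto
  then have "(\<lambda>x. indicator (cube d) x *\<^sub>R f x) \<in> borel_measurable borel"
    by (rule borel_measurable_continuous_on_indicator) (rule assms)
  from measurable_compose[OF measurable_cube_borel this]
  show ?thesis by (subst measurable_cong[where g = "\<lambda>x. indicator (cube d) x *\<^sub>R f x"])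
    (auto simp: space_cube_measure)
qed

lemma continuous_on_cube_bounded:
  fixes f :: "(nat \<Rightarrow> real) \<Rightarrow> real"
  assumes "continuous_on (cube d) f"
  obtains B where "\<And>x. x \<in> cube d \<Longrightarrow> \<bar>f x\<bar> \<le> B"
proof -
  have "bounded (f ` cube d)"
    using assms by (intro compact_imp_bounded compact_continuous_image compact_cube)
  then show ?thesis using that unfolding bounded_iff by auto
qed

lemma continuous_on_cube_integrable:
  fixes f :: "(nat \<Rightarrow> real) \<Rightarrow> real"
  assumes "continuous_on (cube d) f"
  shows "integrable (cube_measure {1..d}) f"
proof -
  interpret P: prob_space "cube_measure {1..d}" by (rule prob_space_cube_measure)
  obtain B where B: "\<And>x. x \<in> cube d \<Longrightarrow> \<bar>f x\<bar> \<le> B"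
    using continuous_on_cube_bounded[OF assms] by blast
  show ?thesis
  proof (rule P.integrable_const_bound[where B = B])
    show "AE x in cube_measure {1..d}. norm (f x) \<le> B"
      using B by (intro AE_I2) (auto simp: space_cube_measure)
  qed (rule continuous_on_cube_measurable[OF assms])
qed

lemma continuous_on_cube_locally_integrable:
  fixes f :: "(nat \<Rightarrow> real) \<Rightarrow> real"
  assumes f: "continuous_on (cube d) f"
  shows "locally_integrable d f"
  unfolding locally_integrable_def
proof (intro conjI allI impI continuous_on_cube_measurable f)
  fix K :: "(nat \<Rightarrow> real) set" assume K: "compact K \<and> K \<subseteq> {1..d} \<rightarrow>\<^sub>E {-1<..<1}"
  have "K \<in> sets borel" using K by (simp add: borel_compact)
  from measurable_sets[OF measurable_cube_borel this]
  have "K \<inter> space (cube_measure {1..d}) \<in> sets (cube_measure {1..d})" by simp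
  moreover have "K \<subseteq> space (cube_measure {1..d})"
    unfolding space_cube_measure cube_def
    by (rule subset_trans[OF conjunct2[OF K] PiE_mono]) auto
  ultimately have "K \<in> sets (cube_measure {1..d})" by (simp add: Int_absorb2)
  then show "set_integrable (cube_measure {1..d}) K f"
    unfolding set_integrable_def
    using integrable_mult_indicator continuous_on_cube_integrable[OF f] by blast
qed

section \<open>Test functions and integration by parts\<close>

lemma PiE_upd: "x \<in> {1..d} \<rightarrow>\<^sub>E UNIV \<Longrightarrow> i \<in> {1..d} \<Longrightarrow> x(i := t) \<in> {1..d} \<rightarrow>\<^sub>E UNIV"
  by (auto simp: PiE_def extensional_def)

lemma cube_subset: "cube d \<subseteq> {1..d} \<rightarrow>\<^sub>E UNIV"
  unfolding cube_def by auto

lemma continuous_on_fun_upd: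
  "continuous_on A (\<lambda>t. x(i := t) :: 'a \<Rightarrow> 'b::topological_space)"
proof (rule continuous_on_coordinatewise_then_product)
  fix j show "continuous_on A (\<lambda>t. (x(i := t)) j)" by (cases "j = i") auto
qed

lemma test_function_smooth:
  assumes "test_function d \<phi>"
  shows "continuous_on ({1..d} \<rightarrow>\<^sub>E UNIV) \<phi>"
    and "\<And>x i. x \<in> {1..d} \<rightarrow>\<^sub>E UNIV \<Longrightarrow> i \<in> {1..d} \<Longrightarrow> (\<lambda>t. \<phi> (x(i := t))) differentiable (at (x i))"
proof -
  have "\<forall>is\<in>lists {1..d}. continuous_on ({1..d} \<rightarrow>\<^sub>E UNIV) (partial_derivs is \<phi>) \<and>
      (\<forall>x\<in>{1..d} \<rightarrow>\<^sub>E UNIV. \<forall>i\<in>{1..d}. (\<lambda>t. partial_derivs is \<phi> (x(i := t))) differentiable (at (x i)))"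
    using assms unfolding test_function_def smooth_def by blast
  from bspec[OF this lists.Nil]
  show "continuous_on ({1..d} \<rightarrow>\<^sub>E UNIV) \<phi>"
    and "\<And>x i. x \<in> {1..d} \<rightarrow>\<^sub>E UNIV \<Longrightarrow> i \<in> {1..d} \<Longrightarrow> (\<lambda>t. \<phi> (x(i := t))) differentiable (at (x i))"
    by simp_all
qed

lemma test_function_derivative:
  assumes \<phi>: "test_function d \<phi>" and x: "x \<in> {1..d} \<rightarrow>\<^sub>E UNIV" and i: "i \<in> {1..d}"
  shows "((\<lambda>t. \<phi> (x(i := t))) has_real_derivative partial_deriv i \<phi> x) (at (x i))"
  using test_function_smooth(2)[OF assms] unfolding partial_deriv_def
  by (simp add: DERIV_deriv_iff_real_differentiable)

lemma test_function_partial_deriv: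
  assumes \<phi>: "test_function d \<phi>" and i: "i \<in> {1..d}"
  shows "test_function d (partial_deriv i \<phi>)"
  unfolding test_function_def
proof
  show "smooth d (partial_deriv i \<phi>)"
    unfolding smooth_def
  proof
    fix js assume "js \<in> lists {1..d}"
    \<comment> \<open>\<open>partial_derivs\<close> is a right fold, so the derivative taken first
      stands last in the list.\<close>
    then have "js @ [i] \<in> lists {1..d}" using i by simp
    with \<phi> have "continuous_on ({1..d} \<rightarrow>\<^sub>E UNIV) (partial_derivs (js @ [i]) \<phi>) \<and>
      (\<forall>x\<in>{1..d} \<rightarrow>\<^sub>E UNIV. \<forall>k\<in>{1..d}. (\<lambda>t. partial_derivs (js @ [i]) \<phi> (x(k := t))) differentiable (at (x k)))"
      unfolding test_function_def smooth_def by blast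
    then show "continuous_on ({1..d} \<rightarrow>\<^sub>E UNIV) (partial_derivs js (partial_deriv i \<phi>)) \<and>
      (\<forall>x\<in>{1..d} \<rightarrow>\<^sub>E UNIV. \<forall>k\<in>{1..d}. (\<lambda>t. partial_derivs js (partial_deriv i \<phi>) (x(k := t))) differentiable (at (x k)))"
      unfolding foldr_append foldr.simps comp_def id_apply .
  qed
  obtain K where K: "compact K" "K \<subseteq> {1..d} \<rightarrow>\<^sub>E {-1<..<1}" "\<And>x. x \<in> ({1..d} \<rightarrow>\<^sub>E UNIV) - K \<Longrightarrow> \<phi> x = 0"
    using \<phi> unfolding test_function_def by blast
  have "partial_deriv i \<phi> x = 0" if x: "x \<in> ({1..d} \<rightarrow>\<^sub>E UNIV) - K" for x
  proof -
    have "closed K" by (rule compact_imp_closed[OF K(1)])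
    \<comment> \<open>The same compact set supports the derivative: outside \<open>K\<close>, which
      is closed, the function vanishes on a whole neighbourhood in direction
      \<open>i\<close>.\<close>
    then have "open ((\<lambda>t. x(i := t)) -` (- K))"
      by (intro open_vimage continuous_on_fun_upd) auto
    moreover have "x i \<in> (\<lambda>t. x(i := t)) -` (- K)" using x by simp
    moreover have "\<phi> (x(i := t)) = 0" if "t \<in> (\<lambda>t. x(i := t)) -` (- K)" for t
    proof (rule K(3))
      show "x(i := t) \<in> ({1..d} \<rightarrow>\<^sub>E UNIV) - K" using that x PiE_upd[OF _ i, of x] by blast
    qed
    ultimately have "((\<lambda>t. \<phi> (x(i := t))) has_real_derivative 0) (at (x i))"
      using has_field_derivative_transform_within_open[of "\<lambda>_. 0" 0 "x i" "(\<lambda>t. x(i := t)) -` (- K)" "\<lambda>t. \<phi> (x(i := t))"]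
      by simp
    then show ?thesis unfolding partial_deriv_def by (rule DERIV_imp_deriv)
  qed
  with K(1,2) show "\<exists>K. compact K \<and> K \<subseteq> {1..d} \<rightarrow>\<^sub>E {-1<..<1} \<and> (\<forall>x\<in>({1..d} \<rightarrow>\<^sub>E UNIV) - K. partial_deriv i \<phi> x = 0)"
    by blast
qed

lemma test_function_partial_derivs:
  "test_function d \<phi> \<Longrightarrow> is \<in> lists {1..d} \<Longrightarrow> test_function d (partial_derivs is \<phi>)"
  by (induction "is") (auto intro: test_function_partial_deriv)

lemma test_function_boundary:
  assumes \<phi>: "test_function d \<phi>" and x: "x \<in> {1..d} \<rightarrow>\<^sub>E UNIV" and i: "i \<in> {1..d}" "\<bar>x i\<bar> = 1"
  shows "\<phi> x = 0"
proof -
  obtain K where K: "K \<subseteq> {1..d} \<rightarrow>\<^sub>E {-1<..<1}" "\<And>x. x \<in> ({1..d} \<rightarrow>\<^sub>E UNIV) - K \<Longrightarrow> \<phi> x = 0"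
    using \<phi> unfolding test_function_def by blast
  have "x \<notin> K" using K(1) i by (force simp: PiE_def Pi_def abs_if split: if_splits)
  then show ?thesis using K(2) x by blast
qed

text \<open>Fubini's theorem isolates coordinate \<open>i\<close>; on each line \<open>h\<close> is
  the derivative of \<open>f * \<phi>\<close>, and the boundary terms vanish because
  \<open>\<phi>\<close> is supported in the open cube. One-sided derivatives of \<open>f\<close> at
  the faces are enough for the fundamental theorem.\<close>

lemma integration_by_parts_cube:
  assumes f: "continuous_on (cube d) f" and g: "continuous_on (cube d) g" and i: "i \<in> {1..d}"
    and der: "\<And>x. x \<in> cube d \<Longrightarrow> ((\<lambda>t. f (x(i := t))) has_real_derivative g x) (at (x i) within {-1..1})"
    and \<phi>: "test_function d \<phi>"
  shows "(\<integral>x. f x * partial_deriv i \<phi> x \<partial>cube_measure {1..d}) = - (\<integral>x. g x * \<phi> x \<partial>cube_measure {1..d})"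
proof -
  define h where "h x = f x * partial_deriv i \<phi> x + g x * \<phi> x" for x
  have c\<phi>: "continuous_on (cube d) \<phi>"
    using continuous_on_subset[OF test_function_smooth(1)[OF \<phi>] cube_subset] .
  have c\<phi>': "continuous_on (cube d) (partial_deriv i \<phi>)"
    using continuous_on_subset[OF test_function_smooth(1)[OF test_function_partial_deriv[OF \<phi> i]] cube_subset] .
  have ch: "continuous_on (cube d) h" unfolding h_def by (intro continuous_intros f g c\<phi> c\<phi>')
  obtain B where B: "\<And>x. x \<in> cube d \<Longrightarrow> \<bar>h x\<bar> \<le> B"
    using continuous_on_cube_bounded[OF ch] by blast
  have I: "insert i ({1..d} - {i}) = {1..d}" using i by auto
  have "integral\<^sup>L (cube_measure {1..d}) h
      = (\<integral>x. (\<integral>y. h (x(i := y)) \<partial>half_lebesgue) \<partial>cube_measure ({1..d} - {i}))"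
    using half.product_integral_insert[of "{1..d} - {i}" i h] continuous_on_cube_integrable[OF ch] unfolding I by simp
  also have "\<dots> = (\<integral>x. 0 \<partial>cube_measure ({1..d} - {i}))"
  proof (rule Bochner_Integration.integral_cong[OF refl])
    fix x assume x: "x \<in> space (cube_measure ({1..d} - {i}))"
    have xy: "x(i := y) \<in> cube d" if "y \<in> {-1..1}" for y
      using x that i unfolding cube_def space_PiM by (auto simp: PiE_def Pi_def extensional_def)
    have xp: "x(i := y) \<in> {1..d} \<rightarrow>\<^sub>E UNIV" for y
      using x i unfolding space_PiM by (auto simp: PiE_def extensional_def)
    let ?q = "\<lambda>y. f (x(i := y)) * \<phi> (x(i := y))"
    have "((\<lambda>y. h (x(i := y))) has_integral ?q 1 - ?q (-1)) {-1..1}"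
    proof (rule fundamental_theorem_of_calculus)
      fix y :: real assume y: "y \<in> {-1..1}"
      have 1: "((\<lambda>t. f (x(i := t))) has_real_derivative g (x(i := y))) (at y within {-1..1})"
        using der[OF xy[OF y]] by simp
      have 2: "((\<lambda>t. \<phi> (x(i := t))) has_real_derivative partial_deriv i \<phi> (x(i := y))) (at y within {-1..1})"
        using has_field_derivative_at_within[OF test_function_derivative[OF \<phi> xp i]] by simp
      show "(?q has_vector_derivative h (x(i := y))) (at y within {-1..1})"
        unfolding has_real_derivative_iff_has_vector_derivative[symmetric] h_def
        using DERIV_mult[OF 1 2] by (simp add: algebra_simps)
    qed simp
    moreover have "\<phi> (x(i := 1)) = 0" "\<phi> (x(i := -1)) = 0"
      using test_function_boundary[OF \<phi> xp i] by auto
    ultimately have "integral {-1..1} (\<lambda>y. h (x(i := y))) = 0" by (simp add: integral_unique)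
    moreover have "integral {-1..1} (\<lambda>y. h (x(i := y))) = 2 * (\<integral>y. h (x(i := y)) \<partial>half_lebesgue)"
    proof (rule integral_half_lebesgue(2))
      have "continuous_on {-1..1} (\<lambda>y. h (x(i := y)))"
        by (rule continuous_on_compose2[OF ch continuous_on_fun_upd]) (use xy in auto)
      then show "(\<lambda>y. h (x(i := y))) \<in> borel_measurable half_lebesgue"
        unfolding measurable_cong_sets[OF sets_half_lebesgue refl] by (rule borel_measurable_continuous_on_restrict)
    qed (rule B[OF xy])
    ultimately show "(\<integral>y. h (x(i := y)) \<partial>half_lebesgue) = 0" by simp
  qed
  finally have "integral\<^sup>L (cube_measure {1..d}) h = 0" by simp
  moreover have "integral\<^sup>L (cube_measure {1..d}) h =
      (\<integral>x. f x * partial_deriv i \<phi> x \<partial>cube_measure {1..d}) + (\<integral>x. g x * \<phi> x \<partial>cube_measure {1..d})"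
    unfolding h_def
    by (intro Bochner_Integration.integral_add continuous_on_cube_integrable continuous_intros f g c\<phi> c\<phi>')
  ultimately show ?thesis by simp
qed

section \<open>Weak derivatives and Sobolev norms of real traces\<close>

lemma of_real_in_poly_stadium:
  "unit_box n x \<Longrightarrow> (\<And>i. i \<in> {1..n} \<Longrightarrow> 0 < s i) \<Longrightarrow>
    (embed x) \<in> poly_stadium n s"
  using of_real_in_stadium unfolding poly_stadium_def by blast

lemma cube_in_poly_stadium:
  "x \<in> cube n \<Longrightarrow> 0 < t \<Longrightarrow> (embed x) \<in> poly_stadium n (\<lambda>_. t)"
  using cubeD by (intro of_real_in_poly_stadium) auto

lemma sep_hol_continuous_cube:
  assumes F: "sep_hol d (\<lambda>_. t) B F" and t: "0 < t"
  shows "continuous_on (cube d) (\<lambda>x. Re (F (embed x)))"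
proof (rule continuous_on_eq_continuous_within[THEN iffD2], rule ballI)
  fix x assume x: "x \<in> cube d"
  \<comment> \<open>Half of the width is given up so that Cauchy's inequality has room.\<close>
  have lip: "cmod (F z - F w) \<le> B / (t/2) * (\<Sum>i\<in>{1..d}. cmod (z i - w i))"
    if "z \<in> poly_stadium d (\<lambda>_. t/2)" "w \<in> poly_stadium d (\<lambda>_. t/2)" for z w
    by (rule sep_hol_lipschitz[OF F _ _ that]) (use t in auto)
  have "\<bar>Re (F (embed y)) - Re (F (embed x))\<bar>
      \<le> B / (t/2) * (\<Sum>i\<in>{1..d}. \<bar>y i - x i\<bar>)" if y: "y \<in> cube d" for y
  proof -
    have "\<bar>Re (F (embed y) - F (embed x))\<bar>
      \<le> B / (t/2) * (\<Sum>i\<in>{1..d}. cmod (complex_of_real (y i) - complex_of_real (x i)))"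
      using t by (intro order_trans[OF abs_Re_le_cmod] lip cube_in_poly_stadium x y) auto
    then show ?thesis by (simp flip: of_real_diff)
  qed
  then have ev: "\<forall>\<^sub>F y in at x within cube d. norm (Re (F (embed y)) - Re (F (embed x)))
      \<le> B / (t/2) * (\<Sum>i\<in>{1..d}. \<bar>y i - x i\<bar>)"
    by (auto simp: eventually_at_filter)
  have "((\<lambda>y. y i) \<longlongrightarrow> x i) (at x within cube d)" for i
    using continuous_on_subset[OF continuous_on_product_coordinates, of "cube d" i] x by (auto simp: continuous_on_def)
  then have "((\<lambda>y. B / (t/2) * (\<Sum>i\<in>{1..d}. \<bar>y i - x i\<bar>)) \<longlongrightarrow> B / (t/2) * (\<Sum>i\<in>{1..d}. \<bar>x i - x i\<bar>)) (at x within cube d)"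
    by (intro tendsto_intros)
  then have "((\<lambda>y. B / (t/2) * (\<Sum>i\<in>{1..d}. \<bar>y i - x i\<bar>)) \<longlongrightarrow> 0) (at x within cube d)" by simp
  from Lim_null_comparison[OF ev this]
  show "continuous (at x within cube d) (\<lambda>x. Re (F (embed x)))"
    unfolding continuous_within by (rule LIM_zero_cancel)
qed

text \<open>The head of the list is the outermost derivative of the test function, hence the first
  to be moved over by parts and the first to act on \<open>F\<close>. This is why
  \<open>foldr\<close> on the test function corresponds to \<open>fold\<close> on
  \<open>F\<close>.\<close>

lemma sep_hol_weak_deriv_integral:
  assumes "sep_hol d (\<lambda>_. t + real (length is) * r) B F" and t: "0 < t" and r: "0 < r"
    and "is \<in> lists {1..d}" and \<phi>: "test_function d \<phi>"
  shows "(\<integral>x. Re (F (embed x)) * partial_derivs is \<phi> x \<partial>cube_measure {1..d})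
    = (-1) ^ length is * (\<integral>x. Re (fold cpartial is F (embed x)) * \<phi> x \<partial>cube_measure {1..d})"
  using assms(1,4)
proof (induction "is" arbitrary: F B)
  case (Cons i "is")
  have i: "i \<in> {1..d}" and il: "is \<in> lists {1..d}" using Cons.prems by auto
  define T where "T = t + real (length (i # is)) * r"
  have T: "0 < T" unfolding T_def using t r by (intro add_pos_nonneg mult_nonneg_nonneg) auto
  have F: "sep_hol d (\<lambda>_. T) B F" using Cons.prems(1) unfolding T_def .
  have F': "sep_hol d (\<lambda>_. t + real (length is) * r) (B / r) (cpartial i F)"
    by (rule sep_hol_cpartial[OF Cons.prems(1) i r]) (use r in \<open>auto simp: algebra_simps\<close>)
  have T': "0 < t + real (length is) * r" using t r by (simp add: add_pos_nonneg)
  have "(\<integral>x. Re (F (embed x)) * partial_deriv i (partial_derivs is \<phi>) x \<partial>cube_measure {1..d})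
     = - (\<integral>x. Re (cpartial i F (embed x)) * partial_derivs is \<phi> x \<partial>cube_measure {1..d})"
  proof (rule integration_by_parts_cube[OF sep_hol_continuous_cube[OF F T] sep_hol_continuous_cube[OF F' T'] i])
    show "((\<lambda>t. Re (F (\<lambda>j. complex_of_real ((x(i := t)) j)))) has_real_derivative
            Re (cpartial i F (embed x))) (at (x i) within {- 1..1})" if "x \<in> cube d" for x
      using cubeD[OF that] by (intro cpartial_has_real_derivative[OF F i T]) auto
  qed (rule test_function_partial_derivs[OF \<phi> il])
  then show ?case using Cons.IH[OF F' il] by simp
qed simp

text \<open>The norm is an infimum over families of weak derivatives, so the real parts of the
  complex partial derivatives, bounded by Cauchy's inequality, give an upper bound. There are
  \<open>d ^ j\<close> index lists of length \<open>j\<close>, which explains the square root in the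
  constant.\<close>

lemma sobolev_norm_bound:
  fixes d m :: nat and t r :: real
  assumes t: "0 < t" and r: "0 < r"
  obtains C where "0 \<le> C" "\<And>F B f. sep_hol d (\<lambda>_. t + real m * r) B F \<Longrightarrow> 0 \<le> B \<Longrightarrow>
      (\<And>x. x \<in> cube d \<Longrightarrow> f x = Re (F (embed x))) \<Longrightarrow>
      sobolev_norm d m f \<le> ereal (C * B)"
proof -
  define C where "C = (\<Sum>j\<le>m. sqrt (real (d ^ j)) / r ^ j)"
  have C0: "0 \<le> C" unfolding C_def using r by (intro sum_nonneg) auto
  show ?thesis
  proof (rule that[OF C0])
    fix F B f
    assume F: "sep_hol d (\<lambda>_. t + real m * r) B F" and B: "0 \<le> B"
      and f: "\<And>x. x \<in> cube d \<Longrightarrow> f x = Re (F (embed x))"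
    define D where "D is x = Re (fold cpartial is F (embed x))" for "is" :: "nat list" and x :: "nat \<Rightarrow> real"
    have Fl: "sep_hol d (\<lambda>_. t + real (length is) * r) B F" if "length is \<le> m" for "is" :: "nat list"
      using that r by (intro sep_hol_mono[OF F]) auto
    have Dh: "sep_hol d (\<lambda>_. t) (B / r ^ length is) (fold cpartial is F)"
      if "is \<in> lists {1..d}" "length is \<le> m" for "is"
      using that r by (intro sep_hol_fold_cpartial[OF Fl]) auto
    have Dc: "continuous_on (cube d) (D is)" if "is \<in> lists {1..d}" "length is \<le> m" for "is"
      unfolding D_def by (rule sep_hol_continuous_cube[OF Dh[OF that] t])
    have Db: "\<bar>D is x\<bar> \<le> B / r ^ length is" if "is \<in> lists {1..d}" "length is \<le> m" "x \<in> cube d" for "is" x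
      unfolding D_def using sep_hol_bound[OF Dh[OF that(1,2)] cube_in_poly_stadium[OF that(3) t]] abs_Re_le_cmod
      by (rule order_trans[rotated])
    have fc: "continuous_on (cube d) f"
      using Dc[of "[]"] f unfolding D_def by (simp cong: continuous_on_cong)
    have weak: "weak_deriv d is f (D is)" if l: "is \<in> lists {1..d}" "length is \<le> m" for "is"
      unfolding weak_deriv_def
    proof (intro conjI allI impI continuous_on_cube_locally_integrable fc Dc[OF l])
      fix \<phi> assume \<phi>: "test_function d \<phi>"
      have "(\<integral>x. f x * partial_derivs is \<phi> x \<partial>cube_measure {1..d})
         = (\<integral>x. Re (F (embed x)) * partial_derivs is \<phi> x \<partial>cube_measure {1..d})"
        by (rule Bochner_Integration.integral_cong) (auto simp: space_cube_measure f)
      then show "(\<integral>x. f x * partial_derivs is \<phi> x \<partial>cube_measure {1..d})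
          = (-1) ^ length is * (\<integral>x. D is x * \<phi> x \<partial>cube_measure {1..d})"
        unfolding D_def using sep_hol_weak_deriv_integral[OF Fl[OF l(2)] t r l(1) \<phi>] by simp
    qed
    have ess: "esssup (cube_measure {1..d}) (\<lambda>x. ereal (sqrt (\<Sum>is\<in>{is\<in>lists {1..d}. length is = j}. (D is x)\<^sup>2)))
        \<le> ereal (sqrt (real (d ^ j)) / r ^ j * B)" if j: "j \<le> m" for j
    proof (rule esssup_I)
      let ?A = "{is\<in>lists {1..d}. length is = j}"
      show "(\<lambda>x. ereal (sqrt (\<Sum>is\<in>?A. (D is x)\<^sup>2))) \<in> borel_measurable (cube_measure {1..d})"
        using j by (intro borel_measurable_ereal continuous_on_cube_measurable continuous_intros Dc) auto
      have "sqrt (\<Sum>is\<in>?A. (D is x)\<^sup>2) \<le> sqrt (real (d ^ j)) / r ^ j * B" if x: "x \<in> cube d" for x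
      proof -
        have A: "?A = {is. set is \<subseteq> {1..d} \<and> length is = j}" by auto
        have card: "card ?A = d ^ j" unfolding A by (simp add: card_lists_length_eq)
        have "(\<Sum>is\<in>?A. (D is x)\<^sup>2) \<le> (\<Sum>is\<in>?A. (B / r ^ j)\<^sup>2)"
        proof (rule sum_mono)
          fix "is" assume "is \<in> ?A"
          then have "\<bar>D is x\<bar> \<le> B / r ^ j" using Db[of "is" x] x j by auto
          then show "(D is x)\<^sup>2 \<le> (B / r ^ j)\<^sup>2" by (metis abs_ge_zero power2_abs power_mono)
        qed
        also have "\<dots> = real (d ^ j) * (B / r ^ j)\<^sup>2" unfolding sum_constant card by simp
        finally have "sqrt (\<Sum>is\<in>?A. (D is x)\<^sup>2) \<le> sqrt (real (d ^ j) * (B / r ^ j)\<^sup>2)" by simp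
        also have "\<dots> = sqrt (real (d ^ j)) / r ^ j * B"
          using B r by (simp add: real_sqrt_mult)
        finally show ?thesis .
      qed
      then show "AE x in cube_measure {1..d}. ereal (sqrt (\<Sum>is\<in>?A. (D is x)\<^sup>2)) \<le> ereal (sqrt (real (d ^ j)) / r ^ j * B)"
        by (intro AE_I2) (auto simp: space_cube_measure)
    qed
    have "sobolev_norm d m f \<le> (\<Sum>j\<le>m. esssup (cube_measure {1..d})
          (\<lambda>x. ereal (sqrt (\<Sum>is\<in>{is\<in>lists {1..d}. length is = j}. (D is x)\<^sup>2))))"
      unfolding sobolev_norm_def using weak by (intro INF_lower) auto
    also have "\<dots> \<le> (\<Sum>j\<le>m. ereal (sqrt (real (d ^ j)) / r ^ j * B))"
      by (intro sum_mono ess) auto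
    also have "\<dots> = ereal (C * B)" unfolding C_def sum_ereal sum_distrib_right ..
    finally show "sobolev_norm d m f \<le> ereal (C * B)" .
  qed
qed

section \<open>Triangular bijections of the cube\<close>

text \<open>Forward substitution: once the earlier coordinates are known, each equation is a
  bijection of the segment in its own variable, and solving it does not disturb the equations
  already solved.\<close>

lemma triangular_bij_betw:
  assumes dep: "\<And>k x y. k \<in> {1..d} \<Longrightarrow> (\<And>i. i \<in> {1..k} \<Longrightarrow> x i = y i) \<Longrightarrow> c k x = c k y"
    and bij: "\<And>k x. k \<in> {1..d} \<Longrightarrow> \<forall>i\<in>{1..<k}. \<bar>x i\<bar> \<le> 1 \<Longrightarrow>
      bij_betw (\<lambda>t::real. c k (x(k := t))) {-1..1} {-1..1::real}"
  shows "bij_betw (\<lambda>x. \<lambda>k\<in>{1..d}. c k x) (cube d) (cube d)"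
proof -
  have range: "c k x \<in> {-1..1}" if x: "x \<in> cube d" and k: "k \<in> {1..d}" for x k
  proof -
    have "x k \<in> {-1..1}" using cubeD[OF x k] by (auto simp: abs_le_iff)
    moreover have "\<forall>i\<in>{1..<k}. \<bar>x i\<bar> \<le> 1" using cubeD[OF x] k by auto
    ultimately have "c k (x(k := x k)) \<in> {-1..1}" using bij_betwE[OF bij[OF k]] by blast
    then show ?thesis by simp
  qed
  have inj: "inj_on (\<lambda>x. \<lambda>k\<in>{1..d}. c k x) (cube d)"
  proof (rule inj_onI)
    fix x y assume x: "x \<in> cube d" and y: "y \<in> cube d" and eq: "(\<lambda>k\<in>{1..d}. c k x) = (\<lambda>k\<in>{1..d}. c k y)"
    have eqk: "c k x = c k y" if "k \<in> {1..d}" for k using fun_cong[OF eq, of k] that by simp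
    have "x k = y k" if "k \<in> {1..d}" for k
      using that
    proof (induction k rule: less_induct)
      case (less k)
      have "c k (x(k := y k)) = c k y"
        using less by (intro dep) (auto split: if_splits)
      then have "c k (x(k := x k)) = c k (x(k := y k))" using eqk[OF less.prems] by simp
      moreover have "inj_on (\<lambda>t. c k (x(k := t))) {-1..1}"
        using cubeD[OF x] less.prems by (intro bij_betw_imp_inj_on[OF bij]) auto
      moreover have "x k \<in> {-1..1}" "y k \<in> {-1..1}"
        using cubeD[OF x less.prems] cubeD[OF y less.prems] by (auto simp: abs_le_iff)
      ultimately show ?case by (meson inj_onD)
    qed
    then show "x = y" using x y unfolding cube_def by (intro PiE_ext) auto
  qed
  have surj: "y \<in> (\<lambda>x. \<lambda>k\<in>{1..d}. c k x) ` cube d" if y: "y \<in> cube d" for y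
  proof -
    have "\<exists>x. (\<forall>i\<in>{1..n}. \<bar>x i\<bar> \<le> 1 \<and> c i x = y i)" if "n \<le> d" for n
      using that
    proof (induction n)
      case (Suc n)
      then obtain x where x: "\<forall>i\<in>{1..n}. \<bar>x i\<bar> \<le> 1 \<and> c i x = y i" by auto
      have sn: "Suc n \<in> {1..d}" using Suc.prems by auto
      have "y (Suc n) \<in> {-1..1}" using cubeD[OF y sn] by (auto simp: abs_le_iff)
      moreover have "\<forall>i\<in>{1..<Suc n}. \<bar>x i\<bar> \<le> 1" using x by auto
      ultimately obtain t where t: "t \<in> {-1..1}" "c (Suc n) (x(Suc n := t)) = y (Suc n)"
        using bij_betw_imp_surj_on[OF bij[OF sn, of x]] by (metis (no_types, lifting) imageE)
      have "\<bar>(x(Suc n := t)) i\<bar> \<le> 1 \<and> c i (x(Suc n := t)) = y i" if i: "i \<in> {1..Suc n}" for i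
      proof (cases "i = Suc n")
        case False
        then have i': "i \<in> {1..n}" "i \<in> {1..d}" using i Suc.prems by auto
        have "c i (x(Suc n := t)) = c i x" using i' by (intro dep) auto
        then show ?thesis using x i' False by simp
      qed (use t in \<open>auto simp: abs_le_iff\<close>)
      then show ?case by blast
    qed simp
    then obtain x where x: "\<forall>i\<in>{1..d}. \<bar>x i\<bar> \<le> 1 \<and> c i x = y i" by blast
    define x' where "x' = restrict x {1..d}"
    have x': "x' \<in> cube d" unfolding x'_def cube_def using x by (auto simp: abs_le_iff)
    have "c i x' = y i" if "i \<in> {1..d}" for i
    proof -
      have "c i x' = c i x" unfolding x'_def using that by (intro dep) auto
      then show ?thesis using x that by simp
    qed
    then have "(\<lambda>k\<in>{1..d}. c k x') = y" using y unfolding cube_def by (intro PiE_ext[of _ "{1..d}" "\<lambda>_. UNIV"]) auto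
    then show ?thesis using x' by blast
  qed
  show ?thesis
    unfolding bij_betw_def
  proof (intro conjI inj equalityI subsetI)
    fix y assume "y \<in> (\<lambda>x. \<lambda>k\<in>{1..d}. c k x) ` cube d"
    then show "y \<in> cube d" using range by (auto simp: cube_def)
  qed (rule surj)
qed

section \<open>Components of the approximating map\<close>

lemma polynomial_space_cong:
  assumes "p \<in> polynomial_space k \<Lambda>" "\<And>i. i \<in> {1..k} \<Longrightarrow> x i = y i"
  shows "p x = p y"
proof -
  obtain S c where p: "p = (\<lambda>x. \<Sum>\<nu>\<in>S. c \<nu> * (\<Prod>j\<in>{1..k}. x j ^ \<nu> j))"
    using assms(1) unfolding polynomial_space_def by blast
  show ?thesis unfolding p using assms(2) by (intro sum.cong arg_cong2[where f = "(*)"] prod.cong) auto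
qed

lemma polynomial_space_continuous:
  assumes "p \<in> polynomial_space k \<Lambda>"
  shows "continuous_on A (\<lambda>t. p (x(k := t)))"
proof -
  obtain S c where p: "p = (\<lambda>x. \<Sum>\<nu>\<in>S. c \<nu> * (\<Prod>j\<in>{1..k}. x j ^ \<nu> j))"
    using assms(1) unfolding polynomial_space_def by blast
  have "continuous_on A (\<lambda>t. (x(k := t)) j)" for j
    by (cases "j = k") auto
  then show ?thesis unfolding p by (intro continuous_intros)
qed

lemma approx_component_cong:
  assumes "p \<in> polynomial_space k \<Lambda>" "\<And>i. i \<in> {1..k} \<Longrightarrow> x i = y i" "1 \<le> k"
  shows "approx_component p k x = approx_component p k y"
proof -
  have "p (x(k := t)) = p (y(k := t))" for t
    using assms(2) by (intro polynomial_space_cong[OF assms(1)]) auto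
  then show ?thesis unfolding approx_component_def using assms(2)[of k] assms(3) by simp
qed

text \<open>The integrand is continuous and positive, so its normalised primitive rises strictly
  from -1 to 1; surjectivity is the intermediate value theorem.\<close>

lemma approx_component_facts:
  assumes p: "p \<in> polynomial_space k \<Lambda>" and pos: "\<And>t. t \<in> {-1..1} \<Longrightarrow> 0 < 1 + p (x(k := t))"
  shows "bij_betw (\<lambda>t. approx_component p k (x(k := t))) {-1..1} {-1..1}"
    and "strict_mono_on {-1..1} (\<lambda>t. approx_component p k (x(k := t)))"
proof -
  define q where "q t = (1 + p (x(k := t)))\<^sup>2" for t
  have cq: "continuous_on A q" for A
    unfolding q_def by (intro continuous_intros polynomial_space_continuous[OF p])
  have iq: "q integrable_on {a..b}" for a b by (rule integrable_continuous_real[OF cq])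
  have qpos: "0 < integral {s..t} q" if "-1 \<le> s" "s < t" "t \<le> 1" for s t
  proof -
    have 1: "0 < q u" if "u \<in> {s..t}" for u
    proof -
      have "u \<in> {-1..1}" using that \<open>-1 \<le> s\<close> \<open>t \<le> 1\<close> by auto
      then have "0 < 1 + p (x(k := u))" by (rule pos)
      then show ?thesis unfolding q_def by (intro zero_less_power)
    qed
    have "integral {s..t} q \<noteq> 0"
    proof
      assume z: "integral {s..t} q = 0"
      have nn: "0 \<le> q u" for u unfolding q_def by simp
      then have "\<forall>u\<in>{s..t}. q u = 0"
        using integral_eq_0_iff[OF cq \<open>s < t\<close> nn] z by blast
      then show False using 1[of s] \<open>s < t\<close> by auto
    qed
    moreover have "0 \<le> integral {s..t} q" by (intro integral_nonneg iq) (simp add: q_def)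
    ultimately show ?thesis by simp
  qed
  define I where "I = integral {-1..1} q"
  have I: "0 < I" unfolding I_def by (rule qpos) auto
  have eq: "approx_component p k (x(k := t)) = -1 + 2 / I * integral {-1..t} q" for t
    unfolding approx_component_def I_def q_def by simp
  show sm: "strict_mono_on {-1..1} (\<lambda>t. approx_component p k (x(k := t)))"
  proof (rule strict_mono_onI)
    fix s t :: real assume s: "s \<in> {-1..1}" and t: "t \<in> {-1..1}" and st: "s < t"
    have "integral {-1..s} q + integral {s..t} q = integral {-1..t} q"
      using s t st by (intro Henstock_Kurzweil_Integration.integral_combine iq) auto
    then have "integral {-1..s} q < integral {-1..t} q" using qpos[of s t] s t st by auto
    then show "approx_component p k (x(k := s)) < approx_component p k (x(k := t))"
      unfolding eq using I by (intro add_strict_left_mono mult_strict_left_mono) auto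
  qed
  have cont: "continuous_on {-1..1} (\<lambda>t. approx_component p k (x(k := t)))"
    unfolding eq by (intro continuous_intros indefinite_integral_continuous_1 iq)
  have ends: "approx_component p k (x(k := -1)) = -1" "approx_component p k (x(k := 1)) = 1"
    unfolding eq using I by (simp_all add: I_def)
  have "(\<lambda>t. approx_component p k (x(k := t))) ` {-1..1} = {-1..1}"
  proof
    have mono: "approx_component p k (x(k := s)) \<le> approx_component p k (x(k := t))"
      if "s \<in> {-1..1}" "t \<in> {-1..1}" "s \<le> t" for s t
      using strict_mono_onD[OF sm that(1,2)] that(3) by (cases "s = t") auto
    show "(\<lambda>t. approx_component p k (x(k := t))) ` {-1..1} \<subseteq> {-1..1}"
      using mono[of "-1"] mono[of _ 1] ends by fastforce
    show "{-1..1} \<subseteq> (\<lambda>t. approx_component p k (x(k := t))) ` {-1..1}"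
    proof
      fix y :: real assume "y \<in> {-1..1}"
      then have "\<exists>t\<ge>-1. t \<le> 1 \<and> approx_component p k (x(k := t)) = y"
        using ends cont by (intro IVT') auto
      then show "y \<in> (\<lambda>t. approx_component p k (x(k := t))) ` {-1..1}" by auto
    qed
  qed
  then show "bij_betw (\<lambda>t. approx_component p k (x(k := t))) {-1..1} {-1..1}"
    using strict_mono_on_imp_inj_on[OF sm] unfolding bij_betw_def by blast
qed

lemma approx_map_monotone_bijection:
  assumes p: "\<And>k. k \<in> {1..d} \<Longrightarrow> p k \<in> polynomial_space k (\<Lambda> k)"
    and pos: "\<And>k x. k \<in> {1..d} \<Longrightarrow> unit_box k x \<Longrightarrow> 0 < 1 + p k x"
  shows "monotone_triangular d (approx_map d p)" "bij_betw (approx_map d p) (cube d) (cube d)"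
proof -
  have pos': "0 < 1 + p k (x(k := t))" if "k \<in> {1..d}" "\<forall>i\<in>{1..<k}. \<bar>x i\<bar> \<le> 1" "t \<in> {-1..1}" for k x t
    using that by (intro pos) (auto simp: abs_le_iff)
  have "bij_betw (\<lambda>x. \<lambda>k\<in>{1..d}. approx_component (p k) k x) (cube d) (cube d)"
  proof (rule triangular_bij_betw)
    fix k and x y :: "nat \<Rightarrow> real" assume k: "k \<in> {1..d}" and xy: "\<And>i. i \<in> {1..k} \<Longrightarrow> x i = y i"
    then show "approx_component (p k) k x = approx_component (p k) k y"
      by (intro approx_component_cong[OF p[OF k]]) auto
  next
    fix k and x :: "nat \<Rightarrow> real" assume k: "k \<in> {1..d}" and x: "\<forall>i\<in>{1..<k}. \<bar>x i\<bar> \<le> 1"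
    show "bij_betw (\<lambda>t. approx_component (p k) k (x(k := t))) {-1..1} {-1..1}"
      by (rule approx_component_facts(1)[OF p[OF k] pos'[OF k x]])
  qed
  moreover have "(\<lambda>x. \<lambda>k\<in>{1..d}. approx_component (p k) k x) = approx_map d p"
    unfolding approx_map_def ..
  ultimately show "bij_betw (approx_map d p) (cube d) (cube d)" by simp
  show "monotone_triangular d (approx_map d p)"
    unfolding monotone_triangular_def triangular_def
  proof (intro conjI ballI impI)
    fix j x y assume j: "j \<in> {1..d}" and xy: "\<forall>i\<in>{1..j}. x i = (y i :: real)"
    then show "approx_map d p x j = approx_map d p y j"
      unfolding approx_map_def using approx_component_cong[OF p[OF j], of x y] by simp
  next
    fix j x assume j: "j \<in> {1..d}" and x: "x \<in> cube d"
    have "\<forall>i\<in>{1..<j}. \<bar>x i\<bar> \<le> 1" using cubeD[OF x] j by auto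
    from approx_component_facts(2)[OF p[OF j] pos'[OF j this]]
    have "mono_on {-1..1} (\<lambda>t. approx_component (p j) j (x(j := t)))"
      by (rule strict_mono_on_imp_mono_on)
    then show "mono_on {-1..1} (\<lambda>t. approx_map d p (x(j := t)) j)"
      unfolding approx_map_def using j by simp
  qed
qed

section \<open>Approximation of one transport component\<close>

text \<open>Complex differentiability is tested on increments in a single coordinate, where the
  Euclidean distance reduces to \<open>cmod (t - u)\<close> and the gradient to one entry.
  \<open>restrict\<close> passes from extensional points to the arbitrary ones of
  \<open>sep_hol\<close>.\<close>

lemma holomorphic_vars_on_imp_sep_hol:
  assumes hol: "holomorphic_vars_on k R (\<Pi>\<^sub>E i\<in>{1..k}. stadium (\<zeta> i))"
    and bd: "\<And>z. z \<in> (\<Pi>\<^sub>E i\<in>{1..k}. stadium (\<zeta> i)) \<Longrightarrow> cmod (R z) \<le> B"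
  shows "sep_hol k \<zeta> B (\<lambda>z. R (restrict z {1..k}))"
proof (rule sep_holI)
  fix z w :: "nat \<Rightarrow> complex" assume "\<And>i. i \<in> {1..k} \<Longrightarrow> z i = w i"
  then have "restrict z {1..k} = restrict w {1..k}" by (intro restrict_ext) auto
  then show "R (restrict z {1..k}) = R (restrict w {1..k})" by simp
next
  have mem: "restrict z {1..k} \<in> (\<Pi>\<^sub>E i\<in>{1..k}. stadium (\<zeta> i))" if "z \<in> poly_stadium k \<zeta>" for z
    using that unfolding poly_stadium_def by auto
  fix z assume z: "z \<in> poly_stadium k \<zeta>"
  show "cmod (R (restrict z {1..k})) \<le> B" by (rule bd[OF mem[OF z]])
  fix i assume i: "i \<in> {1..k}"
  show "(\<lambda>t. R (restrict (z(i := t)) {1..k})) holomorphic_on stadium (\<zeta> i)"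
    unfolding holomorphic_on_def field_differentiable_def
  proof
    fix u assume u: "u \<in> stadium (\<zeta> i)"
    let ?r = "\<lambda>t. restrict (z(i := t)) {1..k}"
    have rm: "?r t \<in> (\<Pi>\<^sub>E i\<in>{1..k}. stadium (\<zeta> i))" if "t \<in> stadium (\<zeta> i)" for t
      by (intro mem poly_stadium_upd z that)
    obtain a where a: "\<And>e. e > 0 \<Longrightarrow> \<exists>\<rho>>0. \<forall>w\<in>(\<Pi>\<^sub>E i\<in>{1..k}. stadium (\<zeta> i)).
        L2_set (\<lambda>j. cmod (w j - ?r u j)) {1..k} < \<rho> \<longrightarrow>
        cmod (R w - R (?r u) - (\<Sum>j\<in>{1..k}. a j * (w j - ?r u j))) \<le> e * L2_set (\<lambda>j. cmod (w j - ?r u j)) {1..k}"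
      using hol rm[OF u] unfolding holomorphic_vars_on_def by blast
    have diff: "?r t j - ?r u j = (if j = i then t - u else 0)" if "j \<in> {1..k}" for t j
      using that by simp
    have L2: "L2_set (\<lambda>j. cmod (?r t j - ?r u j)) {1..k} = cmod (t - u)" for t
    proof -
      have "(\<Sum>j\<in>{1..k}. (cmod (?r t j - ?r u j))\<^sup>2) = (\<Sum>j\<in>{1..k}. if j = i then (cmod (t - u))\<^sup>2 else 0)"
        by (rule sum.cong[OF refl], subst diff) auto
      then show ?thesis unfolding L2_set_def using i by simp
    qed
    have lin: "(\<Sum>j\<in>{1..k}. a j * (?r t j - ?r u j)) = a i * (t - u)" for t
    proof -
      have "(\<Sum>j\<in>{1..k}. a j * (?r t j - ?r u j)) = (\<Sum>j\<in>{1..k}. if j = i then a i * (t - u) else 0)"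
        by (rule sum.cong[OF refl], subst diff) auto
      then show ?thesis using i by simp
    qed
    have "((\<lambda>t. R (?r t)) has_field_derivative a i) (at u within stadium (\<zeta> i))"
      unfolding has_field_derivative_def has_derivative_within_alt
    proof (intro conjI allI impI bounded_linear_mult_right)
      fix e :: real assume "e > 0"
      then obtain \<rho> where \<rho>: "\<rho> > 0" "\<And>w. w \<in> (\<Pi>\<^sub>E i\<in>{1..k}. stadium (\<zeta> i)) \<Longrightarrow>
        L2_set (\<lambda>j. cmod (w j - ?r u j)) {1..k} < \<rho> \<Longrightarrow>
        cmod (R w - R (?r u) - (\<Sum>j\<in>{1..k}. a j * (w j - ?r u j))) \<le> e * L2_set (\<lambda>j. cmod (w j - ?r u j)) {1..k}"
        using a by meson
      have "cmod (R (?r y) - R (?r u) - a i * (y - u)) \<le> e * cmod (y - u)"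
        if "y \<in> stadium (\<zeta> i)" "cmod (y - u) < \<rho>" for y
        using \<rho>(2)[OF rm[OF that(1)]] that(2) unfolding L2 lin by blast
      then show "\<exists>d>0. \<forall>y\<in>stadium (\<zeta> i). cmod (y - u) < d \<longrightarrow>
          cmod (R (?r y) - R (?r u) - a i * (y - u)) \<le> e * cmod (y - u)"
        using \<rho>(1) by blast
    qed
    then show "\<exists>D. ((\<lambda>t. R (?r t)) has_field_derivative D) (at u within stadium (\<zeta> i))" by blast
  qed
qed

section \<open>Primitives at real points and stability of normalised primitives\<close>

lemma cprim_continuous:
  assumes F: "sep_hol n s B F" and k: "k \<in> {1..n}" and s: "0 < s k" and z: "z \<in> poly_stadium n s"
  shows "continuous_on {0..1} (\<lambda>\<tau>. F (z(k := -1 + of_real \<tau> * (z k + 1))))"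
  by (rule sep_hol_continuous_path[OF F z k])
     (intro continuous_intros, intro segment_in_stadium poly_stadiumD[OF z k] s)

text \<open>The substitution \<open>t = -1 + \<tau> * (x k + 1)\<close> identifies the complex
  primitive with the real integrals in the transport and its approximation. It degenerates at
  \<open>x k = -1\<close>, where both sides are 0.\<close>

lemma cprim_real:
  assumes F: "sep_hol n s B F" and k: "k \<in> {1..n}" and s: "\<And>i. i \<in> {1..n} \<Longrightarrow> 0 < s i"
    and x: "unit_box n x"
    and re: "\<And>y. unit_box n y \<Longrightarrow> F (embed y) = of_real (\<phi> y)"
  shows "cprim k F (embed x) = of_real (integral {-1..x k} (\<lambda>t. \<phi> (x(k := t))))"
proof -
  define m where "m = x k + 1"
  define \<psi> where "\<psi> t = \<phi> (x(k := t))" for t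
  let ?z = "\<lambda>i. complex_of_real (x i)"
  have xk: "\<bar>x k\<bar> \<le> 1" using x k by blast
  have z: "?z \<in> poly_stadium n s" by (rule of_real_in_poly_stadium[OF x s])
  have upd: "?z(k := of_real t) = (\<lambda>i. complex_of_real ((x(k := t)) i))" for t by auto
  have F\<psi>: "F (?z(k := of_real t)) = of_real (\<psi> t)" if "\<bar>t\<bar> \<le> 1" for t
    unfolding upd \<psi>_def using x that by (intro re) auto
  have in1: "\<bar>-1 + \<tau> * m\<bar> \<le> 1" if "\<tau> \<in> {0..1}" for \<tau>
  proof -
    have "0 \<le> \<tau> * m" using that xk unfolding m_def by auto
    moreover have "\<tau> * m \<le> 1 * 2" using that xk unfolding m_def by (intro mult_mono) auto
    ultimately show ?thesis by (simp add: abs_le_iff)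
  qed
  have integrand: "F (?z(k := -1 + of_real \<tau> * (?z k + 1))) = of_real (\<psi> (m * \<tau> + -1))" if "\<tau> \<in> {0..1}" for \<tau>
  proof -
    have "-1 + of_real \<tau> * (?z k + 1) = of_real (-1 + \<tau> * m)" unfolding m_def by simp
    then show ?thesis using F\<psi>[OF in1[OF that]] by (simp only: add.commute mult.commute)
  qed
  have "cprim k F ?z = of_real m * integral {0..1} (\<lambda>\<tau>. complex_of_real (\<psi> (m * \<tau> + -1)))"
  proof -
    have "integral {0..1} (\<lambda>\<tau>. F (?z(k := -1 + of_real \<tau> * (?z k + 1))))
        = integral {0..1} (\<lambda>\<tau>. complex_of_real (\<psi> (m * \<tau> + -1)))"
      by (rule integral_cong) (rule integrand)
    moreover have "?z k + 1 = of_real m" unfolding m_def by simp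
    ultimately show ?thesis unfolding cprim_def by (simp only:)
  qed
  also have "\<dots> = of_real (integral {-1..x k} \<psi>)"
  proof (cases "m = 0")
    case True
    then have "x k = -1" unfolding m_def by simp
    then show ?thesis using True by simp
  next
    case False
    then have m: "0 < m" using xk unfolding m_def by auto
    have "continuous_on {-1..x k} (\<lambda>t. F (?z(k := of_real t)))"
      using xk by (intro sep_hol_continuous_path[OF F z k] continuous_intros of_real_in_stadium s k) (auto simp: abs_le_iff)
    then have "continuous_on {-1..x k} (\<lambda>t. Re (F (?z(k := of_real t))))" by (intro continuous_intros)
    then have "continuous_on {-1..x k} \<psi>"
      using F\<psi> xk by (elim continuous_on_eq) (auto simp: abs_le_iff)
    then have "(\<psi> has_integral integral {-1..x k} \<psi>) (cbox (-1) (x k))"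
      by (simp add: integrable_continuous_real integrable_integral)
    from has_integral_affinity'[OF this m, of "-1"]
    have "((\<lambda>\<tau>. \<psi> (m * \<tau> + -1)) has_integral integral {-1..x k} \<psi> / m) {0..1}"
      using m unfolding m_def by (simp add: divide_inverse mult.commute)
    then have "((\<lambda>\<tau>. complex_of_real (\<psi> (m * \<tau> + -1))) has_integral of_real (integral {-1..x k} \<psi> / m)) {0..1}"
      by (rule has_integral_of_real)
    then show ?thesis using m by (simp add: integral_unique)
  qed
  finally show ?thesis unfolding \<psi>_def .
qed

lemma cprim_diff:
  assumes F: "sep_hol n s B F" and G: "sep_hol n s B' G" and k: "k \<in> {1..n}" and s: "0 < s k"
    and z: "z \<in> poly_stadium n s"
  shows "cprim k F z - cprim k G z = cprim k (\<lambda>z. F z - G z) z"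
  unfolding cprim_def
  by (simp only: integral_diff[OF integrable_continuous_real[OF cprim_continuous[OF F k s z]]
        integrable_continuous_real[OF cprim_continuous[OF G k s z]]] right_diff_distrib)

text \<open>A lower bound on the real part, unlike one on the modulus, is preserved by averaging
  along the segment. The factor 2 is the prefactor \<open>z k + 1\<close> at the end point
  1.\<close>

lemma cprim_Re_ge:
  assumes F: "sep_hol n s B F" and k: "k \<in> {1..n}" and s: "0 < s k" and z: "z \<in> poly_stadium n s"
    and \<kappa>: "\<And>z. z \<in> poly_stadium n s \<Longrightarrow> \<kappa> \<le> Re (F z)"
  shows "2 * \<kappa> \<le> Re (cprim k F (z(k := 1)))"
proof -
  have z1: "z(k := 1) \<in> poly_stadium n s"
    using of_real_in_stadium[OF s, of 1] by (intro poly_stadium_upd z) simp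
  let ?h = "\<lambda>\<tau>. F ((z(k := 1))(k := -1 + of_real \<tau> * ((z(k := 1)) k + 1)))"
  have int: "?h integrable_on {0..1}"
    by (rule integrable_continuous_real[OF cprim_continuous[OF F k s z1]])
  have hRe: "((\<lambda>\<tau>. Re (?h \<tau>)) has_integral Re (integral {0..1} ?h)) {0..1}"
    by (rule has_integral_Re[OF integrable_integral[OF int]])
  have "\<kappa> \<le> Re (?h \<tau>)" if "\<tau> \<in> {0..1}" for \<tau>
    using poly_stadiumD[OF z1 k] s that by (intro \<kappa> poly_stadium_upd z1 segment_in_stadium)
  then have "integral {0..1} (\<lambda>\<tau>::real. \<kappa>) \<le> Re (integral {0..1} ?h)"
    using hRe by (intro has_integral_le[OF integrable_integral hRe]) auto
  then have "\<kappa> \<le> Re (integral {0..1} ?h)" by simp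
  then show ?thesis unfolding cprim_def by simp
qed

lemma sep_hol_divide:
  assumes F: "sep_hol n s A F" and G: "sep_hol n s B G" and \<kappa>: "0 < \<kappa>" "\<And>z. z \<in> poly_stadium n s \<Longrightarrow> \<kappa> \<le> cmod (G z)"
  shows "sep_hol n s (A * (1 / \<kappa>)) (\<lambda>z. F z / G z)"
proof -
  have "sep_hol n s (1 / \<kappa>) (\<lambda>z. inverse (G z))"
  proof (rule sep_hol_compose[OF G, where V = "- {0}"])
    show "inverse holomorphic_on - {0::complex}" by (intro holomorphic_intros) auto
    fix z assume "z \<in> poly_stadium n s"
    then have g: "\<kappa> \<le> cmod (G z)" by (rule \<kappa>(2))
    moreover have "cmod (inverse (G z)) \<le> 1 / \<kappa>"
      using le_imp_inverse_le[OF g \<kappa>(1)] by (simp only: norm_inverse inverse_eq_divide[of \<kappa>])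
    ultimately show "G z \<in> - {0} \<and> cmod (inverse (G z)) \<le> 1 / \<kappa>" using \<kappa>(1) by auto
  qed
  from sep_hol_mult[OF F this] show ?thesis by (simp add: divide_inverse)
qed

lemma sep_hol_rebound:
  "sep_hol n s B F \<Longrightarrow> (\<And>z. z \<in> poly_stadium n s \<Longrightarrow> cmod (F z) \<le> B') \<Longrightarrow> sep_hol n s B' F"
  unfolding sep_hol_def by blast

text \<open>Normalisation is stable by
  \<open>a / c - a' / c' = (a - a') / c + a' * (c' - c) / (c * c')\<close>: numerators and
  denominators each change by at most \<open>N * \<eta>\<close>, where \<open>N\<close> bounds the
  prefactor \<open>z k + 1\<close>.\<close>

lemma sep_hol_normalised_cprim_diff:
  assumes F: "sep_hol n s A F" and G: "sep_hol n s B G" and k: "k \<in> {1..n}" and s: "0 < s k"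
    and \<kappa>: "0 < \<kappa>" and cF: "\<And>z. z \<in> poly_stadium n s \<Longrightarrow> \<kappa> \<le> cmod (cprim k F (z(k := 1)))"
    and cG: "\<And>z. z \<in> poly_stadium n s \<Longrightarrow> \<kappa> \<le> cmod (cprim k G (z(k := 1)))"
    and \<eta>: "\<And>z. z \<in> poly_stadium n s \<Longrightarrow> cmod (F z - G z) \<le> \<eta>"
  defines "N \<equiv> 2 + s k"
  shows "sep_hol n s (2 * (N / \<kappa> + N * B * N / \<kappa>\<^sup>2) * \<eta>)
     (\<lambda>z. 2 * (cprim k F z / cprim k F (z(k := 1)) - cprim k G z / cprim k G (z(k := 1))))"
proof (rule sep_hol_rebound)
  have one: "1 \<in> stadium (s k)" using of_real_in_stadium[OF s, of 1] by simp
  have gF: "sep_hol n s (N * A) (cprim k F)" and gG: "sep_hol n s (N * B) (cprim k G)"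
    unfolding N_def by (intro sep_hol_cprim F G k s)+
  \<comment> \<open>Separate holomorphy comes with a crude bound that ignores cancellation; it is
    then replaced by the one proportional to \<open>\<eta>\<close>.\<close>
  show "sep_hol n s (2 * (N * A * (1 / \<kappa>) + N * B * (1 / \<kappa>)))
     (\<lambda>z. 2 * (cprim k F z / cprim k F (z(k := 1)) - cprim k G z / cprim k G (z(k := 1))))"
    by (intro sep_hol_mult[OF sep_hol_const] sep_hol_diff
        sep_hol_divide[OF gF sep_hol_fix[OF gF one] \<kappa> cF] sep_hol_divide[OF gG sep_hol_fix[OF gG one] \<kappa> cG]) auto
  fix z assume z: "z \<in> poly_stadium n s"
  have z1: "z(k := 1) \<in> poly_stadium n s" by (intro poly_stadium_upd z one)
  have D: "sep_hol n s \<eta> (\<lambda>z. F z - G z)" by (rule sep_hol_rebound[OF sep_hol_diff[OF F G] \<eta>])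
  note Db = sep_hol_bound[OF sep_hol_cprim[OF D k s]]
  define a c a' c' where "a = cprim k F z" and "c = cprim k F (z(k := 1))"
    and "a' = cprim k G z" and "c' = cprim k G (z(k := 1))"
  have aa: "cmod (a - a') \<le> N * \<eta>" unfolding a_def a'_def cprim_diff[OF F G k s z] N_def by (rule Db[OF z])
  have cc: "cmod (c - c') \<le> N * \<eta>" unfolding c_def c'_def cprim_diff[OF F G k s z1] N_def by (rule Db[OF z1])
  have a': "cmod a' \<le> N * B" unfolding a'_def by (rule sep_hol_bound[OF gG z])
  have c: "\<kappa> \<le> cmod c" "\<kappa> \<le> cmod c'" unfolding c_def c'_def using cF[OF z] cG[OF z] by auto
  then have c0: "c \<noteq> 0" "c' \<noteq> 0" using \<kappa> by auto
  have N\<eta>: "0 \<le> N * \<eta>" using aa by (meson norm_ge_zero order_trans)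
  have NB: "0 \<le> N * B" using a' by (meson norm_ge_zero order_trans)
  have "a / c - a' / c' = (a - a') / c + a' * (c' - c) / (c * c')"
    using c0 by (simp add: field_simps)
  also have "cmod \<dots> \<le> cmod (a - a') / cmod c + cmod a' * cmod (c - c') / (cmod c * cmod c')"
    using norm_triangle_ineq[of "(a - a') / c" "a' * (c' - c) / (c * c')"]
    by (simp add: norm_divide norm_mult norm_minus_commute)
  also have "\<dots> \<le> N * \<eta> / \<kappa> + N * B * (N * \<eta>) / (\<kappa> * \<kappa>)"
    using aa cc a' c \<kappa> N\<eta> NB by (intro add_mono frac_le mult_mono) auto
  also have "\<dots> = (N / \<kappa> + N * B * N / \<kappa>\<^sup>2) * \<eta>"
    by (simp add: power2_eq_square algebra_simps)
  finally have "cmod (a / c - a' / c') \<le> (N / \<kappa> + N * B * N / \<kappa>\<^sup>2) * \<eta>" .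
  then have "2 * cmod (a / c - a' / c') \<le> 2 * ((N / \<kappa> + N * B * N / \<kappa>\<^sup>2) * \<eta>)" by (rule mult_left_mono) simp
  then show "cmod (2 * (cprim k F z / cprim k F (z(k := 1)) - cprim k G z / cprim k G (z(k := 1))))
     \<le> 2 * (N / \<kappa> + N * B * N / \<kappa>\<^sup>2) * \<eta>"
    unfolding a_def[symmetric] c_def[symmetric] a'_def[symmetric] c'_def[symmetric]
    by (simp only: norm_mult norm_numeral mult.assoc)
qed

text \<open>
  The closed Bernstein ellipse with parameter \<open>1 + \<zeta>\<close> lies in the open stadium of radius \<open>\<zeta>\<close>,
  which leaves room for a slightly larger parameter \<open>r\<close>.
\<close>

lemma ellipse_parameters:
  fixes \<rho> :: real
  assumes "1 < \<rho>"
  obtains r \<sigma> s where "1 \<le> \<sigma>" "\<rho> * \<sigma> < r" "(r - 1 / r) / 2 < \<rho> - 1" "0 < s" "2 + 2 * s \<le> \<sigma> + 1 / \<sigma>" "s \<le> \<rho> - 1"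
proof -
  \<comment> \<open>\<open>4 * h\<close> is the gap
    \<open>2 * (\<rho> - 1) - (\<rho> - 1 / \<rho>)\<close>. Enlarging the parameter by
    \<open>h\<close> uses up at most half of it.\<close>
  define h where "h = (\<rho> - 1)\<^sup>2 / (4 * \<rho>)"
  have h: "0 < h" unfolding h_def using assms by simp
  define r where "r = \<rho> + h"
  have "1 / \<rho> - 1 / r = h / (\<rho> * r)" unfolding r_def using assms h by (simp add: field_simps)
  also have "\<dots> \<le> h / 1"
    using assms h unfolding r_def by (intro divide_left_mono) (auto intro!: less_imp_le less_1_mult)
  finally have "- (1 / r) \<le> h - 1 / \<rho>" by simp
  then have "r - 1 / r \<le> \<rho> + 2 * h - 1 / \<rho>" unfolding r_def by simp
  also have "\<dots> < \<rho> + 4 * h - 1 / \<rho>" using h by simp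
  also have "\<dots> = 2 * (\<rho> - 1)"
    unfolding h_def using assms by (simp add: field_simps power2_eq_square)
  finally have 1: "(r - 1 / r) / 2 < \<rho> - 1" by simp
  \<comment> \<open>The midpoint of 1 and \<open>r / \<rho>\<close> leaves room on both sides: for a
    neighbourhood of positive width, and for a geometric ratio below 1.\<close>
  define \<sigma> where "\<sigma> = (1 + r / \<rho>) / 2"
  have rp: "1 < r / \<rho>" unfolding r_def using assms h by simp
  have "1 < (1 + q) / 2 \<and> (1 + q) / 2 < q" if "1 < q" for q :: real using that by simp
  from this[OF rp] have \<sigma>: "1 < \<sigma>" "\<sigma> < r / \<rho>" unfolding \<sigma>_def by blast+
  have 2: "\<rho> * \<sigma> < r" using \<sigma>(2) assms by (simp add: field_simps)
  \<comment> \<open>The first entry of the minimum is the solution of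
    \<open>2 + 2 * s = \<sigma> + 1 / \<sigma>\<close>.\<close>
  define s where "s = min ((\<sigma> - 1)\<^sup>2 / (2 * \<sigma>)) (\<rho> - 1)"
  have 3: "0 < s" unfolding s_def using \<sigma> assms by auto
  have "s \<le> (\<sigma> - 1)\<^sup>2 / (2 * \<sigma>)" unfolding s_def by (rule min.cobounded1)
  then have "2 + 2 * s \<le> 2 + 2 * ((\<sigma> - 1)\<^sup>2 / (2 * \<sigma>))" by linarith
  also have "\<dots> = \<sigma> + 1 / \<sigma>" using \<sigma> by (simp add: field_simps power2_eq_square)
  finally have 4: "2 + 2 * s \<le> \<sigma> + 1 / \<sigma>" .
  show ?thesis by (rule that[of \<sigma> r s]) (use \<sigma> 1 2 3 4 in \<open>auto simp: s_def\<close>)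
qed

lemma ellipse_parameters_uniform:
  fixes \<rho> :: "nat \<Rightarrow> real"
  assumes "\<And>i. i \<in> {1..n} \<Longrightarrow> 1 < \<rho> i"
  shows "\<exists>r \<sigma> s. 0 < s \<and> (\<forall>i\<in>{1..n}. 1 < \<rho> i \<and> 1 \<le> \<sigma> i \<and> \<rho> i * \<sigma> i < r i \<and>
      (r i - 1 / r i) / 2 < \<rho> i - 1 \<and> 2 + 2 * s \<le> \<sigma> i + 1 / \<sigma> i \<and> s \<le> \<rho> i - 1)"
proof -
  have "\<exists>r \<sigma> s. 1 \<le> \<sigma> \<and> \<rho> i * \<sigma> < r \<and> (r - 1 / r) / 2 < \<rho> i - 1 \<and> 0 < s \<and> 2 + 2 * s \<le> \<sigma> + 1 / \<sigma> \<and> s \<le> \<rho> i - 1"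
    if "i \<in> {1..n}" for i
    using ellipse_parameters[OF assms[OF that]] by metis
  then obtain r \<sigma> t where par: "\<And>i. i \<in> {1..n} \<Longrightarrow> 1 \<le> \<sigma> i \<and> \<rho> i * \<sigma> i < r i \<and> (r i - 1 / r i) / 2 < \<rho> i - 1 \<and>
      0 < t i \<and> 2 + 2 * t i \<le> \<sigma> i + 1 / \<sigma> i \<and> t i \<le> \<rho> i - 1"
    by metis
  \<comment> \<open>Inserting 1 keeps the set nonempty also for \<open>n = 0\<close>.\<close>
  define s where "s = Min (insert 1 (t ` {1..n}))"
  have s0: "0 < s" unfolding s_def using par by (subst Min_gr_iff) auto
  have st: "s \<le> t i" if "i \<in> {1..n}" for i unfolding s_def using that by (intro Min_le) auto
  have "1 < \<rho> i \<and> 1 \<le> \<sigma> i \<and> \<rho> i * \<sigma> i < r i \<and>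
      (r i - 1 / r i) / 2 < \<rho> i - 1 \<and> 2 + 2 * s \<le> \<sigma> i + 1 / \<sigma> i \<and> s \<le> \<rho> i - 1"
    if i: "i \<in> {1..n}" for i
    using par[OF i] st[OF i] assms[OF i] by linarith
  with s0 show ?thesis by blast
qed

text \<open>Because \<open>max 1 (\<nu> k) \<le> \<nu> k + 1\<close>, the modified last exponent
  costs at most one factor \<open>r k\<close>. Raising the threshold to
  \<open>r k * \<epsilon>\<close> pays for it, which changes only the constant of the error
  bound.\<close>

lemma index_simplex_subset_multi_index_set:
  assumes r: "\<And>j. j \<in> {1..k} \<Longrightarrow> 1 < r j" and k: "1 \<le> k" and \<epsilon>: "0 < \<epsilon>"
  shows "index_simplex k r (r k * \<epsilon>) \<subseteq> multi_index_set r k \<epsilon>"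
proof
  fix \<nu> assume \<nu>: "\<nu> \<in> index_simplex k r (r k * \<epsilon>)"
  have rp: "0 < r j" if "j \<in> {1..k}" for j using r[OF that] by simp
  have rk: "1 < r k" using r k by simp
  have K: "{1..k} = insert k {1..<k}" using k by auto
  define p where "p = (\<Prod>j\<in>{1..<k}. r j ^ \<nu> j)"
  have p: "0 < p" unfolding p_def by (intro prod_pos) (auto intro!: zero_less_power rp)
  have le: "r k * \<epsilon> * (r k ^ \<nu> k * p) \<le> 1"
    using \<nu> unfolding index_simplex_def K p_def by simp
  have inv: "(\<Prod>j\<in>{1..<k}. r j powi (- int (\<nu> j))) = 1 / p"
    unfolding p_def by (simp add: power_int_minus prod_inversef[symmetric] divide_inverse)
  have "max 1 (\<nu> k) \<le> Suc (\<nu> k)" by simp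
  then have "r k ^ max 1 (\<nu> k) \<le> r k ^ Suc (\<nu> k)" using rk by (intro power_increasing) auto
  then have "\<epsilon> * (r k ^ max 1 (\<nu> k) * p) \<le> \<epsilon> * (r k ^ Suc (\<nu> k) * p)"
    using p \<epsilon> by (intro mult_left_mono mult_right_mono) auto
  also have "\<dots> \<le> 1" using le by (simp add: mult_ac)
  finally have "\<epsilon> \<le> 1 / (r k ^ max 1 (\<nu> k) * p)"
    using p rk by (simp add: pos_le_divide_eq)
  then have "\<epsilon> \<le> r k powi (- int (max 1 (\<nu> k))) * (\<Prod>j\<in>{1..<k}. r j powi (- int (\<nu> j)))"
    unfolding inv unfolding power_int_minus power_int_of_nat by (simp add: divide_inverse)
  then show "\<nu> \<in> multi_index_set r k \<epsilon>" using \<nu> unfolding multi_index_set_def index_simplex_def by simp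
qed

lemma real_polynomial_facts:
  fixes c :: "(nat \<Rightarrow> nat) \<Rightarrow> real" and k :: nat
  assumes S: "finite S" "S \<subseteq> \<Lambda>"
  defines "p \<equiv> \<lambda>x. \<Sum>\<nu>\<in>S. c \<nu> * (\<Prod>j\<in>{1..k}. x j ^ \<nu> j)"
    and "P \<equiv> \<lambda>z. \<Sum>\<nu>\<in>S. complex_of_real (c \<nu>) * (\<Prod>j\<in>{1..k}. z j ^ \<nu> j)"
  shows "p \<in> polynomial_space k \<Lambda>"
    and "(\<And>z. z \<in> poly_stadium k s \<Longrightarrow> cmod (P z) \<le> B) \<Longrightarrow> sep_hol k s B P"
proof -
  show "p \<in> polynomial_space k \<Lambda>" unfolding polynomial_space_def p_def using S by blast
  show "sep_hol k s B P" if B: "\<And>z. z \<in> poly_stadium k s \<Longrightarrow> cmod (P z) \<le> B"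
  proof (rule sep_holI)
    fix z w :: "nat \<Rightarrow> complex" assume "\<And>i. i \<in> {1..k} \<Longrightarrow> z i = w i"
    then show "P z = P w"
      unfolding P_def by (intro sum.cong arg_cong2[where f = "(*)"] prod.cong) auto
  next
    fix z :: "nat \<Rightarrow> complex" and i
    have "(\<lambda>t. (z(i := t)) j) holomorphic_on A" for j A
      by (cases "j = i") auto
    then show "(\<lambda>t. P (z(i := t))) holomorphic_on stadium (s i)"
      unfolding P_def by (intro holomorphic_intros)
  qed (rule B)
qed

text \<open>
  The square root of the derivative \<open>R\<close> is approximated by \<open>1 + P\<close>. When \<open>\<epsilon>\<close> is too large for
  this to keep \<open>1 + P\<close> away from 0, the zero polynomial serves instead.
\<close>

lemma component_approximation:
  fixes T D :: "(nat \<Rightarrow> real) \<Rightarrow> real" and r :: "nat \<Rightarrow> real"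
  assumes k: "1 \<le> k" and r: "\<And>i. i \<in> {1..k} \<Longrightarrow> 1 < r i"
    and R: "sep_hol k (\<lambda>i. r i - 1) b R" and b: "0 \<le> b"
    and \<kappa>: "0 < \<kappa>" "\<kappa> \<le> 1" "\<And>z. z \<in> poly_stadium k (\<lambda>i. r i - 1) \<Longrightarrow> \<kappa> \<le> Re (R z)"
    and sym: "\<And>z. z \<in> poly_stadium k (\<lambda>i. r i - 1) \<Longrightarrow> cnj (R (\<lambda>i. cnj (z i))) = R z"
    and RD: "\<And>x. unit_box k x \<Longrightarrow> R (embed x) = of_real (D x)"
    and T: "\<And>x. unit_box k x \<Longrightarrow> T x = -1 + integral {-1..x k} (\<lambda>t. D (x(k := t)))"
    and total: "\<And>x. unit_box k x \<Longrightarrow> integral {-1..1} (\<lambda>t. D (x(k := t))) = 2"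
  obtains s K where "0 < s" "0 \<le> K" "\<And>\<epsilon>. \<epsilon> \<in> {0<..<1} \<Longrightarrow> \<exists>p\<in>polynomial_space k (multi_index_set r k \<epsilon>).
      (\<forall>x. unit_box k x \<longrightarrow> 0 < 1 + p x) \<and>
      (\<exists>E. sep_hol k (\<lambda>_. s) (K * \<epsilon>) E \<and>
        (\<forall>x. unit_box k x \<longrightarrow> Re (E (embed x)) = T x - approx_component p k x))"
proof -
  obtain q \<sigma> s where s: "0 < s" and pars: "\<forall>i\<in>{1..k}. 1 < r i \<and> 1 \<le> \<sigma> i \<and> r i * \<sigma> i < q i \<and>
      (q i - 1 / q i) / 2 < r i - 1 \<and> 2 + 2 * s \<le> \<sigma> i + 1 / \<sigma> i \<and> s \<le> r i - 1"
  proof -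
    have "\<exists>q \<sigma> s. 0 < s \<and> (\<forall>i\<in>{1..k}. 1 < r i \<and> 1 \<le> \<sigma> i \<and> r i * \<sigma> i < q i \<and>
      (q i - 1 / q i) / 2 < r i - 1 \<and> 2 + 2 * s \<le> \<sigma> i + 1 / \<sigma> i \<and> s \<le> r i - 1)"
      by (rule ellipse_parameters_uniform[OF r])
    then show ?thesis using that by (elim exE conjE)
  qed
  note par = bspec[OF pars]
  define \<zeta> where "\<zeta> = (\<lambda>i. r i - 1)"
  have kk: "k \<in> {1..k}" using k by simp
  have sub: "poly_stadium k (\<lambda>_. s) \<subseteq> poly_stadium k \<zeta>"
    using par unfolding \<zeta>_def by (intro poly_stadium_mono) auto
  note \<kappa>3 = \<kappa>(3)[folded \<zeta>_def] and sym' = sym[folded \<zeta>_def]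
  have R\<zeta>: "sep_hol k \<zeta> b R" using R unfolding \<zeta>_def .
  have nonneg: "R z \<notin> \<real>\<^sub>\<le>\<^sub>0" if "z \<in> poly_stadium k \<zeta>" for z
    using \<kappa>3[OF that] \<kappa>(1) by (auto simp: complex_nonpos_Reals_iff)
  define W where "W z = csqrt (R z)" for z
  have W: "sep_hol k \<zeta> (sqrt b) W"
    unfolding W_def
  proof (rule sep_hol_compose[OF R\<zeta>, where V = "- \<real>\<^sub>\<le>\<^sub>0"])
    show "csqrt holomorphic_on - \<real>\<^sub>\<le>\<^sub>0" by (rule holomorphic_on_csqrt)
    show "R z \<in> - \<real>\<^sub>\<le>\<^sub>0 \<and> cmod (csqrt (R z)) \<le> sqrt b" if "z \<in> poly_stadium k \<zeta>" for z
      using nonneg[OF that] sep_hol_bound[OF R\<zeta> that] by (simp add: norm_csqrt)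
  qed
  have W2: "W z * W z = R z" for z unfolding W_def by (simp flip: power2_eq_square)
  define b0 where "b0 = sqrt b + 1"
  have b0: "1 \<le> b0" unfolding b0_def using b by simp
  have Q: "sep_hol k \<zeta> b0 (\<lambda>z. W z - 1)"
    unfolding b0_def by (intro sep_hol_diff W sep_hol_const) auto
  have symQ: "cnj (W (\<lambda>i. cnj (z i)) - 1) = W z - 1" if z: "z \<in> poly_stadium k (\<lambda>_. s)" for z
  proof -
    have z': "(\<lambda>i. cnj (z i)) \<in> poly_stadium k \<zeta>"
      using z sub cnj_in_stadium unfolding poly_stadium_def by blast
    have "cnj (W (\<lambda>i. cnj (z i))) = W z"
      unfolding W_def using cnj_csqrt[OF nonneg[OF z']] sym'[of z] z sub by auto
    then show ?thesis by simp
  qed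
  obtain C where C: "0 \<le> C" and approx: "\<And>F B e. sep_hol k \<zeta> B F \<Longrightarrow> 0 \<le> B \<Longrightarrow> 0 < e \<Longrightarrow>
    \<exists>P\<in>cpoly k (index_simplex k r e). \<forall>z\<in>poly_stadium k (\<lambda>_. s). cmod (F z - P z) \<le> C * B * e"
  proof -
    have "\<exists>C\<ge>0. \<forall>F B e. sep_hol k \<zeta> B F \<longrightarrow> 0 \<le> B \<longrightarrow> 0 < e \<longrightarrow>
      (\<exists>P\<in>cpoly k (index_simplex k r e). \<forall>z\<in>poly_stadium k (\<lambda>_. s). cmod (F z - P z) \<le> C * B * e)"
      by (rule sep_hol_polynomial_approx) (unfold \<zeta>_def, rule par)
    then show ?thesis using that by (elim exE conjE) simp
  qed
  define B where "B = b0 + 1"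
  have B: "1 \<le> B" unfolding B_def using b0 by simp
  define N where "N = 2 + s"
  define \<eta>0 where "\<eta>0 = \<kappa> / (2 * N * B)"
  have N: "2 < N" unfolding N_def using s by simp
  have \<eta>0: "0 < \<eta>0" unfolding \<eta>0_def using \<kappa> N B by simp
  have \<eta>0le: "\<eta>0 \<le> \<kappa> / 4"
  proof -
    have "2 * 1 \<le> N * B" using N B by (intro mult_mono) auto
    then have "4 \<le> 2 * N * B" by linarith
    then show ?thesis unfolding \<eta>0_def using \<kappa>(1) by (intro frac_le) auto
  qed
  \<comment> \<open>The factor \<open>r k\<close> stems from the raised threshold
    \<open>r k * \<epsilon>\<close>; adding 1 makes the constant positive.\<close>
  define C1 where "C1 = C * b0 * r k + 1"
  have C1: "0 < C1" unfolding C1_def using C b0 r[OF kk] by (intro add_nonneg_pos mult_nonneg_nonneg) auto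
  define KE where "KE = 2 * (N / \<kappa> + N * (B * B) * N / \<kappa>\<^sup>2) * (2 * B)"
  have KE: "0 \<le> KE" unfolding KE_def using N B \<kappa> by (intro mult_nonneg_nonneg add_nonneg_nonneg) auto
  \<comment> \<open>One summand for each range of \<epsilon>. In the range
    \<open>C1 * \<epsilon> > \<eta>0\<close> the error is merely bounded, and multiplying that bound
    by \<open>C1 * \<epsilon> / \<eta>0 > 1\<close> makes it proportional to \<epsilon>.\<close>
  define K where "K = KE * (C1 + b0 * C1 / \<eta>0)"
  have K: "0 \<le> K" unfolding K_def using KE C1 b0 \<eta>0 by (intro mult_nonneg_nonneg add_nonneg_nonneg) auto
  have Wreal: "W (embed x) = of_real (sqrt (D x)) \<and> \<kappa> \<le> D x"
    if x: "unit_box k x" for x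
  proof -
    have z: "embed x \<in> poly_stadium k \<zeta>"
      by (rule of_real_in_poly_stadium[OF x]) (use r in \<open>auto simp: \<zeta>_def\<close>)
    have "\<kappa> \<le> D x" using \<kappa>3[OF z] RD[OF x] by simp
    moreover from this have "csqrt (of_real (D x)) = of_real (sqrt (D x))"
      using \<kappa>(1) by (intro of_real_sqrt[symmetric]) simp
    ultimately show ?thesis unfolding W_def RD[OF x] by simp
  qed
  have RS: "sep_hol k (\<lambda>_. s) b R" using par by (intro sep_hol_mono[OF R]) auto
  have square_diff: "cmod (R z - A z * A z) \<le> 2 * B * \<eta>"
    if z: "z \<in> poly_stadium k (\<lambda>_. s)" and A: "cmod (A z) \<le> B" and \<eta>: "cmod (W z - A z) \<le> \<eta>" for A z \<eta>
  proof -
    have "R z - A z * A z = (W z + A z) * (W z - A z)" unfolding W2[symmetric] by (simp add: algebra_simps)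
    moreover have "cmod (W z + A z) \<le> 2 * B"
      using norm_triangle_ineq[of "W z" "A z"] sep_hol_bound[OF W, of z] A z sub
      unfolding B_def b0_def by force
    ultimately show ?thesis using \<eta> B by (auto simp: norm_mult intro!: mult_mono)
  qed
  \<comment> \<open>Shared by both ranges of \<epsilon>: \<open>A\<close> is either \<open>1\<close>
    plus the polynomial or the constant 1.\<close>
  have main: "\<exists>E. sep_hol k (\<lambda>_. s) (KE * \<eta>) E \<and>
        (\<forall>x. unit_box k x \<longrightarrow> Re (E (embed x)) = T x - approx_component p k x)"
    if PB: "sep_hol k (\<lambda>_. s) B A" and Ap: "\<And>x. A (embed x) = of_real (1 + p x)"
      and \<eta>: "\<And>z. z \<in> poly_stadium k (\<lambda>_. s) \<Longrightarrow> cmod (W z - A z) \<le> \<eta>"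
      and cA: "\<And>z. z \<in> poly_stadium k (\<lambda>_. s) \<Longrightarrow> \<kappa> \<le> cmod (cprim k (\<lambda>z. A z * A z) (z(k := 1)))"
    for A p \<eta>
  proof -
    let ?F = R and ?G = "\<lambda>z. A z * A z"
    have GS: "sep_hol k (\<lambda>_. s) (B * B) ?G" by (intro sep_hol_mult PB)
    have cR: "\<kappa> \<le> cmod (cprim k R (z(k := 1)))" if z: "z \<in> poly_stadium k (\<lambda>_. s)" for z
    proof -
      have "2 * \<kappa> \<le> Re (cprim k R (z(k := 1)))"
        by (rule cprim_Re_ge[OF RS kk s z]) (use \<kappa>3 sub in auto)
      then show ?thesis using complex_Re_le_cmod[of "cprim k R (z(k := 1))"] \<kappa>(1) by linarith
    qed
    have diff: "cmod (R z - A z * A z) \<le> 2 * B * \<eta>" if "z \<in> poly_stadium k (\<lambda>_. s)" for z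
      by (intro square_diff that sep_hol_bound[OF PB] \<eta>)
    define E where "E z = 2 * (cprim k R z / cprim k R (z(k := 1)) - cprim k ?G z / cprim k ?G (z(k := 1)))" for z
    have "sep_hol k (\<lambda>_. s) (2 * ((2 + s) / \<kappa> + (2 + s) * (B * B) * (2 + s) / \<kappa>\<^sup>2) * (2 * B * \<eta>)) E"
      unfolding E_def by (rule sep_hol_normalised_cprim_diff[OF RS GS kk s \<kappa>(1) cR cA diff])
    then have ES: "sep_hol k (\<lambda>_. s) (KE * \<eta>) E" unfolding KE_def N_def by (simp only: mult.assoc)
    have "Re (E (embed x)) = T x - approx_component p k x"
      if x: "unit_box k x" for x
    proof -
      have upd: "(embed x)(k := 1) = embed (x(k := 1))" by auto
      have x1: "\<forall>i\<in>{1..k}. \<bar>(x(k := 1)) i\<bar> \<le> 1" using x by auto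
      have Gp: "A (embed y) * A (embed y) = of_real ((1 + p y)\<^sup>2)" for y
        unfolding Ap by (simp add: power2_eq_square)
      have pR: "cprim k R (embed y) = of_real (integral {-1..y k} (\<lambda>t. D (y(k := t))))"
        if "unit_box k y" for y
        by (rule cprim_real[OF RS kk s that RD])
      have pG: "cprim k ?G (embed y) = of_real (integral {-1..y k} (\<lambda>t. (1 + p (y(k := t)))\<^sup>2))"
        if "unit_box k y" for y
        by (rule cprim_real[OF GS kk s that Gp])
      have "E (embed x) =
          2 * (of_real (integral {-1..x k} (\<lambda>t. D (x(k := t)))) / of_real 2
            - of_real (integral {-1..x k} (\<lambda>t. (1 + p (x(k := t)))\<^sup>2)) / of_real (integral {-1..1} (\<lambda>t. (1 + p (x(k := t)))\<^sup>2)))"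
        unfolding E_def upd pR[OF x] pR[OF x1] pG[OF x] pG[OF x1] using total[OF x] by simp
      also have "\<dots> = of_real (integral {-1..x k} (\<lambda>t. D (x(k := t))) -
          2 / integral {-1..1} (\<lambda>t. (1 + p (x(k := t)))\<^sup>2) * integral {-1..x k} (\<lambda>t. (1 + p (x(k := t)))\<^sup>2))"
        by simp
      finally show ?thesis unfolding approx_component_def T[OF x] by simp
    qed
    then show ?thesis using ES by blast
  qed
  have kr: "0 < r k" using r[OF kk] by simp
  show ?thesis
  proof (rule that[OF s K])
    fix \<epsilon> :: real assume \<epsilon>: "\<epsilon> \<in> {0<..<1}"
    show "\<exists>p\<in>polynomial_space k (multi_index_set r k \<epsilon>).
      (\<forall>x. unit_box k x \<longrightarrow> 0 < 1 + p x) \<and>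
      (\<exists>E. sep_hol k (\<lambda>_. s) (K * \<epsilon>) E \<and>
        (\<forall>x. unit_box k x \<longrightarrow> Re (E (embed x)) = T x - approx_component p k x))"
    proof (cases "C1 * \<epsilon> \<le> \<eta>0")
      case True
      have "0 < r k * \<epsilon>" using kr \<epsilon> by simp
      then have "\<exists>P\<in>cpoly k (index_simplex k r (r k * \<epsilon>)). \<forall>z\<in>poly_stadium k (\<lambda>_. s).
          cmod ((W z - 1) - P z) \<le> C * b0 * (r k * \<epsilon>)"
        using b0 by (intro approx[OF Q]) auto
      then obtain P where P: "P \<in> cpoly k (index_simplex k r (r k * \<epsilon>))"
        "\<And>z. z \<in> poly_stadium k (\<lambda>_. s) \<Longrightarrow> cmod ((W z - 1) - P z) \<le> C * b0 * (r k * \<epsilon>)"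
        by blast
      obtain S c where S: "finite S" "S \<subseteq> index_simplex k r (r k * \<epsilon>)"
        and Sb: "\<And>z. z \<in> poly_stadium k (\<lambda>_. s) \<Longrightarrow>
          cmod ((W z - 1) - (\<Sum>\<nu>\<in>S. of_real (c \<nu>) * (\<Prod>j\<in>{1..k}. z j ^ \<nu> j))) \<le> C * b0 * (r k * \<epsilon>)"
      proof (rule real_polynomial_approx[OF P(1)])
        show "cnj (W (\<lambda>i. cnj (z i)) - 1) = W z - 1" if "z \<in> poly_stadium k (\<lambda>_. s)" for z
          by (rule symQ[OF that])
        show "cmod ((W z - 1) - P z) \<le> C * b0 * (r k * \<epsilon>)" if "z \<in> poly_stadium k (\<lambda>_. s)" for z
          by (rule P(2)[OF that])
      qed (rule that)
      define p where "p = (\<lambda>x. \<Sum>\<nu>\<in>S. c \<nu> * (\<Prod>j\<in>{1..k}. x j ^ \<nu> j))"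
      define P' where "P' = (\<lambda>z. \<Sum>\<nu>\<in>S. complex_of_real (c \<nu>) * (\<Prod>j\<in>{1..k}. z j ^ \<nu> j))"
      define A where "A z = 1 + P' z" for z
      have S': "S \<subseteq> multi_index_set r k \<epsilon>"
        using S(2) index_simplex_subset_multi_index_set[of k r \<epsilon>, OF r k] \<epsilon> by auto
      note poly = real_polynomial_facts[OF S(1) S', where c = c and k = k, folded p_def P'_def]
      have WA: "cmod (W z - A z) \<le> C1 * \<epsilon>" if z: "z \<in> poly_stadium k (\<lambda>_. s)" for z
      proof -
        have "cmod (W z - A z) \<le> C * b0 * (r k * \<epsilon>)" using Sb[OF z] unfolding A_def P'_def by (simp add: diff_diff_eq)
        also have "\<dots> \<le> C1 * \<epsilon>" unfolding C1_def using \<epsilon> by (simp add: algebra_simps)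
        finally show ?thesis .
      qed
      have small: "C1 * \<epsilon> \<le> \<kappa> / 4" using True \<eta>0le by simp
      have Wb: "cmod (W z) \<le> sqrt b" if z: "z \<in> poly_stadium k (\<lambda>_. s)" for z
        using sep_hol_bound[OF W] z sub by blast
      have Ab: "cmod (A z) \<le> B" if z: "z \<in> poly_stadium k (\<lambda>_. s)" for z
        using norm_triangle_ineq4[of "W z" "W z - A z"] WA[OF z] Wb[OF z] small \<kappa>(2)
        unfolding B_def b0_def by simp
      have "cmod (P' z) \<le> B + 1" if z: "z \<in> poly_stadium k (\<lambda>_. s)" for z
        using norm_triangle_ineq4[of "A z" 1] Ab[OF z] unfolding A_def by simp
      then have "sep_hol k (\<lambda>_. s) (B + 1) P'" unfolding P'_def by (rule poly(2)[unfolded P'_def])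
      then have "sep_hol k (\<lambda>_. s) (1 + (B + 1)) A"
        unfolding A_def by (intro sep_hol_add sep_hol_const) auto
      then have AS: "sep_hol k (\<lambda>_. s) B A" using Ab by (rule sep_hol_rebound)
      have Ap: "A (embed x) = of_real (1 + p x)" for x
        unfolding A_def P'_def p_def by simp
      have cA: "\<kappa> \<le> cmod (cprim k (\<lambda>z. A z * A z) (z(k := 1)))" if z: "z \<in> poly_stadium k (\<lambda>_. s)" for z
      proof -
        have z1: "z(k := 1) \<in> poly_stadium k (\<lambda>_. s)"
          using of_real_in_stadium[OF s, of 1] by (intro poly_stadium_upd z) simp
        have GS: "sep_hol k (\<lambda>_. s) (B * B) (\<lambda>z. A z * A z)" by (intro sep_hol_mult AS)
        have D: "sep_hol k (\<lambda>_. s) (2 * B * (C1 * \<epsilon>)) (\<lambda>z. R z - A z * A z)"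
        proof (rule sep_hol_rebound[OF sep_hol_diff[OF RS GS]])
          show "cmod (R z - A z * A z) \<le> 2 * B * (C1 * \<epsilon>)" if "z \<in> poly_stadium k (\<lambda>_. s)" for z
            by (intro square_diff that Ab WA)
        qed
        have "2 * \<kappa> \<le> Re (cprim k R (z(k := 1)))"
          by (rule cprim_Re_ge[OF RS kk s z]) (use \<kappa>3 sub in auto)
        then have 1: "2 * \<kappa> \<le> cmod (cprim k R (z(k := 1)))" using complex_Re_le_cmod order_trans by blast
        have "cmod (cprim k R (z(k := 1)) - cprim k (\<lambda>z. A z * A z) (z(k := 1))) \<le> (2 + s) * (2 * B * (C1 * \<epsilon>))"
          unfolding cprim_diff[OF RS GS kk s z1] by (rule sep_hol_bound[OF sep_hol_cprim[OF D kk s] z1])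
        also have "\<dots> \<le> (2 + s) * (2 * B * \<eta>0)"
          using True B s by (intro mult_left_mono) auto
        also have "\<dots> = \<kappa>" unfolding N_def[symmetric] \<eta>0_def using B N by (simp add: field_simps)
        finally show ?thesis
          using 1 norm_triangle_ineq2[of "cprim k R (z(k := 1))" "cprim k (\<lambda>z. A z * A z) (z(k := 1))"] by linarith
      qed
      have "0 < 1 + p x" if x: "unit_box k x" for x
      proof -
        have z: "embed x \<in> poly_stadium k (\<lambda>_. s)"
          by (rule of_real_in_poly_stadium[OF x s])
        have "\<bar>sqrt (D x) - (1 + p x)\<bar> \<le> C1 * \<epsilon>"
          using WA[OF z] unfolding conjunct1[OF Wreal[OF x]] Ap of_real_diff[symmetric] norm_of_real .
        then have "\<bar>sqrt (D x) - (1 + p x)\<bar> \<le> \<kappa> / 4" using small by linarith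
        \<comment> \<open>Here \<open>\<kappa> \<le> 1\<close> enters: it gives
          \<open>\<kappa> * \<kappa> \<le> \<kappa>\<close>, so the square root inherits the lower
          bound of \<open>D\<close>.\<close>
        moreover have "\<kappa> \<le> sqrt (D x)"
        proof -
          have "\<kappa> * \<kappa> \<le> \<kappa> * 1" using \<kappa> by (intro mult_left_mono) auto
          then have "\<kappa>\<^sup>2 \<le> D x" using Wreal[OF x] by (simp add: power2_eq_square)
          then show ?thesis by (rule real_le_rsqrt)
        qed
        ultimately show ?thesis using \<kappa>(1) by linarith
      qed
      moreover obtain E where E: "sep_hol k (\<lambda>_. s) (KE * (C1 * \<epsilon>)) E"
        "\<forall>x. unit_box k x \<longrightarrow> Re (E (embed x)) = T x - approx_component p k x"
        using main[OF AS Ap WA cA] by blast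
      moreover have "KE * (C1 * \<epsilon>) \<le> K * \<epsilon>"
      proof -
        have "KE * C1 \<le> K" unfolding K_def using KE C1 b0 \<eta>0 by (intro mult_left_mono) auto
        then show ?thesis using \<epsilon> by (simp add: mult.assoc[symmetric] mult_right_mono)
      qed
      then have "sep_hol k (\<lambda>_. s) (K * \<epsilon>) E" using E(1) by (intro sep_hol_mono[OF E(1)]) auto
      ultimately show ?thesis using poly(1) by blast
    next
      case False
      define p where "p = (\<lambda>x :: nat \<Rightarrow> real. 0 :: real)"
      have pS: "p \<in> polynomial_space k (multi_index_set r k \<epsilon>)"
        using real_polynomial_facts(1)[of "{}" "multi_index_set r k \<epsilon>"] unfolding p_def by simp
      have AS: "sep_hol k (\<lambda>_. s) B (\<lambda>_. 1)" using B by (intro sep_hol_const) simp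
      have WA: "cmod (W z - 1) \<le> b0" if "z \<in> poly_stadium k (\<lambda>_. s)" for z
        using sep_hol_bound[OF Q] that sub by blast
      have cA: "\<kappa> \<le> cmod (cprim k (\<lambda>z. 1 * 1) (z(k := 1)))" for z
        unfolding cprim_def using \<kappa> by simp
      obtain E where E: "sep_hol k (\<lambda>_. s) (KE * b0) E"
        "\<forall>x. unit_box k x \<longrightarrow> Re (E (embed x)) = T x - approx_component p k x"
        using main[OF AS _ WA cA, of p] unfolding p_def by auto
      moreover have "KE * b0 \<le> K * \<epsilon>"
      proof -
        have "1 \<le> C1 * \<epsilon> / \<eta>0" using False \<eta>0 by simp
        then have "b0 * 1 \<le> b0 * (C1 * \<epsilon> / \<eta>0)" using b0 by (intro mult_left_mono) auto
        also have "\<dots> \<le> (C1 + b0 * C1 / \<eta>0) * \<epsilon>" using C1 \<epsilon> by (simp add: distrib_right mult.assoc)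
        finally show ?thesis unfolding K_def using KE by (simp add: mult.assoc mult_left_mono)
      qed
      then have "sep_hol k (\<lambda>_. s) (K * \<epsilon>) E" by (intro sep_hol_mono[OF E(1)]) auto
      moreover have "0 < 1 + p x" for x unfolding p_def by simp
      ultimately show ?thesis using pS by blast
    qed
  qed
qed

section \<open>The components of the Knothe-Rosenblatt transport\<close>

lemma KR_component_approximation:
  assumes d: "k \<in> {1..d}" and M: "0 < M" and reg: "regularity_constants M L C6 C7 C8"
    and \<delta>: "\<forall>j\<in>{1..d}. 0 < \<delta> j" and A: "assumption_A d M L \<delta> C6 f" "assumption_A d M L \<delta> C6 g"
    and r: "\<forall>j\<in>{1..d}. r j = 1 + C7 * \<delta> j"
  obtains s K where "0 < s" "0 \<le> K" "\<And>\<epsilon>. \<epsilon> \<in> {0<..<1} \<Longrightarrow> \<exists>p\<in>polynomial_space k (multi_index_set r k \<epsilon>).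
      (\<forall>x. unit_box k x \<longrightarrow> 0 < 1 + p x) \<and>
      (\<exists>E. sep_hol k (\<lambda>_. s) (K * \<epsilon>) E \<and>
        (\<forall>x. unit_box k x \<longrightarrow>
          Re (E (embed x)) = KR_transport d f g k x - approx_component p k x))"
proof -
  interpret F: bounded_density d f M L by (rule assumption_A_bounded_density[OF A(1) \<delta> M])
  interpret G: bounded_density d g M L by (rule assumption_A_bounded_density[OF A(2) \<delta> M])
  interpret density_pair d f g M L ..
  have k1: "1 \<le> k" and kd: "k \<le> d" and kk: "k \<in> {1..k}" using d by auto
  have C7: "0 < C7" and C8: "0 < C8" using reg unfolding regularity_constants_def by auto
  have C7\<delta>: "0 < C7 * \<delta> i" if "i \<in> {1..k}" for i using C7 \<delta> that kd by auto
  have r\<delta>: "r i - 1 = C7 * \<delta> i" if "i \<in> {1..k}" for i using r that kd by auto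
  let ?U = "\<Pi>\<^sub>E i\<in>{1..k}. stadium (C7 * \<delta> i)"
  let ?T = "KR_transport d f g k"
  obtain R where RT: "\<forall>x\<in>cube k. \<exists>D. ((\<lambda>t. ?T (x(k := t))) has_real_derivative D) (at (x k) within {-1..1}) \<and>
        R (cplx k x) = complex_of_real D"
    and Rhol: "holomorphic_vars_on k R ?U"
    and Rbd: "\<forall>z\<in>?U. R z \<in> nbhd C8 {1} \<and> 1 / C8 \<le> Re (R z)"
  proof -
    have "1 \<le> d" using d by auto
    note reg[unfolded regularity_constants_def, THEN conjunct2, THEN conjunct2, THEN conjunct2,
        THEN spec, THEN spec, THEN spec, THEN spec, THEN mp, OF this, THEN mp, OF \<delta>,
        THEN mp, OF A(1), THEN mp, OF A(2), THEN bspec, OF d]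
    then show ?thesis by (elim exE conjE) (rule that)
  qed
  define R1 where "R1 z = R (restrict z {1..k})" for z
  \<comment> \<open>Averaging with the reflection enforces the symmetry under conjugation directly,
    without an identity theorem in several variables. It preserves the values on the cube, which are
    real, and the bounds on modulus and real part.\<close>
  define R2 where "R2 z = (R1 z + cnj (R1 (\<lambda>i. cnj (z i)))) / 2" for z
  have mem: "restrict z {1..k} \<in> ?U" if "z \<in> poly_stadium k (\<lambda>i. C7 * \<delta> i)" for z
    using that unfolding poly_stadium_def by auto
  have PS: "poly_stadium k (\<lambda>i. r i - 1) = poly_stadium k (\<lambda>i. C7 * \<delta> i)"
    unfolding poly_stadium_def using r\<delta> by auto
  have Rb: "cmod (R z) \<le> 1 + C8" if "z \<in> ?U" for z
  proof -
    have "cmod (R z - 1) < C8" using Rbd that unfolding nbhd_def by auto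
    then show ?thesis using norm_triangle_ineq[of "R z - 1" 1] by simp
  qed
  have R1: "sep_hol k (\<lambda>i. C7 * \<delta> i) (1 + C8) R1"
    unfolding R1_def by (rule holomorphic_vars_on_imp_sep_hol[OF Rhol Rb])
  have R2: "sep_hol k (\<lambda>i. C7 * \<delta> i) ((1 + C8 + (1 + C8)) * (1 / 2)) R2"
  proof -
    have "sep_hol k (\<lambda>i. C7 * \<delta> i) ((1 + C8 + (1 + C8)) * (1 / 2)) (\<lambda>z. (R1 z + cnj (R1 (\<lambda>i. cnj (z i)))) * (1 / 2))"
      by (intro sep_hol_mult sep_hol_add R1 sep_hol_cnj sep_hol_const) simp
    then show ?thesis unfolding R2_def by simp
  qed
  have R2': "sep_hol k (\<lambda>i. r i - 1) (1 + C8) R2"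
    by (rule sep_hol_mono[OF R2]) (use r\<delta> in auto)
  have Re1: "1 / C8 \<le> Re (R1 z)" if "z \<in> poly_stadium k (\<lambda>i. C7 * \<delta> i)" for z
    unfolding R1_def using Rbd mem[OF that] by blast
  \<comment> \<open>The minimum with 1 provides the bound \<open>\<kappa> \<le> 1\<close> demanded
    by \<open>component_approximation\<close>.\<close>
  have Re2: "min 1 (1 / C8) \<le> Re (R2 z)" if z: "z \<in> poly_stadium k (\<lambda>i. r i - 1)" for z
  proof -
    have z': "(\<lambda>i. cnj (z i)) \<in> poly_stadium k (\<lambda>i. C7 * \<delta> i)"
      using z[unfolded PS] cnj_in_stadium unfolding poly_stadium_def by auto
    have "Re (R2 z) = (Re (R1 z) + Re (R1 (\<lambda>i. cnj (z i)))) / 2" unfolding R2_def by simp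
    then have "1 / C8 \<le> Re (R2 z)" using Re1[OF z[unfolded PS]] Re1[OF z'] by argo
    then show ?thesis by (rule order_trans[OF min.cobounded2])
  qed
  have sym: "cnj (R2 (\<lambda>i. cnj (z i))) = R2 z" for z
    unfolding R2_def by (simp add: add.commute)
  \<comment> \<open>Regularity speaks of extensional points of \<open>cube k\<close>, the
    approximation lemma of arbitrary points of the unit box; restriction translates between
    them.\<close>
  define D where "D x = Re (R (cplx k (restrict x {1..k})))" for x
  have restrict_emb: "restrict (embed x) {1..k} = cplx k (restrict x {1..k})" for x
    unfolding cplx_def by auto
  have cubex: "restrict x {1..k} \<in> cube k" if "unit_box k x" for x
    using that unfolding cube_def by (auto simp: abs_le_iff)
  have RD: "R (cplx k (restrict x {1..k})) = of_real (D x)" if x: "unit_box k x" for x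
    using RT cubex[OF x] unfolding D_def by fastforce
  have R2D: "R2 (embed x) = of_real (D x)" if x: "unit_box k x" for x
    unfolding R2_def R1_def complex_cnj_complex_of_real restrict_emb RD[OF x] by simp
  have der: "((\<lambda>t. ?T (x(k := t))) has_real_derivative D x) (at (x k) within {-1..1})"
    if x: "unit_box k x" for x
  proof -
    obtain D' where D': "((\<lambda>t. ?T ((restrict x {1..k})(k := t))) has_real_derivative D') (at (restrict x {1..k} k) within {-1..1})"
      "R (cplx k (restrict x {1..k})) = complex_of_real D'"
      using RT cubex[OF x] by blast
    have "D' = D x" using D'(2) unfolding D_def by simp
    moreover have "?T ((restrict x {1..k})(k := t)) = ?T (x(k := t))" for t
      using k1 by (intro KR_transport_cong) auto
    moreover have "restrict x {1..k} k = x k" using kk by simp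
    ultimately show ?thesis using D'(1) by simp
  qed
  have ftc: "integral {-1..c} (\<lambda>t. D (x(k := t))) = ?T (x(k := c)) + 1"
    if x: "unit_box k x" and c: "\<bar>c\<bar> \<le> 1" for x c
  proof -
    have "((\<lambda>t. D (x(k := t))) has_integral ?T (x(k := c)) - ?T (x(k := -1))) {-1..c}"
    proof (rule fundamental_theorem_of_calculus)
      fix t assume t: "t \<in> {-1..c}"
      have "\<forall>i\<in>{1..k}. \<bar>(x(k := t)) i\<bar> \<le> 1" using x t c by auto
      with der[of "x(k := t)"] have "((\<lambda>t. ?T (x(k := t))) has_real_derivative D (x(k := t))) (at t within {-1..1})"
        by (simp only: fun_upd_upd fun_upd_same)
      then have "((\<lambda>t. ?T (x(k := t))) has_real_derivative D (x(k := t))) (at t within {-1..c})"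
        by (rule DERIV_subset) (use c in auto)
      then show "((\<lambda>t. ?T (x(k := t))) has_vector_derivative D (x(k := t))) (at t within {-1..c})"
        by (simp add: has_real_derivative_iff_has_vector_derivative)
    qed (use c in auto)
    moreover have "?T (x(k := -1)) = -1"
      using x by (intro KR_transport_endpoints(1) k1 kd) auto
    ultimately show ?thesis by (simp add: integral_unique)
  qed
  show ?thesis
  proof (rule component_approximation[OF k1 _ R2' _ _ _ Re2 sym R2D])
    show "1 < r i" if "i \<in> {1..k}" for i using C7\<delta>[OF that] r\<delta>[OF that] by simp
    show "0 \<le> 1 + C8" "0 < min 1 (1 / C8)" "min 1 (1 / C8) \<le> 1" using C8 by auto
    show "?T x = -1 + integral {-1..x k} (\<lambda>t. D (x(k := t)))" if x: "unit_box k x" for x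
      using ftc[OF x, of "x k"] x kk by simp
    show "integral {-1..1} (\<lambda>t. D (x(k := t))) = 2" if x: "unit_box k x" for x
    proof -
      have "?T (x(k := 1)) = 1" using x by (intro KR_transport_endpoints(2) k1 kd) auto
      then show ?thesis using ftc[OF x, of 1] by simp
    qed
  qed (assumption | rule that)+
qed

theorem theorem4p5:
  fixes d m :: nat
    and M L C6 C7 C8 \<beta> :: real
    and \<delta> r :: "nat \<Rightarrow> real"
    and \<rho> \<pi> :: "(nat \<Rightarrow> real) measure"
    and f\<^sub>\<rho> f\<^sub>\<pi> :: "(nat \<Rightarrow> real) \<Rightarrow> real"
  assumes "1 \<le> d"
    and "0 < M" and "M \<le> L"
    and "regularity_constants M L C6 C7 C8"
    and "\<forall>j\<in>{1..d}. 0 < \<delta> j"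
    and "assumption_A d M L \<delta> C6 f\<^sub>\<rho>" and "assumption_A d M L \<delta> C6 f\<^sub>\<pi>"
    and "\<rho> = density (cube_measure {1..d}) (\<lambda>x. ennreal (f\<^sub>\<rho> x))"
    and "\<pi> = density (cube_measure {1..d}) (\<lambda>x. ennreal (f\<^sub>\<pi> x))"
    and "\<forall>j\<in>{1..d}. r j = 1 + C7 * \<delta> j"
    and "\<beta> = (fact (d - 1) * (\<Prod>j\<in>{1..d}. ln (r j))) powr (1 / real d)"
  shows "\<forall>\<beta>'<\<beta>. \<exists>C>0. \<forall>\<epsilon>\<in>{0<..<1}. \<exists>p.
           (\<forall>k\<in>{1..d}. p k \<in> polynomial_space k (multi_index_set r k \<epsilon>)) \<and>
           monotone_triangular d (approx_map d p) \<and>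
           bij_betw (approx_map d p) (cube d) (cube d) \<and>
           sobolev_norm_vec d m (\<lambda>x k. KR_transport d f\<^sub>\<rho> f\<^sub>\<pi> k x - approx_map d p x k)
             \<le> ereal (C * exp (- \<beta>' *
                 real (\<Sum>k\<in>{1..d}. card (multi_index_set r k \<epsilon>)) powr (1 / real d)))"
proof -
  have C7: "0 < C7" using assms(4) unfolding regularity_constants_def by auto
  have r1: "1 < r j" if "j \<in> {1..d}" for j using assms(5,10) C7 that by auto
  \<comment> \<open>The width \<open>s\<close> and the constant \<open>K\<close> are fixed before
    \<epsilon>; otherwise the final constant could depend on it.\<close>
  let ?good = "\<lambda>k s K. 0 < s \<and> 0 \<le> K \<and> (\<forall>\<epsilon>\<in>{0<..<1}. \<exists>p\<in>polynomial_space k (multi_index_set r k \<epsilon>).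
      (\<forall>x. unit_box k x \<longrightarrow> 0 < 1 + p x) \<and>
      (\<exists>E. sep_hol k (\<lambda>_. s) (K * \<epsilon>) E \<and>
        (\<forall>x. unit_box k x \<longrightarrow>
          Re (E (embed x)) = KR_transport d f\<^sub>\<rho> f\<^sub>\<pi> k x - approx_component p k x)))"
  have "\<exists>s K. ?good k s K" if "k \<in> {1..d}" for k
    by (rule KR_component_approximation[OF that assms(2,4,5,6,7,10)]) blast
  then obtain s K where good: "\<And>k. k \<in> {1..d} \<Longrightarrow> ?good k (s k) (K k)" by metis
  have "\<exists>C\<ge>0. \<forall>F B f. sep_hol d (\<lambda>_. s k) B F \<longrightarrow> 0 \<le> B \<longrightarrow>
      (\<forall>x\<in>cube d. f x = Re (F (embed x))) \<longrightarrow> sobolev_norm d m f \<le> ereal (C * B)"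
    if k: "k \<in> {1..d}" for k
  proof -
    \<comment> \<open>Half of the width is kept as the final domain and the other half pays for
      \<open>m\<close> derivatives; the denominator \<open>m + 1\<close> also covers
      \<open>m = 0\<close>.\<close>
    have t: "0 < s k / 2" and q: "0 < s k / (2 * (real m + 1))" using good[OF k] by auto
    have le: "s k / 2 + real m * (s k / (2 * (real m + 1))) \<le> s k"
    proof -
      have "real m / (real m + 1) * (s k / 2) \<le> 1 * (s k / 2)" using t by (intro mult_right_mono) auto
      moreover have "real m * (s k / (2 * (real m + 1))) = real m / (real m + 1) * (s k / 2)"
        by (simp only: times_divide_eq_right times_divide_times_eq times_divide_eq_left divide_divide_eq_left mult.commute)
      ultimately show ?thesis by linarith
    qed
    obtain C where C: "0 \<le> C" "\<And>F B f. sep_hol d (\<lambda>_. s k / 2 + real m * (s k / (2 * (real m + 1)))) B F \<Longrightarrow> 0 \<le> B \<Longrightarrow>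
      (\<And>x. x \<in> cube d \<Longrightarrow> f x = Re (F (embed x))) \<Longrightarrow> sobolev_norm d m f \<le> ereal (C * B)"
      using sobolev_norm_bound[OF t q, of d m] by blast
    have "sobolev_norm d m f \<le> ereal (C * B)"
      if "sep_hol d (\<lambda>_. s k) B F" "0 \<le> B" "\<forall>x\<in>cube d. f x = Re (F (embed x))" for F B f
      by (rule C(2)[OF sep_hol_mono[OF that(1)] that(2)]) (use le that(3) in auto)
    with C(1) show ?thesis by blast
  qed
  then obtain C where C: "\<And>k. k \<in> {1..d} \<Longrightarrow> 0 \<le> C k" "\<And>k F B f. k \<in> {1..d} \<Longrightarrow> sep_hol d (\<lambda>_. s k) B F \<Longrightarrow> 0 \<le> B \<Longrightarrow>
      \<forall>x\<in>cube d. f x = Re (F (embed x)) \<Longrightarrow> sobolev_norm d m f \<le> ereal (C k * B)"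
    by metis
  obtain K' where K': "0 \<le> K'" "\<And>\<epsilon>. \<epsilon> \<in> {0<..<1} \<Longrightarrow>
      \<beta> * real (\<Sum>k\<in>{1..d}. card (multi_index_set r k \<epsilon>)) powr (1 / real d) \<le> ln (1 / \<epsilon>) + K'"
    using multi_index_count[OF assms(1) r1 assms(11)] by blast
  \<comment> \<open>The factor \<open>exp K'\<close> compensates the additive constant in the count,
    and the summand 1 keeps \<open>C0\<close> positive even if all \<open>C k * K k\<close>
    vanish.\<close>
  define C0 where "C0 = ((\<Sum>k\<in>{1..d}. C k * K k) + 1) * exp K'"
  have sum0: "0 \<le> (\<Sum>k\<in>{1..d}. C k * K k)"
    using C(1) good by (intro sum_nonneg mult_nonneg_nonneg) auto
  have C0: "0 < C0" unfolding C0_def using sum0 by simp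
  show ?thesis
  proof (intro allI impI exI[of _ C0] conjI C0 ballI)
    fix \<beta>' \<epsilon> :: real
    assume \<beta>': "\<beta>' < \<beta>" and \<epsilon>: "\<epsilon> \<in> {0<..<1}"
    have "\<exists>p\<in>polynomial_space k (multi_index_set r k \<epsilon>).
      (\<forall>x. unit_box k x \<longrightarrow> 0 < 1 + p x) \<and>
      (\<exists>E. sep_hol k (\<lambda>_. s k) (K k * \<epsilon>) E \<and>
        (\<forall>x. unit_box k x \<longrightarrow>
          Re (E (embed x)) = KR_transport d f\<^sub>\<rho> f\<^sub>\<pi> k x - approx_component p k x))"
      if "k \<in> {1..d}" for k
      using good[OF that] \<epsilon> by blast
    then obtain p E where p: "\<And>k. k \<in> {1..d} \<Longrightarrow> p k \<in> polynomial_space k (multi_index_set r k \<epsilon>)"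
      and pos: "\<And>k x. k \<in> {1..d} \<Longrightarrow> unit_box k x \<Longrightarrow> 0 < 1 + p k x"
      and E: "\<And>k. k \<in> {1..d} \<Longrightarrow> sep_hol k (\<lambda>_. s k) (K k * \<epsilon>) (E k)"
      and err: "\<And>k x. k \<in> {1..d} \<Longrightarrow> unit_box k x \<Longrightarrow>
          Re (E k (embed x)) = KR_transport d f\<^sub>\<rho> f\<^sub>\<pi> k x - approx_component (p k) k x"
      by metis
    have bound: "sobolev_norm d m (\<lambda>x. KR_transport d f\<^sub>\<rho> f\<^sub>\<pi> k x - approx_map d p x k) \<le> ereal (C k * K k * \<epsilon>)"
      if k: "k \<in> {1..d}" for k
    proof -
      have "sep_hol d (\<lambda>_. s k) (K k * \<epsilon>) (E k)"
        using k by (intro sep_hol_mono[OF E[OF k]]) auto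
      moreover have "0 \<le> K k * \<epsilon>" using good[OF k] \<epsilon> by auto
      moreover have "\<forall>x\<in>cube d. KR_transport d f\<^sub>\<rho> f\<^sub>\<pi> k x - approx_map d p x k = Re (E k (embed x))"
      proof
        fix x assume x: "x \<in> cube d"
        have "unit_box k x" using cubeD[OF x] k by auto
        from err[OF k this]
        show "KR_transport d f\<^sub>\<rho> f\<^sub>\<pi> k x - approx_map d p x k = Re (E k (embed x))"
          unfolding approx_map_def using k by simp
      qed
      ultimately have "sobolev_norm d m (\<lambda>x. KR_transport d f\<^sub>\<rho> f\<^sub>\<pi> k x - approx_map d p x k) \<le> ereal (C k * (K k * \<epsilon>))"
        by (rule C(2)[OF k])
      then show ?thesis by (simp only: mult.assoc)
    qed
    let ?N = "real (\<Sum>k\<in>{1..d}. card (multi_index_set r k \<epsilon>)) powr (1 / real d)"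
    have "sobolev_norm_vec d m (\<lambda>x k. KR_transport d f\<^sub>\<rho> f\<^sub>\<pi> k x - approx_map d p x k)
        \<le> (\<Sum>k\<in>{1..d}. ereal (C k * K k * \<epsilon>))"
      unfolding sobolev_norm_vec_def by (intro sum_mono bound)
    also have "\<dots> = ereal ((\<Sum>k\<in>{1..d}. C k * K k) * \<epsilon>)" by (simp add: sum_distrib_right)
    also have "\<dots> \<le> ereal (C0 * exp (- \<beta>' * ?N))"
    proof -
      have "\<beta>' * ?N \<le> \<beta> * ?N" using \<beta>' by (intro mult_right_mono) auto
      also have "\<dots> \<le> ln (1 / \<epsilon>) + K'" by (rule K'(2)[OF \<epsilon>])
      finally have "- (ln (1 / \<epsilon>) + K') \<le> - \<beta>' * ?N" by simp
      then have "exp (- (ln (1 / \<epsilon>) + K')) \<le> exp (- \<beta>' * ?N)" by (simp only: exp_le_cancel_iff)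
      moreover have "exp (- (ln (1 / \<epsilon>) + K')) = \<epsilon> * exp (- K')"
        using \<epsilon> by (simp add: ln_div exp_diff exp_minus divide_inverse)
      ultimately have "\<epsilon> * exp (- K') \<le> exp (- \<beta>' * ?N)" by (simp only:)
      then have "C0 * (\<epsilon> * exp (- K')) \<le> C0 * exp (- \<beta>' * ?N)"
        by (rule mult_left_mono) (rule less_imp_le[OF C0])
      moreover have "C0 * (\<epsilon> * exp (- K')) = ((\<Sum>k\<in>{1..d}. C k * K k) + 1) * \<epsilon>"
        unfolding C0_def by (simp add: exp_minus)
      moreover have "(\<Sum>k\<in>{1..d}. C k * K k) * \<epsilon> \<le> ((\<Sum>k\<in>{1..d}. C k * K k) + 1) * \<epsilon>"
        using \<epsilon> by (intro mult_right_mono) auto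
      ultimately show ?thesis by simp
    qed
    finally have "sobolev_norm_vec d m (\<lambda>x k. KR_transport d f\<^sub>\<rho> f\<^sub>\<pi> k x - approx_map d p x k)
        \<le> ereal (C0 * exp (- \<beta>' * ?N))" .
    moreover have "monotone_triangular d (approx_map d p)" "bij_betw (approx_map d p) (cube d) (cube d)"
      by (rule approx_map_monotone_bijection[where \<Lambda> = "\<lambda>k. multi_index_set r k \<epsilon>"]; (rule p pos, assumption+))+
    moreover have "\<forall>k\<in>{1..d}. p k \<in> polynomial_space k (multi_index_set r k \<epsilon>)" using p by blast
    ultimately show "\<exists>p. (\<forall>k\<in>{1..d}. p k \<in> polynomial_space k (multi_index_set r k \<epsilon>)) \<and>
           monotone_triangular d (approx_map d p) \<and>
           bij_betw (approx_map d p) (cube d) (cube d) \<and>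
           sobolev_norm_vec d m (\<lambda>x k. KR_transport d f\<^sub>\<rho> f\<^sub>\<pi> k x - approx_map d p x k)
             \<le> ereal (C0 * exp (- \<beta>' * ?N))"
      by (intro exI[of _ p] conjI)
  qed
qed

end
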